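(* If $\mu$ is square free attainable, then $$2\hat\mu(4)^2-1\le \hat\mu(8)\le M(\hat\mu(4)),\qquad M(x):=\max\big(x^4,(2|x|-1)^2\big).$$ Conversely, for all real $x,y$ with $|x|\le 1$ and $2x^2-1\le y\le M(x)$ there exists a square free attainable measure $\mu$ with $(\hat\mu(4),\hat\mu(8))=(x,y)$.
   Context: Let $S$ be the set of nonzero integers expressible as a sum of two integer squares. For $n\in S$ let $\Lambda_n=\{a+bi\in\mathbb{Z}[i]: a^2+b^2=n\}$, $r_2(n)=|\Lambda_n|$, and $\mu_n=\frac{1}{r_2(n)}\sum_{\lambda\in\Lambda_n}\delta_{\lambda/\sqrt n}$, a probability measure on $\mathcal{S}^1=\{z\in\mathbb{C}:|z|=1\}$. A probability measure $\mu$ on $\mathcal{S}^1$ is square free attainable if there is a sequence $(n_j)$ of square free elements of $S$ with $\mu_{n_j}\to\mu$ weakly. Fourier coefficients: $\hat\mu(k)=\int_{\mathcal{S}^1} z^{-k}\,d\mu(z)$. *)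

theory Defs
  imports "HOL-Probability.Probability" "HOL-Computational_Algebra.Squarefree"
begin

definition sums_of_two_squares :: "int set" where
  "sums_of_two_squares = {n. n \<noteq> 0 \<and> (\<exists>a b :: int. n = a\<^sup>2 + b\<^sup>2)}"

text \<open>Gaussian integers are represented as complex numbers with integral coordinates.\<close>

definition gauss_points :: "int \<Rightarrow> complex set" where
  "gauss_points n = {Complex (of_int a) (of_int b) | a b :: int. a\<^sup>2 + b\<^sup>2 = n}"

definition r2 :: "int \<Rightarrow> nat" where
  "r2 n = card (gauss_points n)"

definition circle_borel :: "complex measure" where
  "circle_borel = restrict_space borel (sphere 0 1)"

text \<open>The sum of Dirac measures \<open>return\<close> is taken setwise; the lemma \<open>emeasure_lattice_measure\<close>
  below shows that this does define a measure with the given values.\<close>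

definition lattice_measure :: "int \<Rightarrow> complex measure" where
  "lattice_measure n = measure_of (space circle_borel) (sets circle_borel)
     (\<lambda>A. ennreal (1 / real (r2 n)) *
        (\<Sum>z\<in>gauss_points n. emeasure (return circle_borel (z / of_real (sqrt (of_int n)))) A))"

definition circle_prob_measure :: "complex measure \<Rightarrow> bool" where
  "circle_prob_measure \<mu> \<longleftrightarrow> prob_space \<mu> \<and> sets \<mu> = sets circle_borel"

text \<open>The circle is compact, so continuous test functions are automatically bounded.\<close>

definition circle_weak_conv :: "(nat \<Rightarrow> complex measure) \<Rightarrow> complex measure \<Rightarrow> bool" where
  "circle_weak_conv \<nu> \<mu> \<longleftrightarrow>
     (\<forall>f :: complex \<Rightarrow> real. continuous_on (sphere 0 1) f \<longrightarrow>
        (\<lambda>j. \<integral>z. f z \<partial>\<nu> j) \<longlonglongrightarrow> (\<integral>z. f z \<partial>\<mu>))"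

definition squarefree_attainable :: "complex measure \<Rightarrow> bool" where
  "squarefree_attainable \<mu> \<longleftrightarrow> circle_prob_measure \<mu> \<and>
     (\<exists>n :: nat \<Rightarrow> int. (\<forall>j. n j \<in> sums_of_two_squares \<and> squarefree (n j)) \<and>
        circle_weak_conv (\<lambda>j. lattice_measure (n j)) \<mu>)"

definition fourier_coeff :: "complex measure \<Rightarrow> int \<Rightarrow> complex" where
  "fourier_coeff \<mu> k = (\<integral>z. z powi (- k) \<partial>\<mu>)"

definition upper_curve :: "real \<Rightarrow> real" where
  "upper_curve x = max (x ^ 4) ((2 * \<bar>x\<bar> - 1)\<^sup>2)"

lemma space_circle_borel [simp]: "space circle_borel = sphere 0 1"
  by (simp add: circle_borel_def space_restrict_space)

lemma sets_lattice_measure [simp]: "sets (lattice_measure n) = sets circle_borel"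
  unfolding lattice_measure_def by (rule sets.sets_measure_of_eq)

lemma space_lattice_measure [simp]: "space (lattice_measure n) = sphere 0 1"
  using sets_eq_imp_space_eq[OF sets_lattice_measure] by simp

lemma emeasure_lattice_measure:
  assumes A: "A \<in> sets circle_borel"
  shows "emeasure (lattice_measure n) A = ennreal (1 / real (r2 n)) *
    (\<Sum>z\<in>gauss_points n. emeasure (return circle_borel (z / of_real (sqrt (of_int n)))) A)"
    (is "_ = ?m A")
  unfolding lattice_measure_def
proof (rule emeasure_measure_of_sigma[OF sets.sigma_algebra_axioms])
  show "positive (sets circle_borel) ?m"
    by (simp add: positive_def)
  show "countably_additive (sets circle_borel) ?m"
    unfolding countably_additive_def
  proof (intro allI impI)
    fix B :: "nat \<Rightarrow> complex set"
    assume B: "range B \<subseteq> sets circle_borel" "disjoint_family B"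
    have "(\<Sum>i. ?m (B i)) = ennreal (1 / real (r2 n)) *
        (\<Sum>i. \<Sum>z\<in>gauss_points n. emeasure (return circle_borel (z / of_real (sqrt (of_int n)))) (B i))"
      by (rule ennreal_suminf_cmult)
    also have "\<dots> = ennreal (1 / real (r2 n)) *
        (\<Sum>z\<in>gauss_points n. \<Sum>i. emeasure (return circle_borel (z / of_real (sqrt (of_int n)))) (B i))"
      by (subst suminf_sum) auto
    also have "\<dots> = ?m (\<Union> (range B))"
      using B by (intro arg_cong2[where f = times] sum.cong refl suminf_emeasure) auto
    finally show "(\<Sum>i. ?m (B i)) = ?m (\<Union> (range B))" .
  qed
qed (rule A)

lemma finite_gauss_points: "finite (gauss_points n)"
proof (rule finite_subset)
  show "gauss_points n \<subseteq> (\<lambda>(a, b). Complex (of_int a) (of_int b)) ` ({- n..n} \<times> {- n..n})"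
  proof
    fix z assume "z \<in> gauss_points n"
    then obtain a b where ab: "z = Complex (of_int a) (of_int b)" "a\<^sup>2 + b\<^sup>2 = n"
      by (auto simp: gauss_points_def)
    have le: "\<bar>c\<bar> \<le> c\<^sup>2" for c :: int
      by (cases "c = 0") (use self_le_power[of "\<bar>c\<bar>" 2] in auto)
    have "\<bar>a\<bar> \<le> n" "\<bar>b\<bar> \<le> n"
      using le[of a] le[of b] ab(2) zero_le_power2[of a] zero_le_power2[of b] by linarith+
    then show "z \<in> (\<lambda>(a, b). Complex (of_int a) (of_int b)) ` ({- n..n} \<times> {- n..n})"
      using ab(1) by (auto intro!: image_eqI[of _ _ "(a, b)"])
  qed
qed auto

lemma circle_prob_measure_lattice_measure:
  assumes "n \<in> sums_of_two_squares"
  shows "circle_prob_measure (lattice_measure n)"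
proof -
  obtain a b where ab: "n = a\<^sup>2 + b\<^sup>2" "n \<noteq> 0"
    using assms by (auto simp: sums_of_two_squares_def)
  then have pos: "n > 0"
    by (metis add_nonneg_nonneg order_less_le zero_le_power2)
  have "gauss_points n \<noteq> {}"
    using ab by (auto simp: gauss_points_def)
  then have r2: "r2 n > 0"
    by (simp add: r2_def card_gt_0_iff finite_gauss_points)
  have mem: "norm (z / of_real (sqrt (of_int n))) = 1" if z: "z \<in> gauss_points n" for z
  proof -
    obtain c d where cd: "z = Complex (of_int c) (of_int d)" "c\<^sup>2 + d\<^sup>2 = n"
      using z by (auto simp: gauss_points_def)
    have "(of_int c)\<^sup>2 + (of_int d)\<^sup>2 = (of_int n :: real)"
      unfolding cd(2)[symmetric] by simp
    then have "norm z = sqrt (of_int n)"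
      using cd(1) by (simp add: complex_norm)
    then show ?thesis
      using pos by (simp add: norm_divide)
  qed
  have "emeasure (lattice_measure n) (sphere 0 1) = ennreal (1 / real (r2 n)) * of_nat (r2 n)"
  proof -
    have *: "sphere 0 1 \<in> sets circle_borel"
      using sets.top[of circle_borel] by simp
    have "(\<Sum>z\<in>gauss_points n. emeasure (return circle_borel (z / of_real (sqrt (of_int n)))) (sphere 0 1))
        = (\<Sum>z\<in>gauss_points n. 1)"
      by (rule sum.cong) (use * mem in \<open>auto simp: indicator_def\<close>)
    then show ?thesis
      using * by (simp add: emeasure_lattice_measure r2_def)
  qed
  also have "\<dots> = 1"
    using r2 by (simp add: ennreal_of_nat_eq_real_of_nat ennreal_mult[symmetric])
  finally show ?thesis
    by (auto simp: circle_prob_measure_def intro!: prob_spaceI)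
qed

end

theory Submission
  imports Defs
begin

text \<open>For squarefree \<open>n\<close> the measure \<open>\<mu>\<^sub>n\<close> is a convolution over the primes dividing \<open>n\<close>, so its
  coefficients at 4 and 8 are \<open>\<Prod> x\<^sub>p\<close> and \<open>\<Prod> (2 x\<^sub>p\<^sup>2 - 1)\<close>, where \<open>x\<^sub>p = cos 4\<theta>\<^sub>p\<close> and \<open>\<theta>\<^sub>p\<close> is
  the argument of a Gaussian prime above \<open>p\<close>. The region of the theorem contains \<open>(1, 1)\<close> and is
  stable under coordinatewise multiplication by the points \<open>(c, 2 c\<^sup>2 - 1)\<close> with \<open>\<bar>c\<bar> \<le> 1\<close>, which gives
  the inequalities; conversely finite products of such points are dense in the region, and weak
  limits exist by Helly's theorem.

  What remains is that every \<open>c\<close> is a limit of values \<open>x\<^sub>p\<close> over infinitely many primes. This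
  follows from Dirichlet's argument for the Hecke characters \<open>(z / \<bar>z\<bar>) ^ (4 k)\<close>. To control the
  series \<open>L(k, s)\<close> as \<open>s \<rightarrow> 1\<close>, split the Gaussian integers into residue classes modulo \<open>2 + i\<close>: all
  five classes contribute almost the same as the class of 0, whose contribution is the term at
  \<open>2 + i\<close> times the whole series. Hence \<open>L(k, s) (1 - v 5 powr (1 - s))\<close> is bounded and Lipschitz,
  where \<open>v\<close> is the character value at \<open>2 + i\<close>, and \<open>v \<noteq> 1\<close> for \<open>k \<ge> 1\<close>.\<close>

subsection \<open>Gaussian integers\<close>

text \<open>No analytic continuation is used: everything happens for real \<open>s\<close> in (1,
  2], and a Lipschitz bound replaces differentiability at 1. This suffices for nonvanishing: if L(k,
  s) tended to 0, it would be O(s - 1), while L(0, s) is O(1 / (s - 1)) and L(2k, s) is bounded, so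
  the product of their moduli to the powers 4, 3, 1 would tend to 0, although it is at least 1. A
  rational integer could not replace 2 + i: every character is 1 on it, so its factor would vanish
  at s = 1 for all k. With 2 + i this happens for k = 0, where it limits the pole to first order.

  The branches of M come from products with equal factors: two factors sqrt |x| give (2 |x| - 1)^2,
  and m factors |x|^(1/m) give (2 |x|^(2/m) - 1)^m, which tends to x^4. The value c = 1 needs care:
  inert primes have it as well, and their norms are squares. Targets are therefore moved slightly
  inside (-1, 1), which forces primes whose norm is a rational prime.\<close>

datatype gint = Gint (gre: int) (gim: int)

text \<open>A type of its own gives access to the class-based \<open>dvd\<close> and
  \<open>prime_elem\<close>; metric facts come through the injective ring homomorphism
  \<open>of_gint\<close>.\<close>

instantiation gint :: comm_ring_1
begin

definition "0 = Gint 0 0"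
definition "1 = Gint 1 0"
definition "a + b = Gint (gre a + gre b) (gim a + gim b)"
definition "a - b = Gint (gre a - gre b) (gim a - gim b)"
definition "- a = Gint (- gre a) (- gim a)"
definition "a * b = Gint (gre a * gre b - gim a * gim b) (gre a * gim b + gim a * gre b)"

instance
proof
  fix a b c :: gint
  note [simp] = zero_gint_def one_gint_def plus_gint_def minus_gint_def uminus_gint_def
    times_gint_def
  show "a * b * c = a * (b * c)"
    by (simp add: algebra_simps)
  show "a * b = b * a" "(a + b) * c = a * c + b * c"
    by (simp_all add: algebra_simps)
qed (simp_all add: zero_gint_def one_gint_def plus_gint_def minus_gint_def uminus_gint_def
    times_gint_def)

end

definition of_gint :: "gint \<Rightarrow> complex" where
  "of_gint a = Complex (of_int (gre a)) (of_int (gim a))"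

definition gnorm :: "gint \<Rightarrow> nat" where
  "gnorm a = nat ((gre a)\<^sup>2 + (gim a)\<^sup>2)"

lemma of_gint_simps [simp]:
  "of_gint 0 = 0" "of_gint 1 = 1" "of_gint (a + b) = of_gint a + of_gint b"
  "of_gint (a - b) = of_gint a - of_gint b" "of_gint (- a) = - of_gint a"
  "of_gint (a * b) = of_gint a * of_gint b"
  by (auto simp: of_gint_def zero_gint_def one_gint_def plus_gint_def minus_gint_def
      uminus_gint_def times_gint_def complex_eq_iff)

lemma of_gint_power [simp]: "of_gint (a ^ n) = of_gint a ^ n"
  by (induction n) auto

lemma of_gint_eq_iff [simp]: "of_gint a = of_gint b \<longleftrightarrow> a = b"
  by (cases a; cases b) (auto simp: of_gint_def)

lemma of_gint_eq_0_iff [simp]: "of_gint a = 0 \<longleftrightarrow> a = 0"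
  using of_gint_eq_iff[of a 0] by simp

instance gint :: idom
proof
  fix a b :: gint
  assume "a \<noteq> 0" "b \<noteq> 0"
  then have "of_gint (a * b) \<noteq> 0"
    by simp
  then show "a * b \<noteq> 0"
    by (metis of_gint_simps(1))
qed

lemma of_int_gnorm: "int (gnorm a) = (gre a)\<^sup>2 + (gim a)\<^sup>2"
  by (simp add: gnorm_def)

lemma norm_of_gint_sq: "(norm (of_gint a))\<^sup>2 = real (gnorm a)"
proof -
  have "(norm (of_gint a))\<^sup>2 = real_of_int (int (gnorm a))"
    unfolding of_int_gnorm by (simp add: of_gint_def cmod_power2)
  then show ?thesis
    by simp
qed

lemma norm_of_gint: "norm (of_gint a) = sqrt (real (gnorm a))"
  by (simp flip: norm_of_gint_sq)

lemma gnorm_mult [simp]: "gnorm (a * b) = gnorm a * gnorm b"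
proof -
  have "real (gnorm (a * b)) = real (gnorm a * gnorm b)"
    by (simp add: norm_of_gint_sq[symmetric] norm_mult power_mult_distrib)
  then show ?thesis
    by (simp only: of_nat_eq_iff)
qed

lemma gnorm_eq_0_iff [simp]: "gnorm a = 0 \<longleftrightarrow> a = 0"
proof -
  have "gnorm a = 0 \<longleftrightarrow> norm (of_gint a) = 0"
    unfolding norm_of_gint by simp
  then show ?thesis
    by simp
qed

lemma gnorm_0 [simp]: "gnorm 0 = 0" and gnorm_1 [simp]: "gnorm 1 = 1"
  by (auto simp: gnorm_def zero_gint_def one_gint_def)

lemma gnorm_pos_iff [simp]: "gnorm a > 0 \<longleftrightarrow> a \<noteq> 0"
  using gnorm_eq_0_iff[of a] by linarith

lemma finite_gnorm_le: "finite {a. gnorm a \<le> n}"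
proof (rule finite_subset)
  show "{a. gnorm a \<le> n} \<subseteq> (\<lambda>(x, y). Gint x y) ` ({- int n..int n} \<times> {- int n..int n})"
  proof
    fix a assume a: "a \<in> {a. gnorm a \<le> n}"
    have le: "\<bar>c\<bar> \<le> c\<^sup>2" for c :: int
      by (cases "c = 0") (use self_le_power[of "\<bar>c\<bar>" 2] in auto)
    have "\<bar>gre a\<bar> \<le> int n" "\<bar>gim a\<bar> \<le> int n"
      using le[of "gre a"] le[of "gim a"] of_int_gnorm[of a] a zero_le_power2[of "gre a"]
        zero_le_power2[of "gim a"] by auto
    then show "a \<in> (\<lambda>(x, y). Gint x y) ` ({- int n..int n} \<times> {- int n..int n})"
      by (auto intro!: image_eqI[of _ _ "(gre a, gim a)"])
  qed
qed auto

definition gcnj :: "gint \<Rightarrow> gint" where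
  "gcnj a = Gint (gre a) (- gim a)"

lemma of_gint_gcnj [simp]: "of_gint (gcnj a) = cnj (of_gint a)"
  by (simp add: gcnj_def of_gint_def complex_eq_iff)

lemma gcnj_mult [simp]: "gcnj (a * b) = gcnj a * gcnj b"
  by (simp add: gcnj_def times_gint_def)

lemma gcnj_gcnj [simp]: "gcnj (gcnj a) = a"
  by (simp add: gcnj_def)

lemma gcnj_eq_0_iff [simp]: "gcnj a = 0 \<longleftrightarrow> a = 0"
  by (cases a) (simp add: gcnj_def zero_gint_def)

lemma gnorm_gcnj [simp]: "gnorm (gcnj a) = gnorm a"
  by (simp add: gcnj_def gnorm_def)

lemma of_gint_of_nat [simp]: "of_gint (of_nat n) = of_nat n"
  by (induction n) auto

lemma mult_gcnj: "a * gcnj a = of_nat (gnorm a)"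
proof -
  have "of_gint (a * gcnj a) = of_gint (of_nat (gnorm a))"
    by (simp add: complex_norm_square[symmetric] norm_of_gint_sq flip: of_real_power)
  then show ?thesis
    by (simp only: of_gint_eq_iff)
qed

lemma gnorm_of_nat [simp]: "gnorm (of_nat n) = n\<^sup>2"
proof -
  have "real (gnorm (of_nat n)) = real (n\<^sup>2)"
    by (simp flip: norm_of_gint_sq)
  then show ?thesis
    by (simp only: of_nat_eq_iff)
qed

lemma dvd_gcnj_iff: "gcnj a dvd gcnj b \<longleftrightarrow> a dvd b"
proof
  show "gcnj a dvd gcnj b" if "a dvd b" for a b
    using that by (auto simp: dvd_def)
  from this[of "gcnj a" "gcnj b"] show "a dvd b" if "gcnj a dvd gcnj b"
    using that by simp
qed

lemma gnorm_dvd: "a dvd b \<Longrightarrow> gnorm a dvd gnorm b"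
  by (auto simp: dvd_def)

lemma dvd_of_nat_gnorm: "a dvd of_nat (gnorm a)"
  unfolding mult_gcnj[symmetric] by simp

lemma gint_unit_iff: "a dvd 1 \<longleftrightarrow> gnorm a = 1"
proof
  assume "a dvd 1"
  then show "gnorm a = 1"
    using gnorm_dvd[of a 1] by simp
next
  assume "gnorm a = 1"
  then show "a dvd 1"
    using dvd_of_nat_gnorm[of a] by simp
qed

lemma dvd_self_mult_imp_unit:
  fixes a b :: "'a :: idom"
  assumes "a * b dvd a" "a \<noteq> 0"
  shows "b dvd 1"
  using assms dvd_mult_cancel_left[of a b 1] by simp

text \<open>Rounding both coordinates of the exact quotient leaves an error of at most 1/2 in each,
  so the remainder has at most half the norm of \<open>b\<close>.\<close>

lemma gint_division:
  assumes "b \<noteq> 0"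
  obtains q where "gnorm (a - q * b) < gnorm b"
proof
  define z where "z = of_gint a / of_gint b"
  define q where "q = Gint (round (Re z)) (round (Im z))"
  have r: "(x - of_int (round x))\<^sup>2 \<le> (1/2)\<^sup>2" for x :: real
    using of_int_round_abs_le[of x] by (subst abs_le_square_iff[symmetric]) (simp add: abs_minus_commute)
  have "(norm (z - of_gint q))\<^sup>2 \<le> 1 / 2"
    unfolding cmod_power2 using add_mono[OF r[of "Re z"] r[of "Im z"]]
    by (simp add: q_def of_gint_def power_divide)
  moreover have "of_gint (a - q * b) = (z - of_gint q) * of_gint b"
    using assms by (simp add: z_def field_simps)
  ultimately have "(norm (of_gint (a - q * b)))\<^sup>2 \<le> 1 / 2 * (norm (of_gint b))\<^sup>2"
    by (simp only: norm_mult power_mult_distrib mult_right_mono zero_le_power2)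
  also have "\<dots> < (norm (of_gint b))\<^sup>2"
    using assms by simp
  finally show "gnorm (a - q * b) < gnorm b"
    unfolding norm_of_gint_sq by simp
qed

text \<open>A nonunit divisor of least norm is prime, by the Euclidean algorithm.\<close>

lemma gint_prime_divisor_exists:
  assumes a: "a \<noteq> 0" "\<not> a dvd 1"
  obtains p :: gint where "prime_elem p" "p dvd a"
proof -
  define p where "p = (ARG_MIN gnorm p. p dvd a \<and> \<not> p dvd 1)"
  have p: "p dvd a" "\<not> p dvd 1" and min: "\<And>q. q dvd a \<Longrightarrow> \<not> q dvd 1 \<Longrightarrow> gnorm p \<le> gnorm q"
    using arg_min_natI[of "\<lambda>p. p dvd a \<and> \<not> p dvd 1" a gnorm]
      arg_min_nat_le[of "\<lambda>p. p dvd a \<and> \<not> p dvd 1" _ gnorm] a unfolding p_def by auto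
  have p0: "p \<noteq> 0"
    using p(1) a by auto
  have "p dvd x \<or> p dvd y" if xy: "p dvd x * y" for x y
  proof (rule ccontr)
    assume *: "\<not> (p dvd x \<or> p dvd y)"
    \<comment> \<open>The ideal generated by \<open>p\<close> and \<open>x\<close>. By division with
      remainder, a nonzero element \<open>d\<close> of least norm divides all of it.\<close>
    define I where "I = {s * p + t * x | s t. True}"
    define d where "d = (ARG_MIN gnorm d. d \<in> I \<and> d \<noteq> 0)"
    have pI: "p \<in> I"
      unfolding I_def by (rule CollectI, rule exI[of _ 1], rule exI[of _ 0]) simp
    have xI: "x \<in> I"
      unfolding I_def by (rule CollectI, rule exI[of _ 0], rule exI[of _ 1]) simp
    have d: "d \<in> I" "d \<noteq> 0" and dmin: "\<And>e. e \<in> I \<Longrightarrow> e \<noteq> 0 \<Longrightarrow> gnorm d \<le> gnorm e"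
      using arg_min_natI[of "\<lambda>d. d \<in> I \<and> d \<noteq> 0" p gnorm]
        arg_min_nat_le[of "\<lambda>d. d \<in> I \<and> d \<noteq> 0" _ gnorm] p0 pI unfolding d_def by auto
    obtain s t where st: "d = s * p + t * x"
      using d by (auto simp: I_def)
    have dvd: "d dvd e" if e: "e \<in> I" for e
    proof -
      obtain q where q: "gnorm (e - q * d) < gnorm d"
        using gint_division[OF d(2)] .
      obtain s' t' where "e = s' * p + t' * x"
        using e by (auto simp: I_def)
      then have "e - q * d = (s' - q * s) * p + (t' - q * t) * x"
        by (simp add: st algebra_simps)
      then have "e - q * d \<in> I"
        by (auto simp: I_def)
      then have "e - q * d = 0"
        using dmin[of "e - q * d"] q by auto
      then show ?thesis
        by simp
    qed
    show False
    \<comment> \<open>If \<open>d\<close> is a unit, its Bezout relation multiplied by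
      \<open>y\<close> shows \<open>p dvd y\<close>. Otherwise \<open>d\<close> is a nonunit divisor
      of \<open>a\<close>, minimality of \<open>gnorm p\<close> makes it an associate of
      \<open>p\<close>, and \<open>d dvd x\<close> yields \<open>p dvd x\<close>.\<close>
    proof (cases "d dvd 1")
      case True
      then obtain w where w: "1 = d * w"
        by (auto simp: dvd_def)
      have "y = w * s * y * p + w * t * (x * y)"
        using arg_cong[OF w, of "\<lambda>z. z * y"] by (simp add: st algebra_simps)
      then have "p dvd y"
        using xy by (metis dvd_add dvd_mult dvd_triv_right)
      then show False
        using * by simp
    next
      case False
      obtain e where e: "p = d * e"
        using dvd[OF pI] by (auto simp: dvd_def)
      have "d dvd a"
        using e p(1) by (metis dvd_mult_left)
      then have "gnorm d * gnorm e \<le> gnorm d"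
        using min[OF _ False] e by simp
      moreover have "gnorm d > 0" "gnorm e > 0"
        using d(2) e p0 by auto
      ultimately have "gnorm e \<le> 1"
        by auto
      with \<open>gnorm e > 0\<close> have "gnorm e = 1"
        by linarith
      then obtain f where "1 = e * f"
        unfolding gint_unit_iff[symmetric] by (auto simp: dvd_def)
      then have "d = p * f"
        using e by (simp add: mult.assoc)
      then have "p dvd d"
        by simp
      then have "p dvd x"
        using dvd[OF xI] by (rule dvd_trans)
      then show False
        using * by simp
    qed
  qed
  then have "prime_elem p"
    using p0 p by (auto simp: prime_elem_def)
  then show ?thesis
    using that p by blast
qed

lemma gint_prime_dvd_prime_imp_dvd:
  fixes p q :: gint
  assumes "prime_elem p" "prime_elem q" "p dvd q"
  shows "q dvd p"
proof -
  obtain r where r: "q = p * r"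
    using assms by (auto simp: dvd_def)
  then have "q dvd p \<or> q dvd r"
    using assms prime_elem_dvd_multD[of q p r] by auto
  moreover have "\<not> q dvd r"
  proof
    assume "q dvd r"
    then have "p * r dvd r" "r \<noteq> 0"
      using r assms by auto
    then show False
      using assms dvd_self_mult_imp_unit[of r p] by (auto simp: mult.commute prime_elem_def)
  qed
  ultimately show ?thesis
    by blast
qed

text \<open>Picks one element from each class of associates: the predicate under \<open>SOME\<close>
  depends only on the class. Any choice will do, because the characters below are trivial on
  units.\<close>

definition gint_rep :: "gint \<Rightarrow> gint" where
  "gint_rep a = (SOME b. a dvd b \<and> b dvd a)"

definition gint_primes :: "gint set" where
  "gint_primes = {p. prime_elem p \<and> gint_rep p = p}"

lemma gint_rep: "a dvd gint_rep a" "gint_rep a dvd a"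
  unfolding gint_rep_def using someI[of "\<lambda>b. a dvd b \<and> b dvd a" a] by auto

lemma gint_rep_cong:
  assumes "a dvd b" "b dvd a"
  shows "gint_rep a = gint_rep b"
proof -
  have "(\<lambda>c. a dvd c \<and> c dvd a) = (\<lambda>c. b dvd c \<and> c dvd b)"
    using assms by (metis dvd_trans)
  then show ?thesis
    by (simp add: gint_rep_def)
qed

lemma gint_primes_imp_prime_elem: "p \<in> gint_primes \<Longrightarrow> prime_elem p"
  by (simp add: gint_primes_def)

text \<open>Associates share a representative, so different members of \<open>gint_primes\<close>
  are not associates; the sieve below relies on this.\<close>

lemma gint_primes_dvd_imp_eq:
  assumes "p \<in> gint_primes" "q \<in> gint_primes" "p dvd q"
  shows "p = q"
  using assms gint_rep_cong[of p q] gint_prime_dvd_prime_imp_dvd[of p q]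
  by (auto simp: gint_primes_def)

lemma gint_primes_divisor_exists:
  assumes a: "a \<noteq> 0" "\<not> a dvd 1"
  obtains p where "p \<in> gint_primes" "p dvd a"
proof -
  obtain q where q: "prime_elem q" "q dvd a"
    using gint_prime_divisor_exists[OF a] .
  define p where "p = gint_rep q"
  have "prime_elem p"
    unfolding prime_elem_def
  proof (intro conjI allI impI)
    have "q dvd p" "q \<noteq> 0" "\<not> q dvd 1" "p dvd q"
      using gint_rep[of q] q(1) by (simp_all add: p_def prime_elem_def)
    then show "p \<noteq> 0" "\<not> p dvd 1"
      by (metis dvd_0_left_iff, metis dvd_trans)
    show "p dvd x \<or> p dvd y" if "p dvd x * y" for x y
      using gint_rep[of q] q(1) that by (metis p_def dvd_trans prime_elem_dvd_multD)
  qed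
  moreover have "gint_rep p = p"
    using gint_rep_cong[of p q] gint_rep[of q] by (simp add: p_def)
  moreover have "p dvd a"
    using gint_rep[of q] q(2) by (metis p_def dvd_trans)
  ultimately show ?thesis
    using that by (auto simp: gint_primes_def)
qed

lemma gnorm_prime_elem_ge_2:
  assumes "prime_elem (p :: gint)"
  shows "gnorm p \<ge> 2"
proof -
  have "gnorm p \<noteq> 0" "gnorm p \<noteq> 1"
    using assms by (auto simp: prime_elem_def gint_unit_iff)
  then show ?thesis
    by linarith
qed

subsection \<open>Hecke characters and their Dirichlet series\<close>

lemma summable_on_int_powr:
  assumes "s > (1::real)"
  shows "(\<lambda>x::int. (1 + \<bar>real_of_int x\<bar>) powr (-s)) summable_on UNIV"
proof -
  let ?g = "\<lambda>x::int. (1 + \<bar>real_of_int x\<bar>) powr (-s)"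
  have "summable (\<lambda>n. real (Suc n) powr (-s))"
    using assms by (subst summable_Suc_iff) (simp add: summable_real_powr_iff)
  then have "(\<lambda>n. real (Suc n) powr (-s)) summable_on UNIV"
    by (subst summable_on_UNIV_nonneg_real_iff) auto
  then have *: "(\<lambda>n. ?g (int n)) summable_on UNIV" "(\<lambda>n. ?g (- int n)) summable_on UNIV"
    by (simp_all add: add.commute)
  have "?g summable_on range int"
    using * by (subst summable_on_reindex) (auto simp: o_def)
  moreover have "?g summable_on range (\<lambda>n. - int n)"
    using * by (subst summable_on_reindex) (auto simp: o_def inj_on_def)
  ultimately have "?g summable_on (range int \<union> range (\<lambda>n. - int n))"
    by (rule summable_on_union)
  also have "range int \<union> range (\<lambda>n. - int n) = UNIV"
  proof (intro equalityI subsetI)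
    show "x \<in> range int \<union> range (\<lambda>n. - int n)" for x
      by (cases x rule: int_cases2) auto
  qed auto
  finally show ?thesis .
qed

text \<open>Comparison with a product of two one-dimensional series. The element 0 is harmless
  because \<open>0 powr (-s) = 0\<close>.\<close>

lemma summable_on_gnorm_powr:
  assumes s: "s > (1::real)"
  shows "(\<lambda>a. real (gnorm a) powr (-s)) summable_on A"
proof (rule summable_on_subset)
  let ?g = "\<lambda>x::int. (1 + \<bar>real_of_int x\<bar>) powr (-s)"
  have "(\<lambda>(x, y). ?g x * ?g y) summable_on (SIGMA x:UNIV. UNIV)"
  proof (rule summable_on_SigmaI[where g = "\<lambda>x. ?g x * infsum ?g UNIV"])
    show "((\<lambda>y. case (x, y) of (x, y) \<Rightarrow> ?g x * ?g y) has_sum ?g x * infsum ?g UNIV) UNIV" for x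
      using has_sum_cmult_right[OF has_sum_infsum[OF summable_on_int_powr[OF s]]] by simp
    show "(\<lambda>x. ?g x * infsum ?g UNIV) summable_on UNIV"
      by (intro summable_on_cmult_left summable_on_int_powr s)
  qed simp
  then have sum: "(\<lambda>(x, y). ?g x * ?g y) summable_on UNIV"
    by simp
  have "bij (\<lambda>a. (gre a, gim a))"
    by (rule bij_betwI[of _ _ _ "\<lambda>(x, y). Gint x y"]) auto
  from summable_on_reindex_bij_betw[OF this, THEN iffD2, OF sum]
  have "(\<lambda>a. case (gre a, gim a) of (x, y) \<Rightarrow> ?g x * ?g y) summable_on UNIV" .
  from summable_on_cmult_right[OF this, of "4 powr s"]
  have "(\<lambda>a. 4 powr s * (?g (gre a) * ?g (gim a))) summable_on UNIV"
    by (simp only: prod.case)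
  then show "(\<lambda>a. real (gnorm a) powr (-s)) summable_on UNIV"
  proof (rule summable_on_comparison_test)
    fix a
    show "real (gnorm a) powr (-s) \<le> 4 powr s * (?g (gre a) * ?g (gim a))"
    proof (cases "a = 0")
      case False
      define x y where "x = \<bar>gre a\<bar>" and "y = \<bar>gim a\<bar>"
      have xy: "x \<ge> 0" "y \<ge> 0"
        by (auto simp: x_def y_def)
      have N: "int (gnorm a) = x\<^sup>2 + y\<^sup>2"
        by (simp add: of_int_gnorm x_def y_def)
      have "int (gnorm a) \<ge> 1"
        using False gnorm_pos_iff[of a] by linarith
      moreover have le: "c \<le> c\<^sup>2" if "c \<ge> 0" for c :: int
        by (cases "c = 0") (use self_le_power[of c 2] that in auto)
      moreover note le[OF xy(1)] le[OF xy(2)]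
      moreover have "2 * (x * y) \<le> x\<^sup>2 + y\<^sup>2"
        using zero_le_power2[of "x - y"] by (simp add: power2_eq_square algebra_simps)
      \<comment> \<open>After expansion, 1 and \<open>x + y\<close> are each bounded by the norm,
        and \<open>x * y\<close> by half of it.\<close>
      ultimately have "(1 + x) * (1 + y) \<le> 4 * int (gnorm a)"
        unfolding N by (simp add: algebra_simps)
      then have "real_of_int ((1 + x) * (1 + y)) \<le> real_of_int (4 * int (gnorm a))"
        by (simp only: of_int_le_iff)
      then have le: "(1 + real_of_int x) * (1 + real_of_int y) \<le> 4 * real (gnorm a)"
        by simp
      have "(4 * real (gnorm a)) powr (-s) \<le> ((1 + real_of_int x) * (1 + real_of_int y)) powr (-s)"
        using s xy by (intro powr_mono2' le) (auto intro: mult_pos_pos)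
      then have "4 powr s * (4 * real (gnorm a)) powr (-s)
          \<le> 4 powr s * ((1 + real_of_int x) * (1 + real_of_int y)) powr (-s)"
        by (intro mult_left_mono) auto
      also have "4 powr s * (4 * real (gnorm a)) powr (-s) = real (gnorm a) powr (-s)"
        by (simp add: powr_mult powr_minus)
      finally show ?thesis
        using xy by (simp add: powr_mult x_def y_def)
    qed simp
  qed simp
qed auto

text \<open>Exponents divisible by 4 make the value invariant under units, so that it depends only
  on the ideal generated by \<open>a\<close>.\<close>

definition hecke :: "nat \<Rightarrow> gint \<Rightarrow> complex" where
  "hecke k a = sgn (of_gint a) ^ (4 * k)"

definition hecke_term :: "nat \<Rightarrow> real \<Rightarrow> gint \<Rightarrow> complex" where
  "hecke_term k s a = hecke k a * of_real (real (gnorm a) powr (-s))"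

text \<open>The sum runs over elements instead of ideals, which makes it
  \<open>gint_unit_count\<close> times the usual L-series; no generators have to be chosen, and 0
  contributes nothing.\<close>

definition hecke_L :: "nat \<Rightarrow> real \<Rightarrow> complex" where
  "hecke_L k s = infsum (hecke_term k s) UNIV"

lemma hecke_mult: "hecke k (a * b) = hecke k a * hecke k b"
  by (simp add: hecke_def sgn_mult power_mult_distrib)

lemma hecke_0_left [simp]: "hecke 0 a = 1"
  by (simp add: hecke_def)

lemma hecke_eq_power: "hecke k a = hecke 1 a ^ k"
  by (simp add: hecke_def power_mult)

lemma norm_hecke: "a \<noteq> 0 \<Longrightarrow> norm (hecke k a) = 1"
  by (simp add: hecke_def norm_power norm_sgn)

lemma norm_hecke_le: "norm (hecke k a) \<le> 1"
  by (cases "a = 0") (simp_all add: norm_hecke, simp add: hecke_def power_0_left)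

lemma hecke_unit:
  assumes "a dvd 1"
  shows "hecke k a = 1"
proof -
  have "int (gnorm a) = 1"
    using assms by (simp add: gint_unit_iff)
  then have *: "(gre a)\<^sup>2 + (gim a)\<^sup>2 = 1"
    by (simp add: of_int_gnorm)
  have "norm (of_gint a) = 1"
    using assms by (simp add: norm_of_gint gint_unit_iff)
  then have "hecke 1 a = of_gint a ^ 4"
    by (simp add: hecke_def sgn_div_norm)
  moreover have "(gre a)\<^sup>2 = 0 \<or> (gim a)\<^sup>2 = 0"
    using * zero_le_power2[of "gre a"] zero_le_power2[of "gim a"] by linarith
  then have "(gre a = 0 \<and> (gim a = 1 \<or> gim a = -1)) \<or> (gim a = 0 \<and> (gre a = 1 \<or> gre a = -1))"
    using * by (auto simp: power2_eq_1_iff)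
  then have "of_gint a ^ 4 = 1"
    by (cases a) (auto simp: of_gint_def complex_eq_iff power4_eq_xxxx)
  ultimately show ?thesis
    by (simp add: hecke_eq_power[of k])
qed

lemma hecke_term_mult: "hecke_term k s (a * b) = hecke_term k s a * hecke_term k s b"
  by (simp add: hecke_term_def hecke_mult powr_mult)

lemma norm_hecke_term: "norm (hecke_term k s a) = real (gnorm a) powr (-s)"
  by (cases "a = 0") (simp_all add: hecke_term_def norm_mult norm_hecke)

lemma hecke_term_0 [simp]: "hecke_term k s 0 = 0"
  by (simp add: hecke_term_def)

lemma hecke_term_unit: "a dvd 1 \<Longrightarrow> hecke_term k s a = 1"
  by (simp add: hecke_term_def hecke_unit) (simp add: gint_unit_iff)

lemma abs_summable_on_hecke_term:
  "s > 1 \<Longrightarrow> (\<lambda>a. norm (hecke_term k s a)) summable_on A"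
  unfolding norm_hecke_term by (rule summable_on_gnorm_powr)

lemma summable_on_hecke_term: "s > 1 \<Longrightarrow> hecke_term k s summable_on A"
  by (rule abs_summable_summable, rule abs_summable_on_hecke_term)

lemma hecke_L_0: "s > 1 \<Longrightarrow> hecke_L 0 s = of_real (\<Sum>\<^sub>\<infinity>a. real (gnorm a) powr (-s))"
  unfolding hecke_L_def hecke_term_def
  by (intro infsumI) (simp add: has_sum_of_real_iff summable_on_gnorm_powr)

section \<open>Sieving by primes and the Euler product\<close>

definition sifted :: "gint set \<Rightarrow> gint set" where
  "sifted P = {a. \<forall>p\<in>P. \<not> p dvd a}"

text \<open>Sieving out one prime at a time avoids expanding the geometric series of the Euler factors.\<close>

lemma hecke_L_sieve:
  assumes s: "s > 1" and "finite P" "P \<subseteq> gint_primes"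
  shows "hecke_L k s * (\<Prod>p\<in>P. 1 - hecke_term k s p) = infsum (hecke_term k s) (sifted P)"
  using assms(2,3)
proof (induction P rule: finite_induct)
  case empty
  then show ?case
    by (simp add: sifted_def hecke_L_def)
next
  case (insert p P)
  have p: "prime_elem p"
    using insert.prems by (auto intro: gint_primes_imp_prime_elem)
  have pq: "\<not> q dvd p" if "q \<in> P" for q
    using gint_primes_dvd_imp_eq[of q p] that insert by auto
  \<comment> \<open>No prime of \<open>P\<close> divides \<open>p\<close>, so the multiples of
    \<open>p\<close> in \<open>sifted P\<close> are \<open>p\<close> times \<open>sifted P\<close>;
    by complete multiplicativity they contribute the factor \<open>hecke_term k s p\<close>.\<close>
  have split: "sifted P = sifted (insert p P) \<union> (\<lambda>a. p * a) ` sifted P"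
  proof (intro equalityI subsetI)
    fix a assume a: "a \<in> sifted P"
    show "a \<in> sifted (insert p P) \<union> (\<lambda>a. p * a) ` sifted P"
    proof (cases "p dvd a")
      case True
      then obtain b where "a = p * b"
        by (auto simp: dvd_def)
      moreover have "b \<in> sifted P"
        using a calculation by (auto simp: sifted_def)
      ultimately show ?thesis
        by blast
    qed (use a in \<open>auto simp: sifted_def\<close>)
  next
    fix a assume "a \<in> sifted (insert p P) \<union> (\<lambda>a. p * a) ` sifted P"
    then show "a \<in> sifted P"
    proof
      assume "a \<in> (\<lambda>a. p * a) ` sifted P"
      then obtain b where b: "a = p * b" "b \<in> sifted P"
        by auto
      have "\<not> q dvd a" if q: "q \<in> P" for q
        using b pq[OF q] q insert.prems prime_elem_dvd_multD[of q p b] gint_primes_imp_prime_elem[of q]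
        by (auto simp: sifted_def)
      then show ?thesis
        by (auto simp: sifted_def)
    qed (auto simp: sifted_def)
  qed
  have "infsum (hecke_term k s) (sifted P) = infsum (hecke_term k s) (sifted (insert p P))
      + infsum (hecke_term k s) ((\<lambda>a. p * a) ` sifted P)"
    by (subst split, rule infsum_Un_disjoint)
      (auto intro: summable_on_hecke_term s simp: sifted_def)
  also have "infsum (hecke_term k s) ((\<lambda>a. p * a) ` sifted P)
      = hecke_term k s p * infsum (hecke_term k s) (sifted P)"
  proof -
    have "p \<noteq> 0"
      using p by auto
    then have "inj_on (\<lambda>a. p * a) (sifted P)"
      by (simp add: inj_on_def)
    then have "infsum (hecke_term k s) ((\<lambda>a. p * a) ` sifted P)
        = (\<Sum>\<^sub>\<infinity>a\<in>sifted P. hecke_term k s p * hecke_term k s a)"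
      by (simp only: infsum_reindex o_def hecke_term_mult)
    then show ?thesis
      by (simp only: infsum_cmult_right')
  qed
  finally have "infsum (hecke_term k s) (sifted (insert p P))
      = infsum (hecke_term k s) (sifted P) * (1 - hecke_term k s p)"
    by algebra
  also have "infsum (hecke_term k s) (sifted P) = hecke_L k s * (\<Prod>p\<in>P. 1 - hecke_term k s p)"
    using insert by simp
  finally show ?case
    unfolding prod.insert[OF insert.hyps] by (simp only: mult_ac)
qed

definition gint_unit_count :: nat where
  "gint_unit_count = card {a :: gint. a dvd 1}"

lemma finite_gint_units: "finite {a :: gint. a dvd 1}"
  by (rule finite_subset[OF _ finite_gnorm_le[of 1]]) (auto simp: gint_unit_iff)

lemma gint_unit_count_pos: "gint_unit_count > 0"
  unfolding gint_unit_count_def using finite_gint_units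
  by (auto simp: card_gt_0_iff intro: exI[of _ 1])

text \<open>Once \<open>P\<close> contains a prime divisor of every nonzero nonunit in a large
  finite set \<open>F\<close>, sieving leaves the units and terms outside \<open>F\<close> (or 0),
  which are bounded by the tail. Keeping the series on the left presupposes nothing about
  convergence of the infinite product.\<close>

lemma hecke_euler_product:
  assumes s: "s > 1"
  shows "((\<lambda>P. hecke_L k s * (\<Prod>p\<in>P. 1 - hecke_term k s p)) \<longlongrightarrow> of_nat gint_unit_count)
    (finite_subsets_at_top gint_primes)"
proof (rule tendstoI)
  fix e :: real assume e: "e > 0"
  let ?n = "\<lambda>a. norm (hecke_term k s a)"
  let ?U = "{a :: gint. a dvd 1}"
  have sum: "?n summable_on A" for A
    by (rule abs_summable_on_hecke_term[OF s])
  obtain F where F: "finite F" "dist (sum ?n F) (infsum ?n UNIV) \<le> e / 2"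
    using infsum_finite_approximation[OF sum, of "e/2"] e by auto
  have tail: "infsum ?n (- F) < e"
  proof -
    have "infsum ?n (F \<union> - F) = infsum ?n F + infsum ?n (- F)"
      using sum by (intro infsum_Un_disjoint) auto
    then have "infsum ?n (- F) = infsum ?n UNIV - sum ?n F"
      using F(1) by (simp add: Compl_partition)
    also have "\<dots> \<le> e / 2"
      using F(2) by (simp only: dist_real_def abs_le_iff minus_diff_eq)
    finally show ?thesis
      using e by simp
  qed
  define d where "d = (\<lambda>a. SOME p. p \<in> gint_primes \<and> p dvd a)"
  have d: "d a \<in> gint_primes" "d a dvd a" if a: "a \<noteq> 0" "\<not> a dvd 1" for a
  proof -
    obtain p where "p \<in> gint_primes \<and> p dvd a"
      using gint_primes_divisor_exists[OF a] by blast
    then have "d a \<in> gint_primes \<and> d a dvd a"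
      unfolding d_def by (rule someI)
    then show "d a \<in> gint_primes" "d a dvd a"
      by auto
  qed
  \<comment> \<open>One chosen prime divisor for each nonzero nonunit of \<open>F\<close>.\<close>
  define P0 where "P0 = d ` {a \<in> F. a \<noteq> 0 \<and> \<not> a dvd 1}"
  have P0: "finite P0" "P0 \<subseteq> gint_primes"
    using F(1) d by (auto simp: P0_def)
  have "dist (hecke_L k s * (\<Prod>p\<in>P. 1 - hecke_term k s p)) (of_nat gint_unit_count) < e"
    if P: "finite P" "P0 \<subseteq> P" "P \<subseteq> gint_primes" for P
  proof -
    have U: "?U \<subseteq> sifted P"
    proof (intro subsetI)
      fix a assume a: "a \<in> ?U"
      have "\<not> p dvd a" if "p \<in> P" for p
        using that P(3) a gint_primes_imp_prime_elem[of p] dvd_trans[of p a 1]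
        by (auto simp: prime_elem_def)
      then show "a \<in> sifted P"
        by (simp add: sifted_def)
    qed
    have R: "a = 0 \<or> a \<notin> F" if "a \<in> sifted P - ?U" for a
      using that d[of a] P(2) by (auto simp: sifted_def P0_def)
    have "infsum (hecke_term k s) (?U \<union> (sifted P - ?U))
        = infsum (hecke_term k s) ?U + infsum (hecke_term k s) (sifted P - ?U)"
      by (rule infsum_Un_disjoint) (auto intro: summable_on_hecke_term s)
    also have "?U \<union> (sifted P - ?U) = sifted P"
      using U by auto
    also have "infsum (hecke_term k s) ?U = of_nat gint_unit_count"
 
      using finite_gint_units by (simp add: hecke_term_unit gint_unit_count_def)
    finally have "dist (hecke_L k s * (\<Prod>p\<in>P. 1 - hecke_term k s p)) (of_nat gint_unit_count)
        = norm (infsum (hecke_term k s) (sifted P - ?U))"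
      using hecke_L_sieve[OF s P(1,3), of k] by (simp add: dist_norm)
    also have "\<dots> \<le> infsum ?n (sifted P - ?U)"
      by (rule norm_infsum_bound) (rule sum)
    also have "\<dots> \<le> infsum ?n (- F)"
    proof (rule infsum_mono_neutral)
      show "?n a \<le> 0" if "a \<in> (sifted P - ?U) - (- F)" for a
        using R[of a] that by auto
    qed (use sum in auto)
    also have "\<dots> < e"
      by (rule tail)
    finally show ?thesis .
  qed
  then show "\<forall>\<^sub>F P in finite_subsets_at_top gint_primes.
      dist (hecke_L k s * (\<Prod>p\<in>P. 1 - hecke_term k s p)) (of_nat gint_unit_count) < e"
    unfolding eventually_finite_subsets_at_top using P0 by blast
qed

text \<open>If the series were 0, the sieved products would be constantly 0 and could not tend to
  the positive number of units.\<close>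

lemma hecke_L_nonzero: "s > 1 \<Longrightarrow> hecke_L k s \<noteq> 0"
proof
  assume "s > 1" "hecke_L k s = 0"
  then have "((\<lambda>P. 0) \<longlongrightarrow> (of_nat gint_unit_count :: complex)) (finite_subsets_at_top gint_primes)"
    using hecke_euler_product[of s k] by simp
  then have "(of_nat gint_unit_count :: complex) = 0"
    by (simp add: tendsto_const_iff)
  then show False
    using gint_unit_count_pos by simp
qed

lemma hecke_euler_product':
  assumes s: "s > 1"
  shows "((\<lambda>P. \<Prod>p\<in>P. 1 - hecke_term k s p) \<longlongrightarrow> of_nat gint_unit_count / hecke_L k s)
    (finite_subsets_at_top gint_primes)"
proof -
  have "((\<lambda>P. hecke_L k s * (\<Prod>p\<in>P. 1 - hecke_term k s p) / hecke_L k s)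
      \<longlongrightarrow> of_nat gint_unit_count / hecke_L k s) (finite_subsets_at_top gint_primes)"
    using hecke_L_nonzero[OF s] by (intro tendsto_divide hecke_euler_product s tendsto_const) auto
  then show ?thesis
    using hecke_L_nonzero[OF s] by simp
qed

subsection \<open>Multiplication by 2 + i and the behaviour near s = 1\<close>

definition two_plus_i :: gint where
  "two_plus_i = Gint 2 1"

lemma gnorm_two_plus_i [simp]: "gnorm two_plus_i = 5"
  by (simp add: two_plus_i_def gnorm_def)

lemma two_plus_i_nonzero [simp]: "two_plus_i \<noteq> 0"
  by (simp add: two_plus_i_def zero_gint_def)

text \<open>Modulo 2 + i one has i = -2, so the residue ring is that of the integers modulo 5.
  Symmetric residues keep the shifts at most 2 in modulus.\<close>

lemma bij_two_plus_i_residues: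
  "bij_betw (\<lambda>(a, c). two_plus_i * a + Gint c 0) (UNIV \<times> {-2..2}) UNIV"
  unfolding bij_betw_def
proof (intro conjI equalityI subsetI)
  show "inj_on (\<lambda>(a, c). two_plus_i * a + Gint c 0) (UNIV \<times> {-2..2})"
  proof (rule inj_onI, clarify)
    fix a c a' c'
    assume c: "c \<in> {-2..2}" "c' \<in> {-2..2}"
      and "two_plus_i * a + Gint c 0 = two_plus_i * a' + Gint c' 0"
    then have *: "2 * gre a - gim a + c = 2 * gre a' - gim a' + c'"
        "2 * gim a + gre a = 2 * gim a' + gre a'"
      by (simp_all add: two_plus_i_def plus_gint_def times_gint_def)
    have "5 * (gim a' - gim a) = c' - c"
      using * by presburger
    moreover have "\<bar>c' - c\<bar> \<le> 4"
      using c by auto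
    ultimately have "gim a' - gim a = 0"
      by presburger
    then have "gre a = gre a'" "gim a = gim a'" "c = c'"
      using * by linarith+
    then show "a = a' \<and> c = c'"
      by (simp add: gint.expand)
  qed
  fix b :: gint
  \<comment> \<open>\<open>c\<close> is the symmetric residue of \<open>gre b - 2 * gim b\<close>
    modulo 5, and \<open>y\<close> becomes the imaginary part of the preimage.\<close>
  have "\<exists>y c. -2 \<le> c \<and> c \<le> 2 \<and> c - 5 * y = gre b - 2 * gim b"
    by presburger
  then obtain y c where yc: "-2 \<le> c" "c \<le> 2" "c - 5 * y = gre b - 2 * gim b"
    by blast
  have "two_plus_i * Gint (gim b - 2 * y) y + Gint c 0 = b"
    using yc by (simp add: two_plus_i_def plus_gint_def times_gint_def gint.expand)
  then show "b \<in> (\<lambda>(a, c). two_plus_i * a + Gint c 0) ` (UNIV \<times> {-2..2})"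
    using yc by (auto intro!: image_eqI[of _ _ "(Gint (gim b - 2 * y) y, c)"])
qed auto

text \<open>The profile \<open>H\<close> is left free because the same estimates serve
  \<open>x powr (-s)\<close>, for boundedness, and the difference of two such functions, for the
  Lipschitz bound.\<close>

definition radial :: "nat \<Rightarrow> (real \<Rightarrow> real) \<Rightarrow> gint \<Rightarrow> complex" where
  "radial k H a = hecke k a * of_real (H (real (gnorm a)))"

text \<open>Summed over \<open>a\<close>, this is the full series minus five times its part over the
  multiples of 2 + i.\<close>

definition defect :: "nat \<Rightarrow> (real \<Rightarrow> real) \<Rightarrow> gint \<Rightarrow> complex" where
  "defect k H a = (\<Sum>c\<in>{-2..2}. radial k H (two_plus_i * a + Gint c 0) - radial k H (two_plus_i * a))"

lemma norm_sgn_diff_le: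
  fixes x y :: complex
  assumes "x \<noteq> 0"
  shows "norm (sgn x - sgn y) \<le> 2 * norm (x - y) / norm x"
proof (cases "y = 0")
  case False
  have "sgn x - sgn y = (x - y) / norm x + y * of_real (norm y - norm x) / (norm x * norm y)"
    using assms False by (simp add: sgn_div_norm scaleR_conv_of_real field_simps)
  then have "norm (sgn x - sgn y)
      \<le> norm ((x - y) / norm x) + norm (y * of_real (norm y - norm x) / (norm x * norm y))"
    by (metis norm_triangle_ineq)
  also have "norm (y * of_real (norm y - norm x) / (norm x * norm y)) = \<bar>norm y - norm x\<bar> / norm x"
    using assms False by (simp add: norm_mult norm_divide del: of_real_diff)
  also have "\<dots> \<le> norm (x - y) / norm x"
    by (intro divide_right_mono) (auto simp: norm_triangle_ineq3 abs_minus_commute[of "norm y"])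
  finally show ?thesis
    by (simp add: norm_divide)
qed (use assms in \<open>simp add: norm_sgn\<close>)

text \<open>The exponents are such that shifting the argument by a bounded amount changes a tame radial
  term at \<open>a\<close> by \<open>O(\<bar>a\<bar> powr (-5/2))\<close>, which is summable over the lattice.\<close>

definition tame :: "real \<Rightarrow> (real \<Rightarrow> real) \<Rightarrow> bool" where
  "tame K H \<longleftrightarrow> H 0 = 0 \<and> (\<forall>x\<ge>1. \<bar>H x\<bar> \<le> K * x powr (-3/4)) \<and>
     (\<exists>H'. \<forall>x\<ge>1. (H has_real_derivative H' x) (at x) \<and> \<bar>H' x\<bar> \<le> K * x powr (-7/4))"

lemma tame_nonneg: "tame K H \<Longrightarrow> K \<ge> 0"
  unfolding tame_def by (metis abs_ge_zero mult.right_neutral order.refl order_trans powr_one_eq_one)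

text \<open>Let X be the norm of \<open>a\<close>. The character changes by O(X^(-1/2)) while
  \<open>H\<close> is O(X^(-3/4)); the norm changes by O(X^(1/2)) while the derivative of
  \<open>H\<close> is O(X^(-7/4)). Both products are O(X^(-5/4)). The constants are 200 = 8 * 25 and
  10000 = 16 * 625.\<close>

lemma norm_radial_shift_le:
  assumes H: "tame K H" and a: "a \<noteq> 0" and c: "\<bar>c\<bar> \<le> 2"
  shows "norm (radial k H (two_plus_i * a + Gint c 0) - radial k H (two_plus_i * a))
    \<le> K * (10000 + 200 * real k) * real (gnorm a) powr (-5/4)"
proof -
  define b b' where "b = two_plus_i * a" and "b' = two_plus_i * a + Gint c 0"
  define w w' where "w = of_gint b" and "w' = of_gint b'"
  define r where "r = norm (of_gint a)"
  define X where "X = real (gnorm a)"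
  have K: "K \<ge> 0"
    using H by (rule tame_nonneg)
  have X: "X \<ge> 1"
    using a gnorm_pos_iff[of a] by (simp add: X_def Suc_leI)
  have rX: "r = X powr (1/2)"
    by (simp add: r_def X_def norm_of_gint powr_half_sqrt)
  have r2: "r\<^sup>2 = X"
    by (simp add: r_def X_def norm_of_gint_sq)
  have r: "r \<ge> 1"
    using X by (simp add: r_def norm_of_gint X_def)
  \<comment> \<open>A lower bound above 2 keeps the shifted point away from 0:
    \<open>22/10 * r - 2\<close> is at least \<open>r / 5\<close> as soon as \<open>r\<close> is at
    least 1.\<close>
  have s5: "sqrt 5 \<ge> 22/10" "sqrt 5 \<le> 3"
    by (rule real_le_rsqrt, simp add: power2_eq_square) (rule real_le_lsqrt, auto)
  have nw: "norm w = sqrt 5 * r"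
    unfolding w_def b_def r_def norm_of_gint by (simp add: real_sqrt_mult)
  have ww': "norm (w - w') \<le> 2"
  proof -
    have "w' = w + of_gint (Gint c 0)"
      by (simp add: w_def w'_def b_def b'_def)
    then show ?thesis
      using c by (simp add: of_gint_def cmod_def)
  qed
  have "norm w' \<ge> norm w - 2"
    using ww' norm_triangle_ineq2[of w w'] by linarith
  moreover have "22/10 * r \<le> sqrt 5 * r"
    using s5 r by (intro mult_right_mono) auto
  ultimately have nw': "norm w' \<ge> r / 5"
    using r unfolding nw by linarith
  define n n' where "n = real (gnorm b)" and "n' = real (gnorm b')"
  have w0: "w \<noteq> 0" "w' \<noteq> 0"
    using nw nw' r s5 by auto
  have n1: "n \<ge> 1" "n' \<ge> 1"
    using w0 gnorm_pos_iff[of b] gnorm_pos_iff[of b']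
    unfolding n_def n'_def w_def w'_def of_gint_eq_0_iff by linarith+
  have nn: "n = (norm w)\<^sup>2" "n' = (norm w')\<^sup>2"
    by (simp_all add: n_def n'_def w_def w'_def norm_of_gint_sq)
  have "(r / 5)\<^sup>2 \<le> n'"
    unfolding nn using nw' r by (intro power_mono) auto
  then have n'X: "X / 25 \<le> n'"
    using r2 by (simp add: power_divide)
  have nX: "X / 25 \<le> n"
    unfolding nn nw using r2 X by (simp add: power_mult_distrib)
  \<comment> \<open>A convex set that contains both norms and on which the decay bounds are
    available, as the mean value theorem requires.\<close>
  define S where "S = {max 1 (X / 25)..}"
  have powr_bd: "x powr (-q) \<le> 25 powr q * X powr (-q)" if "x \<in> S" "q > 0" for x q
  proof -
    have "x powr (-q) \<le> (X / 25) powr (-q)"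
      using that X by (intro powr_mono2') (auto simp: S_def)
    also have "\<dots> = 25 powr q * X powr (-q)"
      using X by (simp add: powr_divide powr_minus field_simps)
    finally show ?thesis .
  qed
  have bd1: "x powr (-3/4) \<le> 25 * X powr (-3/4)" if "x \<in> S" for x
  proof -
    have "25 powr (3/4) \<le> (25 powr 1 :: real)"
      by (intro powr_mono) auto
    then have "25 powr (3/4) * X powr (-3/4) \<le> 25 * X powr (-3/4)"
      by (intro mult_right_mono) auto
    then show ?thesis
      using powr_bd[OF that, of "3/4"] by simp
  qed
  have bd2: "x powr (-7/4) \<le> 625 * X powr (-7/4)" if "x \<in> S" for x
  proof -
    have "25 powr (7/4) \<le> (25 powr 2 :: real)"
      by (intro powr_mono) auto
    then have "25 powr (7/4) * X powr (-7/4) \<le> 625 * X powr (-7/4)"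
      by (intro mult_right_mono) auto
    then show ?thesis
      using powr_bd[OF that, of "7/4"] by simp
  qed
  have S: "n \<in> S" "n' \<in> S"
    using n1 nX n'X by (auto simp: S_def)
  obtain H' where H': "\<And>x. x \<ge> 1 \<Longrightarrow> (H has_real_derivative H' x) (at x)"
      "\<And>x. x \<ge> 1 \<Longrightarrow> \<bar>H' x\<bar> \<le> K * x powr (-7/4)"
    using H unfolding tame_def by blast
  have "norm (H n' - H n) \<le> K * (625 * X powr (-7/4)) * norm (n' - n)"
  proof (rule field_differentiable_bound[where S = S and f' = H'])
    show "convex S"
      by (simp add: S_def)
    show "(H has_field_derivative H' x) (at x within S)" if "x \<in> S" for x
      using that by (intro has_field_derivative_at_within[OF H'(1)]) (auto simp: S_def)
    show "norm (H' x) \<le> K * (625 * X powr (-7/4))" if "x \<in> S" for x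
      using H'(2)[of x] mult_left_mono[OF bd2[OF that] K] that by (auto simp: S_def)
  qed (use S in auto)
  also have "norm (n' - n) \<le> 16 * X powr (1/2)"
  proof -
    have "norm w' \<le> norm w + 2"
      using ww' norm_triangle_ineq2[of w' w] by (simp add: norm_minus_commute)
    then have "norm w' + norm w \<le> 2 * (sqrt 5 * r) + 2"
      using nw by linarith
    also have "\<dots> \<le> 8 * r"
      using mult_right_mono[of "sqrt 5" 3 r] s5 r by linarith
    finally have 1: "norm w' + norm w \<le> 8 * r" .
    have 2: "\<bar>norm w' - norm w\<bar> \<le> 2"
      using ww' norm_triangle_ineq3[of w' w] by (simp add: norm_minus_commute)
    have "norm (n' - n) = \<bar>norm w' - norm w\<bar> * (norm w' + norm w)"
      unfolding nn by (simp add: abs_mult power2_eq_square square_diff_square_factored)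
    also have "\<dots> \<le> 2 * (8 * r)"
      using 1 2 by (intro mult_mono) auto
    finally show ?thesis
      using rX by simp
  qed
  finally have "\<bar>H n' - H n\<bar> \<le> K * (625 * X powr (-7/4)) * (16 * X powr (1/2))"
    using K X by (simp add: mult_left_mono)
  also have "\<dots> = 10000 * K * (X powr (-7/4) * X powr (1/2))"
    by simp
  also have "X powr (-7/4) * X powr (1/2) = X powr (-5/4)"
    by (simp flip: powr_add)
  finally have A: "\<bar>H n' - H n\<bar> \<le> 10000 * K * X powr (-5/4)" .
  have "norm (sgn w - sgn w') \<le> 2 * norm (w - w') / norm w"
    by (rule norm_sgn_diff_le) (rule w0)
  also have "\<dots> \<le> 2 * 2 / (2 * r)"
    using ww' r nw s5 by (intro frac_le mult_left_mono) auto
  also have "\<dots> = 2 * X powr (-1/2)"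
    using rX X by (simp add: powr_minus field_simps)
  finally have sw: "norm (sgn w - sgn w') \<le> 2 * X powr (-1/2)" .
  have "norm (hecke k b' - hecke k b) \<le> real (4 * k) * norm (sgn w' - sgn w)"
    unfolding hecke_def w_def w'_def by (rule norm_power_diff) (auto simp: norm_sgn)
  also have "\<dots> \<le> real (4 * k) * (2 * X powr (-1/2))"
    using sw by (intro mult_left_mono) (auto simp: norm_minus_commute)
  finally have B1: "norm (hecke k b' - hecke k b) \<le> 8 * real k * X powr (-1/2)"
    by simp
  have "\<bar>H n'\<bar> \<le> K * n' powr (-3/4)"
    using H n1 by (simp add: tame_def)
  also have "\<dots> \<le> K * (25 * X powr (-3/4))"
    using bd1[OF S(2)] K by (intro mult_left_mono) auto
  finally have B2: "\<bar>H n'\<bar> \<le> K * (25 * X powr (-3/4))" .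
  have "norm (hecke k b' - hecke k b) * \<bar>H n'\<bar>
      \<le> (8 * real k * X powr (-1/2)) * (K * (25 * X powr (-3/4)))"
    using B1 B2 by (intro mult_mono) auto
  also have "\<dots> = 200 * real k * K * (X powr (-1/2) * X powr (-3/4))"
    by simp
  also have "X powr (-1/2) * X powr (-3/4) = X powr (-5/4)"
    by (simp flip: powr_add)
  finally have B: "norm (hecke k b' - hecke k b) * \<bar>H n'\<bar> \<le> 200 * real k * K * X powr (-5/4)" .
  have "radial k H b' - radial k H b
      = (hecke k b' - hecke k b) * of_real (H n') + hecke k b * of_real (H n' - H n)"
    by (simp add: radial_def n_def n'_def algebra_simps)
  then have "norm (radial k H b' - radial k H b)
      \<le> norm ((hecke k b' - hecke k b) * of_real (H n')) + norm (hecke k b * of_real (H n' - H n))"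
    by (metis norm_triangle_ineq)
  also have "\<dots> \<le> norm (hecke k b' - hecke k b) * \<bar>H n'\<bar> + 1 * \<bar>H n' - H n\<bar>"
    unfolding norm_mult norm_of_real by (intro add_mono mult_right_mono norm_hecke_le) auto
  also have "\<dots> \<le> 200 * real k * K * X powr (-5/4) + 10000 * K * X powr (-5/4)"
    using A B by simp
  also have "\<dots> = K * (10000 + 200 * real k) * X powr (-5/4)"
    by (simp add: algebra_simps)
  finally show ?thesis
    by (simp add: X_def b_def b'_def)
qed

text \<open>The leading 5 pays for the five terms at \<open>a = 0\<close>, where the shift estimate
  does not apply; the rest is five shifts at every other point.\<close>

definition defect_const :: "nat \<Rightarrow> real" where
  "defect_const k = 5 + 5 * (10000 + 200 * real k) * (\<Sum>\<^sub>\<infinity>a. real (gnorm a) powr (-5/4))"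

lemma norm_defect_le:
  assumes H: "tame K H"
  shows "norm (defect k H a)
    \<le> K * (5 * of_bool (a = 0) + 5 * (10000 + 200 * real k) * real (gnorm a) powr (-5/4))"
proof (cases "a = 0")
  case False
  have "norm (defect k H a) \<le> (\<Sum>c\<in>{-2..2::int}. K * (10000 + 200 * real k) * real (gnorm a) powr (-5/4))"
    unfolding defect_def by (rule sum_norm_le) (use norm_radial_shift_le[OF H False] in auto)
  also have "\<dots> = K * (5 * (10000 + 200 * real k) * real (gnorm a) powr (-5/4))"
    by simp
  finally show ?thesis
    using False by simp
next
  case True
  have K: "K \<ge> 0"
    using H by (rule tame_nonneg)
  have "norm (radial k H (Gint c 0) - radial k H 0) \<le> K" for c
  proof (cases "c = 0")
    case False
    then have g: "gnorm (Gint c 0) \<noteq> 0"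
      by (simp add: zero_gint_def)
    then have "real (gnorm (Gint c 0)) \<ge> 1"
      by linarith
    then have "\<bar>H (real (gnorm (Gint c 0)))\<bar> \<le> K * real (gnorm (Gint c 0)) powr (-3/4)"
      using H by (simp add: tame_def)
    also have "\<dots> \<le> K * real (gnorm (Gint c 0)) powr 0"
      using \<open>real (gnorm (Gint c 0)) \<ge> 1\<close> K by (intro mult_left_mono powr_mono) auto
    finally show ?thesis
      using g H by (simp add: radial_def tame_def norm_mult norm_hecke)
  qed (use K in \<open>simp flip: zero_gint_def\<close>)
  then have "norm (defect k H a) \<le> (\<Sum>c\<in>{-2..2::int}. K)"
    unfolding defect_def using True by (intro sum_norm_le) simp
  then show ?thesis
    using True by simp
qed

lemma
  assumes H: "tame K H"
  shows summable_on_defect: "defect k H summable_on UNIV"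
    and norm_infsum_defect_le: "norm (infsum (defect k H) UNIV) \<le> K * defect_const k"
proof -
  let ?B = "\<lambda>a. K * (5 * of_bool (a = 0) + 5 * (10000 + 200 * real k) * real (gnorm a) powr (-5/4))"
  have "((\<lambda>a :: gint. 5 * of_bool (a = 0)) has_sum (5::real)) UNIV"
    by (rule has_sum_finite_neutralI[of "{0}"]) auto
  moreover have "((\<lambda>a. real (gnorm a) powr (-5/4)) has_sum (\<Sum>\<^sub>\<infinity>a. real (gnorm a) powr (-5/4))) UNIV"
    using summable_on_gnorm_powr[of "5/4"] by simp
  ultimately have B: "(?B has_sum K * defect_const k) UNIV"
    unfolding defect_const_def by (intro has_sum_cmult_right has_sum_add)
  have "(\<lambda>a. norm (defect k H a)) summable_on UNIV"
    by (rule summable_on_comparison_test[OF has_sum_imp_summable[OF B]])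
      (use norm_defect_le[OF H] in auto)
  then show sum: "defect k H summable_on UNIV"
    by (rule abs_summable_summable)
  show "norm (infsum (defect k H) UNIV) \<le> K * defect_const k"
    by (rule norm_infsum_le[OF has_sum_infsum[OF sum] B norm_defect_le[OF H]])
qed

lemma defect_const_pos: "defect_const k > 0"
  unfolding defect_const_def by (intro add_pos_nonneg mult_nonneg_nonneg infsum_nonneg) auto

text \<open>The endpoint \<open>s = 1\<close> is included, so the defect series is controlled up to
  the boundary of the range of the L-series. The constant 2 bounds the factor \<open>s\<close>
  produced by differentiation.\<close>

lemma tame_powr:
  assumes "s \<in> {1..2}"
  shows "tame 2 (\<lambda>x. x powr (-s))"
  unfolding tame_def
proof (intro conjI exI allI impI)
  fix x :: real assume x: "x \<ge> 1"
  have "x powr (-s) \<le> x powr (-3/4)"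
    using assms x by (intro powr_mono) auto
  also have "\<dots> \<le> 2 * x powr (-3/4)"
    by simp
  finally show "\<bar>x powr (-s)\<bar> \<le> 2 * x powr (-3/4)"
    by simp
  show "((\<lambda>x. x powr (-s)) has_real_derivative - s * x powr (-s - 1)) (at x)"
    using x by (auto intro!: derivative_eq_intros)
  have "x powr (-s-1) \<le> x powr (-7/4)"
    using assms x by (intro powr_mono) auto
  then show "\<bar>- s * x powr (-s - 1)\<bar> \<le> 2 * x powr (-7/4)"
    using assms by (auto simp: abs_mult intro!: mult_mono)
qed simp

text \<open>Mean value theorem in the exponent. It brings a logarithm, absorbed by
  \<open>4 * x powr (1/4)\<close>; this is the quarter that separates the exponents of
  \<open>tame\<close> from -1 and -2. The 9 is 2 * 4 + 1, from \<open>u * ln x - 1\<close> with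
  \<open>u\<close> at most 2.\<close>

lemma tame_powr_diff:
  assumes st: "s \<in> {1..2}" "t \<in> {1..2}"
  shows "tame (9 * \<bar>s - t\<bar>) (\<lambda>x. x powr (-s) - x powr (-t))"
  unfolding tame_def
proof (intro conjI exI allI impI)
  fix x :: real assume x: "x \<ge> 1"
  have ln: "0 \<le> ln x" "ln x \<le> 4 * x powr (1/4)"
    using ln_powr_bound[OF x, of "1/4"] x by auto
  have "norm (x powr (-s) - x powr (-t)) \<le> 4 * x powr (-3/4) * norm (s - t)"
  proof (rule field_differentiable_bound[where S = "{1..2}" and f' = "\<lambda>u. - ln x * x powr (-u)"])
    show "((\<lambda>u. x powr (-u)) has_field_derivative - ln x * x powr (-u)) (at u within {1..2})" for u
      using x by (auto intro!: derivative_eq_intros simp: powr_def)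
    show "norm (- ln x * x powr (-u)) \<le> 4 * x powr (-3/4)" if u: "u \<in> {1..2}" for u
    proof -
      have "norm (- ln x * x powr (-u)) = ln x * x powr (-u)"
        using ln by (simp add: abs_mult)
      also have "\<dots> \<le> (4 * x powr (1/4)) * x powr (-1)"
        using ln u x by (intro mult_mono powr_mono) auto
      also have "\<dots> = 4 * (x powr (1/4) * x powr (-1))"
        by simp
      also have "x powr (1/4) * x powr (-1) = x powr (-3/4)"
        unfolding powr_add[symmetric] by simp
      finally show ?thesis .
    qed
  qed (use st in auto)
  then show "\<bar>x powr (-s) - x powr (-t)\<bar> \<le> 9 * \<bar>s - t\<bar> * x powr (-3/4)"
    using mult_right_mono[of 4 9 "\<bar>s - t\<bar> * x powr (-3/4)"] by (simp add: mult_ac)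
  show "((\<lambda>x. x powr (-s) - x powr (-t)) has_real_derivative
      - s * x powr (-s - 1) - (- t * x powr (-t - 1))) (at x)"
    using x by (auto intro!: derivative_eq_intros)
  have "norm (- s * x powr (-s - 1) - (- t * x powr (-t - 1))) \<le> 9 * x powr (-7/4) * norm (s - t)"
  proof (rule field_differentiable_bound[where S = "{1..2}" and
        f' = "\<lambda>u. (u * ln x - 1) * x powr (-u - 1)"])
    show "((\<lambda>u. - u * x powr (-u - 1)) has_field_derivative (u * ln x - 1) * x powr (-u - 1))
        (at u within {1..2})" for u
      using x by (auto intro!: derivative_eq_intros simp: powr_def algebra_simps)
    show "norm ((u * ln x - 1) * x powr (-u - 1)) \<le> 9 * x powr (-7/4)" if u: "u \<in> {1..2}" for u
    proof -
      have "u * ln x \<le> 2 * (4 * x powr (1/4))"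
        using u ln by (intro mult_mono) auto
      moreover have "u * ln x \<ge> 0"
        using u ln by auto
      moreover have "1 \<le> x powr (1/4)"
        using x by (intro ge_one_powr_ge_zero) auto
      ultimately have "\<bar>u * ln x - 1\<bar> \<le> 9 * x powr (1/4)"
        by linarith
      then have "norm ((u * ln x - 1) * x powr (-u - 1)) \<le> (9 * x powr (1/4)) * x powr (-2)"
        unfolding norm_mult using u x by (intro mult_mono) (auto intro!: powr_mono)
      also have "\<dots> = 9 * (x powr (1/4) * x powr (-2))"
        by simp
      also have "x powr (1/4) * x powr (-2) = x powr (-7/4)"
        unfolding powr_add[symmetric] by simp
      finally show ?thesis .
    qed
  qed (use st in auto)
  then show "\<bar>- s * x powr (-s - 1) - (- t * x powr (-t - 1))\<bar> \<le> 9 * \<bar>s - t\<bar> * x powr (-7/4)"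
    by (simp add: mult_ac)
qed simp

definition hecke_E :: "nat \<Rightarrow> real \<Rightarrow> complex" where
  "hecke_E k s = infsum (defect k (\<lambda>x. x powr (-s))) UNIV"

lemma norm_hecke_E_le: "s \<in> {1..2} \<Longrightarrow> norm (hecke_E k s) \<le> 2 * defect_const k"
  unfolding hecke_E_def by (intro norm_infsum_defect_le tame_powr)

lemma norm_hecke_E_diff_le:
  assumes st: "s \<in> {1..2}" "t \<in> {1..2}"
  shows "norm (hecke_E k s - hecke_E k t) \<le> 9 * \<bar>s - t\<bar> * defect_const k"
proof -
  have "(defect k (\<lambda>x. x powr (-s)) has_sum hecke_E k s) UNIV"
    "(defect k (\<lambda>x. x powr (-t)) has_sum hecke_E k t) UNIV"
    unfolding hecke_E_def
    by (rule has_sum_infsum, rule summable_on_defect, rule tame_powr, rule st)+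
  then have "((\<lambda>a. defect k (\<lambda>x. x powr (-s)) a + - defect k (\<lambda>x. x powr (-t)) a)
      has_sum hecke_E k s + - hecke_E k t) UNIV"
    by (intro has_sum_add) (simp_all add: has_sum_uminusI)
  also have "(\<lambda>a. defect k (\<lambda>x. x powr (-s)) a + - defect k (\<lambda>x. x powr (-t)) a)
      = defect k (\<lambda>x. x powr (-s) - x powr (-t))"
    by (simp add: fun_eq_iff defect_def radial_def algebra_simps flip: sum_subtractf)
  finally have "infsum (defect k (\<lambda>x. x powr (-s) - x powr (-t))) UNIV = hecke_E k s - hecke_E k t"
    by (simp add: infsumI)
  then show ?thesis
    using norm_infsum_defect_le[OF tame_powr_diff[OF st], of k] by simp
qed

lemma hecke_term_eq_radial: "hecke_term k s = radial k (\<lambda>x. x powr (-s))"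
  by (simp add: fun_eq_iff hecke_term_def radial_def)

lemma hecke_L_functional:
  assumes s: "s > 1" "s \<le> 2"
  shows "hecke_L k s * (1 - hecke k two_plus_i * of_real (5 powr (1 - s))) = hecke_E k s"
proof -
  let ?f = "hecke_term k s"
  have sum: "(?f has_sum hecke_L k s) UNIV"
    unfolding hecke_L_def using s by (intro has_sum_infsum summable_on_hecke_term)
  then have "((\<lambda>(a, c). ?f (two_plus_i * a + Gint c 0)) has_sum hecke_L k s) (UNIV \<times> {-2..2})"
    using has_sum_reindex_bij_betw[OF bij_two_plus_i_residues, of ?f] by (simp add: case_prod_unfold)
  from has_sum_Sigma'[OF this, of "\<lambda>a. \<Sum>c\<in>{-2..2}. ?f (two_plus_i * a + Gint c 0)"]
  have 1: "((\<lambda>a. \<Sum>c\<in>{-2..2}. ?f (two_plus_i * a + Gint c 0)) has_sum hecke_L k s) UNIV"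
    by simp
  have "((\<lambda>a. - (5 * ?f two_plus_i * ?f a)) has_sum - (5 * ?f two_plus_i * hecke_L k s)) UNIV"
    by (subst has_sum_uminus) (simp add: has_sum_cmult_right sum)
  from has_sum_add[OF 1 this]
  have "((\<lambda>a. (\<Sum>c\<in>{-2..2}. ?f (two_plus_i * a + Gint c 0)) + - (5 * ?f two_plus_i * ?f a))
      has_sum hecke_L k s + - (5 * ?f two_plus_i * hecke_L k s)) UNIV" .
  also have "(\<lambda>a. (\<Sum>c\<in>{-2..2}. ?f (two_plus_i * a + Gint c 0)) + - (5 * ?f two_plus_i * ?f a))
      = defect k (\<lambda>x. x powr (-s))"
    by (simp add: fun_eq_iff defect_def sum_subtractf hecke_term_mult flip: hecke_term_eq_radial)
  finally have "hecke_E k s = hecke_L k s + - (5 * ?f two_plus_i * hecke_L k s)"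
    unfolding hecke_E_def by (rule infsumI)
  \<comment> \<open>Five residue classes against the norm 5: this is what puts the critical point of
    the factor at s = 1.\<close>
  also have "5 * ?f two_plus_i = hecke k two_plus_i * of_real (5 powr (1 - s))"
  proof -
    have "5 powr (1 - s) = 5 * 5 powr (- s)"
      using powr_add[of 5 1 "-s"] by simp
    then show ?thesis
      by (simp add: hecke_term_def)
  qed
  finally show ?thesis
    by (simp add: algebra_simps)
qed

text \<open>The value 1 would make (2 + i)^(4k) real. But (2 + i)^2 = 3 + 4i, and (3 + 4i)^2 is
  congruent to 3 + 4i modulo 5, so every positive power of it has imaginary part 4 modulo 5.\<close>

lemma hecke_two_plus_i_neq_1:
  assumes k: "k \<ge> 1"
  shows "hecke k two_plus_i \<noteq> 1"
proof
  have mod5: "gre (two_plus_i ^ (2 * m)) mod 5 = 3 \<and> gim (two_plus_i ^ (2 * m)) mod 5 = 4"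
    if "m \<ge> 1" for m
    using that
  proof (induction m rule: dec_induct)
    case base
    show ?case
      by (simp add: two_plus_i_def power2_eq_square times_gint_def)
  next
    case (step m)
    define z where "z = two_plus_i ^ (2 * m)"
    have "two_plus_i ^ (2 * Suc m) = z * Gint 3 4"
      by (simp add: z_def power2_eq_square two_plus_i_def times_gint_def mult_ac)
    then have "gre (two_plus_i ^ (2 * Suc m)) = 3 * gre z - 4 * gim z"
      "gim (two_plus_i ^ (2 * Suc m)) = 4 * gre z + 3 * gim z"
      by (simp_all add: times_gint_def)
    moreover obtain u w where "gre z = 5 * u + 3" "gim z = 5 * w + 4"
      using step.IH unfolding z_def[symmetric] by (metis mult_div_mod_eq)
    ultimately have "gre (two_plus_i ^ (2 * Suc m)) = 5 * (3 * u - 4 * w - 2) + 3"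
      "gim (two_plus_i ^ (2 * Suc m)) = 5 * (4 * u + 3 * w + 4) + 4"
      by simp_all
    then show ?case
      by (simp only: mod_mult_self4) simp
  qed
  assume *: "hecke k two_plus_i = 1"
  have "hecke k two_plus_i = of_gint two_plus_i ^ (4 * k) / of_real (sqrt 5) ^ (4 * k)"
    by (simp add: hecke_def sgn_div_norm norm_of_gint power_divide scaleR_conv_of_real
        divide_inverse[symmetric] inverse_eq_divide)
  then have "of_gint two_plus_i ^ (4 * k) = of_real (sqrt 5 ^ (4 * k))"
    using * by simp
  then have "Im (of_gint (two_plus_i ^ (2 * (2 * k)))) = 0"
    by (simp add: mult.assoc[symmetric])
  then have "gim (two_plus_i ^ (2 * (2 * k))) = 0"
    unfolding of_gint_def by simp
  then show False
    using mod5[of "2 * k"] k by simp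
qed

text \<open>A lower bound, uniform in \<open>s\<close>, for the modulus of g = 1 - v r with r =
  5^(1-s). Since 1 - r is at most |g|, the identity r (1 - v) = g - (1 - r) gives r |1 - v| at most
  2 |g|; with r at least 1/5 this yields the 10.\<close>

definition hecke_gap :: "nat \<Rightarrow> real" where
  "hecke_gap k = norm (1 - hecke k two_plus_i) / 10"

lemma hecke_gap_pos: "k \<ge> 1 \<Longrightarrow> hecke_gap k > 0"
  using hecke_two_plus_i_neq_1[of k] by (simp add: hecke_gap_def)

lemma hecke_L_factor_bounds:
  fixes k :: nat and s :: real
  assumes s: "s > 1" "s \<le> 2"
  defines "g \<equiv> 1 - hecke k two_plus_i * of_real (5 powr (1 - s))"
  shows "hecke_gap k \<le> norm g" "norm g \<le> 2"
proof -
  define r where "r = (5::real) powr (1 - s)"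
  have "5 powr (-1) \<le> r" "r \<le> 5 powr 0"
    unfolding r_def using s by (intro powr_mono; simp)+
  then have r: "1/5 \<le> r" "r \<le> 1"
    by (simp_all add: powr_minus)
  let ?v = "hecke k two_plus_i"
  have v: "norm ?v = 1"
    by (simp add: norm_hecke)
  have g: "g = 1 - ?v * of_real r"
    by (simp add: g_def r_def)
  have "norm g \<le> norm (1::complex) + norm (?v * of_real r)"
    unfolding g by (rule norm_triangle_ineq4)
  then show "norm g \<le> 2"
    using v r by (simp add: norm_mult)
  have "norm (1::complex) - norm (?v * of_real r) \<le> norm g"
    unfolding g by (rule norm_triangle_ineq2)
  then have 1: "1 - r \<le> norm g"
    using v r by (simp add: norm_mult)
  have "of_real r * (1 - ?v) = g - of_real (1 - r)"
    by (simp add: g algebra_simps)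
  then have "norm (of_real r * (1 - ?v)) \<le> norm g + norm (of_real (1 - r) :: complex)"
    by (metis norm_triangle_ineq4)
  then have "r * norm (1 - ?v) \<le> 2 * norm g"
    using 1 r by (simp add: norm_mult del: of_real_diff)
  moreover have "1/5 * norm (1 - ?v) \<le> r * norm (1 - ?v)"
    using r by (intro mult_right_mono) auto
  ultimately show "hecke_gap k \<le> norm g"
    by (simp add: hecke_gap_def)
qed

section \<open>Upper bounds for the series near s = 1\<close>

lemma norm_hecke_E_eq:
  "s > 1 \<Longrightarrow> s \<le> 2 \<Longrightarrow>
    norm (hecke_E k s) = norm (hecke_L k s) * norm (1 - hecke k two_plus_i * of_real (5 powr (1 - s)))"
  by (simp flip: hecke_L_functional add: norm_mult)

lemma norm_hecke_L_le:
  assumes k: "k \<ge> 1" and s: "s > 1" "s \<le> 2"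
  shows "norm (hecke_L k s) \<le> 2 * defect_const k / hecke_gap k"
proof -
  have "norm (hecke_L k s) * hecke_gap k \<le> norm (hecke_E k s)"
    unfolding norm_hecke_E_eq[OF s] using hecke_L_factor_bounds[OF s, of k] by (intro mult_left_mono) auto
  also have "\<dots> \<le> 2 * defect_const k"
    using s by (intro norm_hecke_E_le) auto
  finally show ?thesis
    using hecke_gap_pos[OF k] by (simp add: field_simps)
qed

text \<open>For k = 0 the character value at 2 + i is 1, and \<open>1 - 5 powr (1 - s)\<close>
  vanishes only to first order: 5^(s-1) is at least 1 + (s - 1) ln 5, hence at least s.\<close>

lemma norm_hecke_L_0_le:
  assumes s: "s > 1" "s \<le> 2"
  shows "norm (hecke_L 0 s) \<le> 4 * defect_const 0 / (s - 1)"
proof -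
  have ln5: "ln 5 \<ge> (1::real)"
    using exp_le by (subst ln_ge_iff) auto
  have "(s - 1) * 1 \<le> (s - 1) * ln 5"
    using ln5 s by (intro mult_left_mono) auto
  then have "s \<le> 1 + (s - 1) * ln 5"
    by simp
  also have "\<dots> \<le> exp ((s - 1) * ln 5)"
    by simp
  also have "\<dots> = 5 powr (s - 1)"
    by (simp add: powr_def)
  finally have "5 powr (s - 1) \<ge> s" .
  moreover have "5 powr (1 - s) = 1 / 5 powr (s - 1)"
    using powr_minus_divide[of 5 "s - 1"] by simp
  ultimately have "5 powr (1 - s) \<le> 1 / s"
    using s by (simp add: frac_le)
  moreover have "1 - 1 / s \<ge> (s - 1) / 2"
  proof -
    have "(s - 1) / 2 \<le> (s - 1) / s"
      using s by (intro divide_left_mono) auto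
    then show ?thesis
      using s by (simp add: diff_divide_distrib)
  qed
  ultimately have g: "1 - 5 powr (1 - s) \<ge> (s - 1) / 2"
    by linarith
  have "norm (hecke_L 0 s) * ((s - 1) / 2) \<le> norm (hecke_L 0 s) * norm (1 - 5 powr (1 - s))"
    by (rule mult_left_mono) (use g in \<open>unfold real_norm_def, linarith\<close>, simp)
  also have "\<dots> = norm (hecke_E 0 s)"
  proof -
    have "norm (1 - of_real x :: complex) = norm (1 - x)" for x :: real
      by (metis norm_of_real of_real_1 of_real_diff real_norm_def)
    then show ?thesis
      unfolding norm_hecke_E_eq[OF s] by simp
  qed
  also have "\<dots> \<le> 2 * defect_const 0"
    using s by (intro norm_hecke_E_le) auto
  finally show ?thesis
    using s by (simp add: field_simps)
qed

text \<open>The Mertens inequality behind the nonvanishing of \<open>L(1)\<close>: \<open>3 + 4 cos t + cos 2t \<ge> 0\<close>.\<close>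

lemma three_four_one:
  fixes v :: complex and r :: real
  assumes v: "norm v = 1" and r: "0 \<le> r" "r < 1"
  shows "norm ((1 - of_real r) ^ 3 * (1 - of_real r * v) ^ 4 * (1 - of_real r * v\<^sup>2)) \<le> 1"
proof -
  \<comment> \<open>Real part of the logarithm series. The index \<open>n = 0\<close> contributes 0
    because division by 0 yields 0.\<close>
  have log: "(\<lambda>n. - Re (w ^ n) / real n) sums ln (norm (1 - w))" if w: "norm w < 1" for w :: complex
  proof -
    have "(\<lambda>n. - ((- (- w)) ^ n) / of_nat n) sums ln (1 + (- w))"
      by (rule Ln_series') (use w in simp)
    then have "(\<lambda>n. Re (- (w ^ n) / of_nat n)) sums Re (ln (1 - w))"
      by (intro sums_Re) simp
    moreover have "1 - w \<noteq> 0"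
      using w by auto
    ultimately show ?thesis
      by (simp add: Re_divide_of_nat)
  qed
  have small: "norm (of_real r * v) < 1" "norm (of_real r * v\<^sup>2) < 1" "norm (of_real r :: complex) < 1"
    using v r by (simp_all add: norm_mult norm_power)
  let ?a = "norm (1 - of_real r :: complex)" and ?b = "norm (1 - of_real r * v)"
    and ?c = "norm (1 - of_real r * v\<^sup>2)"
  have nz: "x \<noteq> 1" if "norm x < 1" for x :: complex
    using that by auto
  have pos: "?a > 0" "?b > 0" "?c > 0"
    using nz[OF small(1)] nz[OF small(2)] nz[OF small(3)] by simp_all
  have sums: "(\<lambda>n. 3 * (- Re (of_real r ^ n) / real n) + 4 * (- Re ((of_real r * v) ^ n) / real n)
      + (- Re ((of_real r * v\<^sup>2) ^ n) / real n)) sums (3 * ln ?a + 4 * ln ?b + ln ?c)"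
    by (intro sums_add sums_mult log small)
  have "3 * (- Re (of_real r ^ n) / real n) + 4 * (- Re ((of_real r * v) ^ n) / real n)
      + (- Re ((of_real r * v\<^sup>2) ^ n) / real n) \<le> 0" for n
  proof -
    define u where "u = v ^ n"
    have "norm u = 1"
      using v by (simp add: u_def norm_power)
    then have "(Re u)\<^sup>2 + (Im u)\<^sup>2 = 1"
      using cmod_power2[of u] by simp
    then have "3 + 4 * Re u + Re (u\<^sup>2) = 2 * (1 + Re u)\<^sup>2"
      by (simp add: Re_power2) (simp add: power2_eq_square algebra_simps)
    then have "3 + 4 * Re u + Re (u\<^sup>2) \<ge> 0"
      by simp
    moreover have "3 * (- Re (of_real r ^ n) / real n) + 4 * (- Re ((of_real r * v) ^ n) / real n)
      + (- Re ((of_real r * v\<^sup>2) ^ n) / real n) = - (r ^ n / real n * (3 + 4 * Re u + Re (u\<^sup>2)))"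
      by (simp add: power_mult_distrib u_def power_mult[symmetric] mult.commute[of n] 
          flip: of_real_power) (simp add: algebra_simps add_divide_distrib)
    ultimately show ?thesis
      using r by simp
  qed
  then have "3 * ln ?a + 4 * ln ?b + ln ?c \<le> 0"
    by (rule sums_le[OF _ sums sums_zero])
  also have "3 * ln ?a + 4 * ln ?b + ln ?c = ln (?a ^ 3 * ?b ^ 4 * ?c)"
    using pos by (simp add: ln_mult ln_realpow)
  finally show ?thesis
    using pos by (simp add: norm_mult norm_power)
qed

text \<open>The previous inequality for each Euler factor, multiplied over \<open>P\<close> and
  taken to the limit. The factors are reciprocal to the series, which reverses the inequality; the
  unit count enters with exponent 3 + 4 + 1 = 8.\<close>

lemma hecke_L_three_four_one:
  assumes s: "s > 1"
  shows "1 \<le> norm (hecke_L 0 s) ^ 3 * norm (hecke_L k s) ^ 4 * norm (hecke_L (2 * k) s)"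
proof -
  define E where "E = (\<lambda>k P. \<Prod>p\<in>P. 1 - hecke_term k s p)"
  define U where "U = real gint_unit_count"
  have U: "U \<ge> 1"
    using gint_unit_count_pos by (simp add: U_def)
  have le: "norm (E 0 P ^ 3 * E k P ^ 4 * E (2 * k) P) \<le> 1" if P: "P \<subseteq> gint_primes" for P
  proof -
    have "E 0 P ^ 3 * E k P ^ 4 * E (2 * k) P
        = (\<Prod>p\<in>P. (1 - hecke_term 0 s p) ^ 3 * (1 - hecke_term k s p) ^ 4 * (1 - hecke_term (2 * k) s p))"
      by (simp add: E_def prod.distrib prod_power_distrib)
    also have "norm \<dots> = (\<Prod>p\<in>P. norm ((1 - hecke_term 0 s p) ^ 3 * (1 - hecke_term k s p) ^ 4
        * (1 - hecke_term (2 * k) s p)))"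
      by (simp only: prod_norm)
    also have "\<dots> \<le> 1"
    proof (intro prod_le_1 conjI norm_ge_zero)
      fix p assume "p \<in> P"
      then have p: "prime_elem p"
        using P gint_primes_imp_prime_elem by auto
      then have "gnorm p \<ge> 2"
        by (rule gnorm_prime_elem_ge_2)
      then have "real (gnorm p) powr (-s) < real (gnorm p) powr 0"
        using s by (intro powr_less_mono) auto
      then have r: "real (gnorm p) powr (-s) < 1"
        using p by (simp split: if_splits)
      have v: "norm (hecke k p) = 1"
        using p by (intro norm_hecke) auto
      have "hecke (2 * k) p = (hecke k p)\<^sup>2"
        unfolding hecke_eq_power[of "2 * k"] hecke_eq_power[of k] by (simp add: power_mult[symmetric] mult.commute)
      then show "norm ((1 - hecke_term 0 s p) ^ 3 * (1 - hecke_term k s p) ^ 4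
          * (1 - hecke_term (2 * k) s p)) \<le> 1"
        using three_four_one[OF v _ r] by (simp add: hecke_term_def mult.commute)
    qed
    finally show ?thesis .
  qed
  have "((\<lambda>P. norm (E 0 P ^ 3 * E k P ^ 4 * E (2 * k) P)) \<longlongrightarrow>
      norm ((of_nat gint_unit_count / hecke_L 0 s) ^ 3 * (of_nat gint_unit_count / hecke_L k s) ^ 4
        * (of_nat gint_unit_count / hecke_L (2 * k) s))) (finite_subsets_at_top gint_primes)"
    unfolding E_def by (intro tendsto_intros hecke_euler_product' s)
  then have "norm ((of_nat gint_unit_count / hecke_L 0 s) ^ 3 * (of_nat gint_unit_count / hecke_L k s) ^ 4
        * (of_nat gint_unit_count / hecke_L (2 * k) s)) \<le> 1"
    by (rule tendsto_upperbound) (auto intro!: eventually_finite_subsets_at_top_weakI le)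
  then have "U ^ 8 / (norm (hecke_L 0 s) ^ 3 * norm (hecke_L k s) ^ 4 * norm (hecke_L (2 * k) s)) \<le> 1"
    by (simp add: norm_mult norm_power norm_divide U_def power_divide eval_nat_numeral mult_ac)
  moreover have "norm (hecke_L 0 s) ^ 3 * norm (hecke_L k s) ^ 4 * norm (hecke_L (2 * k) s) > 0"
    using hecke_L_nonzero[OF s] by simp
  ultimately have "U ^ 8 \<le> norm (hecke_L 0 s) ^ 3 * norm (hecke_L k s) ^ 4 * norm (hecke_L (2 * k) s)"
    by (simp add: divide_le_eq)
  moreover have "U ^ 8 \<ge> 1"
    using U by (rule one_le_power)
  ultimately show ?thesis
    by linarith
qed

text \<open>Upper bounds for the series at 0 and \<open>2 * k\<close> turn the product inequality
  into a lower bound of order (s - 1)^3 for the fourth power of \<open>hecke_E k s\<close>. For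
  small s - 1 this beats the fourth power of the Lipschitz error; so one good point 1 + h controls
  all of (1, 1 + h].\<close>

lemma norm_hecke_L_lower_bound:
  assumes k: "k \<ge> 1"
  obtains c s0 where "c > 0" "1 < s0" "s0 \<le> 2" "\<And>t. 1 < t \<Longrightarrow> t \<le> s0 \<Longrightarrow> norm (hecke_L k t) \<ge> c"
proof -
  define A where "A = 4 * defect_const 0"
  define D where "D = 2 * defect_const (2 * k) / hecke_gap (2 * k)"
  define B where "B = 9 * defect_const k"
  define g where "g = hecke_gap k"
  have pos: "A > 0" "D > 0" "B > 0" "g > 0"
    using k defect_const_pos hecke_gap_pos by (simp_all add: A_def D_def B_def g_def)
  define q where "q = g ^ 4 / (A ^ 3 * D)"
  have q: "q > 0"
    using pos by (simp add: q_def)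
  have lower: "norm (hecke_E k s) ^ 4 \<ge> q * (s - 1) ^ 3" if s: "s > 1" "s \<le> 2" for s
  proof -
    have "1 \<le> norm (hecke_L 0 s) ^ 3 * norm (hecke_L k s) ^ 4 * norm (hecke_L (2 * k) s)"
      using s by (intro hecke_L_three_four_one)
    also have "\<dots> \<le> (A / (s - 1)) ^ 3 * norm (hecke_L k s) ^ 4 * D"
      unfolding A_def D_def using s k
      by (intro mult_mono power_mono norm_hecke_L_0_le norm_hecke_L_le)
        (auto simp: less_imp_le defect_const_pos hecke_gap_pos)
    finally have "1 \<le> A ^ 3 * D * norm (hecke_L k s) ^ 4 / (s - 1) ^ 3"
      by (simp add: power_divide mult_ac)
    then have "(s - 1) ^ 3 \<le> A ^ 3 * D * norm (hecke_L k s) ^ 4"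
      using s by (simp add: field_simps)
    then have "q * (s - 1) ^ 3 \<le> q * (A ^ 3 * D * norm (hecke_L k s) ^ 4)"
      using q by (intro mult_left_mono) auto
    also have "\<dots> = (norm (hecke_L k s) * g) ^ 4"
      using pos by (simp add: q_def power_mult_distrib)
    also have "\<dots> \<le> norm (hecke_E k s) ^ 4"
      unfolding norm_hecke_E_eq[OF s] g_def using hecke_L_factor_bounds(1)[OF s] pos
      by (intro power_mono mult_left_mono) (auto simp: g_def)
    finally show ?thesis .
  qed
  \<comment> \<open>Small enough that \<open>(2 * B * h) ^ 4\<close> is at most
    \<open>q * h ^ 3\<close>. Then \<open>hecke_E k\<close> has modulus at least
    \<open>2 * B * h\<close> at \<open>1 + h\<close>, of which the Lipschitz constant
    \<open>B\<close> removes at most \<open>B * h\<close> on the way to \<open>t\<close>.\<close>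
  define h where "h = min 1 (q / (2 * B) ^ 4)"
  have h: "0 < h" "h \<le> 1" "h * (2 * B) ^ 4 \<le> q"
    using q pos by (auto simp: h_def min_def field_simps)
  have "(2 * B * h) ^ 4 = h * (2 * B) ^ 4 * h ^ 3"
    by (simp add: power_mult_distrib eval_nat_numeral)
  also have "\<dots> \<le> q * h ^ 3"
    using h by (intro mult_right_mono) auto
  also have "\<dots> \<le> norm (hecke_E k (1 + h)) ^ 4"
    using lower[of "1 + h"] h by simp
  finally have "(2 * B * h) ^ Suc 3 \<le> norm (hecke_E k (1 + h)) ^ Suc 3"
    by simp
  then have Eh: "2 * B * h \<le> norm (hecke_E k (1 + h))"
    by (rule power_le_imp_le_base) simp
  have "norm (hecke_L k t) \<ge> B * h / 2" if t: "1 < t" "t \<le> 1 + h" for t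
  proof -
    have "norm (hecke_E k (1 + h) - hecke_E k t) \<le> 9 * \<bar>1 + h - t\<bar> * defect_const k"
      using t h by (intro norm_hecke_E_diff_le) auto
    also have "\<dots> = B * (1 + h - t)"
      using t by (simp add: B_def)
    also have "\<dots> \<le> B * h"
      using t pos by simp
    finally have "norm (hecke_E k t) \<ge> B * h"
      using Eh norm_triangle_ineq2[of "hecke_E k (1 + h)" "hecke_E k t"] by simp
    also have "norm (hecke_E k t) \<le> norm (hecke_L k t) * 2"
      using t h hecke_L_factor_bounds(2)[of t k] by (subst norm_hecke_E_eq) (auto intro: mult_left_mono)
    finally show ?thesis
      by simp
  qed
  then show ?thesis
    using that[of "B * h / 2" "1 + h"] h pos by simp
qed

text \<open>A bound near 1 would pass to all finite sums of 1 / N(a). Points with 1 <= y <= x have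
  norm at most 2 x^2, so the x points of a column contribute at least 1 / (2x), and the harmonic
  series would converge.\<close>

lemma hecke_L_0_unbounded:
  assumes s0: "s0 > 1"
  obtains s where "1 < s" "s \<le> s0" "norm (hecke_L 0 s) > B"
proof (rule ccontr)
  assume "\<not> thesis"
  then have *: "norm (hecke_L 0 s) \<le> B" if "1 < s" "s \<le> s0" for s
    using that \<open>\<And>s. 1 < s \<Longrightarrow> s \<le> s0 \<Longrightarrow> B < norm (hecke_L 0 s) \<Longrightarrow> thesis\<close> by (meson not_le)
  have B: "(\<Sum>a\<in>F. real (gnorm a) powr (-1)) \<le> B" if F: "finite F" for F
  proof (rule tendsto_upperbound)
    show "((\<lambda>s. \<Sum>a\<in>F. real (gnorm a) powr (-s)) \<longlongrightarrow> (\<Sum>a\<in>F. real (gnorm a) powr (-1))) (at_right 1)"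
    proof (intro tendsto_sum)
      fix a
      show "((\<lambda>s. real (gnorm a) powr (-s)) \<longlongrightarrow> real (gnorm a) powr (-1)) (at_right 1)"
        by (cases "a = 0") (auto intro!: tendsto_eq_intros)
    qed
    have "(\<Sum>a\<in>F. real (gnorm a) powr (-s)) \<le> B" if s: "s \<in> {1<..<s0}" for s
    proof -
      have "(\<Sum>a\<in>F. real (gnorm a) powr (-s)) \<le> (\<Sum>\<^sub>\<infinity>a. real (gnorm a) powr (-s))"
        using s F by (intro finite_sum_le_infsum summable_on_gnorm_powr) auto
      also have "\<dots> \<le> norm (hecke_L 0 s)"
        using s by (simp add: hecke_L_0)
      also have "\<dots> \<le> B"
        using s by (intro *) auto
      finally show ?thesis .
    qed
    then show "\<forall>\<^sub>F s in at_right 1. (\<Sum>a\<in>F. real (gnorm a) powr (-s)) \<le> B"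
      using s0 by (auto simp: eventually_at_right intro!: exI[of _ s0])
  qed simp
  have "summable (\<lambda>n. 1 / (2 * real (Suc n)))"
  proof (rule summableI_nonneg_bounded[where x = B])
    fix n :: nat
    let ?S = "SIGMA x:{1..n}. {1..x}"
    let ?g = "\<lambda>(x, y). Gint (int x) (int y)"
    have "(\<Sum>i<n. 1 / (2 * real (Suc i))) = (\<Sum>x\<in>{1..n}. 1 / (2 * real x))"
      by (rule sum.reindex_bij_witness[of _ "\<lambda>x. x - 1" Suc]) auto
    also have "\<dots> = (\<Sum>x\<in>{1..n}. \<Sum>y\<in>{1..x}. 1 / (2 * (real x)\<^sup>2))"
      by (intro sum.cong) (auto simp: power2_eq_square)
    also have "\<dots> \<le> (\<Sum>x\<in>{1..n}. \<Sum>y\<in>{1..x}. real (gnorm (?g (x, y))) powr (-1))"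
    proof (intro sum_mono)
      fix x y assume xy: "x \<in> {1..n}" "y \<in> {1..x}"
      have "real (gnorm (?g (x, y))) = (real x)\<^sup>2 + (real y)\<^sup>2"
        by (simp add: gnorm_def nat_add_distrib nat_power_eq)
      moreover have "(real y)\<^sup>2 \<le> (real x)\<^sup>2"
        using xy by (intro power_mono) auto
      moreover have "(real x)\<^sup>2 > 0"
        using xy by auto
      ultimately show "1 / (2 * (real x)\<^sup>2) \<le> real (gnorm (?g (x, y))) powr (-1)"
        using xy
        by (simp only: powr_minus_divide powr_one, intro divide_left_mono)
          (auto intro!: mult_pos_pos add_pos_nonneg)
    qed
    also have "\<dots> = (\<Sum>z\<in>?S. real (gnorm (?g z)) powr (-1))"
      by (subst sum.Sigma) (auto simp: case_prod_unfold)
    also have "\<dots> = (\<Sum>a\<in>?g ` ?S. real (gnorm a) powr (-1))"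
      by (subst sum.reindex) (auto simp: inj_on_def)
    also have "\<dots> \<le> B"
      by (rule B) auto
    finally show "(\<Sum>i<n. 1 / (2 * real (Suc i))) \<le> B" .
  qed auto
  then have "summable (\<lambda>n. 2 * (1 / (2 * real (Suc n))))"
    by (rule summable_mult)
  also have "(\<lambda>n. 2 * (1 / (2 * real (Suc n)))) = (\<lambda>n. inverse (real (Suc n)))"
    by (intro ext) (simp add: field_simps)
  finally have "summable (\<lambda>n. inverse (real n))"
    by (rule summable_Suc_iff[of "\<lambda>n. inverse (real n)", THEN iffD1])
  then show False
    using not_summable_harmonic[where 'a = real] by simp
qed

section \<open>Character sums over Gaussian primes\<close>

definition hecke_P :: "nat \<Rightarrow> real \<Rightarrow> real" where
  "hecke_P k s = (\<Sum>\<^sub>\<infinity>p\<in>gint_primes. Re (hecke_term k s p))"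

lemma summable_on_Re_hecke_term:
  assumes "s > 1"
  shows "(\<lambda>p. Re (hecke_term k s p)) summable_on A"
  by (rule summable_on_Re) (rule summable_on_hecke_term[OF assms])

lemma ln_norm_one_minus_approx:
  fixes w :: complex
  assumes "norm w \<le> 1/2"
  shows "\<bar>ln (norm (1 - w)) + Re w\<bar> \<le> 2 * (norm w)\<^sup>2"
proof -
  have "1 - w \<noteq> 0"
    using assms by auto
  then have "ln (norm (1 - w)) + Re w = Re (ln (1 + - w) - (- w))"
    by simp
  also have "\<bar>\<dots>\<bar> \<le> norm (ln (1 + - w) - (- w))"
    by (rule abs_Re_le_cmod)
  also have "\<dots> \<le> (norm (- w))\<^sup>2 / (1 - norm (- w))"
    using assms by (intro Ln_approx_linear) auto
  also have "\<dots> \<le> (norm w)\<^sup>2 / (1/2)"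
    using assms by (intro frac_le) auto
  finally show ?thesis
    by simp
qed

text \<open>First-order expansion of the logarithm of the Euler product. The quadratic errors are
  dominated by twice the sum of N(a)^(-2), so the constant depends on neither \<open>k\<close> nor
  \<open>s\<close>. Taking moduli first avoids branches of the complex logarithm.\<close>

lemma hecke_P_approx:
  obtains C where "\<And>k s. s > 1 \<Longrightarrow> \<bar>hecke_P k s - ln (norm (hecke_L k s))\<bar> \<le> C"
proof -
  define Z where "Z = (\<Sum>\<^sub>\<infinity>a. real (gnorm a) powr (-2))"
  define U where "U = real gint_unit_count"
  have U: "U > 0"
    using gint_unit_count_pos by (simp add: U_def)
  have "\<bar>hecke_P k s - ln (norm (hecke_L k s))\<bar> \<le> 2 * Z + \<bar>ln U\<bar>" if s: "s > 1" for k s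
  proof -
    let ?f = "hecke_term k s"
    let ?F = "finite_subsets_at_top gint_primes"
    have half: "norm (?f p) \<le> 1/2" if "p \<in> gint_primes" for p
    proof -
      have p: "gnorm p \<ge> 2"
        using that by (intro gnorm_prime_elem_ge_2 gint_primes_imp_prime_elem)
      have "real (gnorm p) powr (-s) \<le> real (gnorm p) powr (-1)"
        using s p by (intro powr_mono) auto
      also have "\<dots> \<le> 1/2"
        using frac_le[of 1 1 2 "real (gnorm p)"] p by (simp add: powr_minus_divide)
      finally show ?thesis
        by (simp add: norm_hecke_term)
    qed
    have "((\<lambda>P. ln (norm (\<Prod>p\<in>P. 1 - ?f p)) + (\<Sum>p\<in>P. Re (?f p)))
        \<longlongrightarrow> ln (norm (of_nat gint_unit_count / hecke_L k s)) + hecke_P k s) ?F"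
    proof (intro tendsto_add tendsto_ln tendsto_norm hecke_euler_product' s)
      show "norm (of_nat gint_unit_count / hecke_L k s) \<noteq> 0"
        using hecke_L_nonzero[OF s] gint_unit_count_pos by simp
      show "((\<lambda>P. \<Sum>p\<in>P. Re (?f p)) \<longlongrightarrow> hecke_P k s) ?F"
        using has_sum_infsum[OF summable_on_Re_hecke_term[OF s]] by (simp add: hecke_P_def has_sum_def)
    qed
    then have "((\<lambda>P. \<bar>ln (norm (\<Prod>p\<in>P. 1 - ?f p)) + (\<Sum>p\<in>P. Re (?f p))\<bar>)
        \<longlongrightarrow> \<bar>ln (norm (of_nat gint_unit_count / hecke_L k s)) + hecke_P k s\<bar>) ?F"
      by (rule tendsto_rabs)
    then have "\<bar>ln (norm (of_nat gint_unit_count / hecke_L k s)) + hecke_P k s\<bar> \<le> 2 * Z"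
    proof (rule tendsto_upperbound)
      have "\<bar>ln (norm (\<Prod>p\<in>P. 1 - ?f p)) + (\<Sum>p\<in>P. Re (?f p))\<bar> \<le> 2 * Z"
        if P: "finite P" "P \<subseteq> gint_primes" for P
      proof -
        have nz: "1 - ?f p \<noteq> 0" if "p \<in> P" for p
          using half[of p] that P(2) by auto
        have "ln (norm (\<Prod>p\<in>P. 1 - ?f p)) = (\<Sum>p\<in>P. ln (norm (1 - ?f p)))"
          using nz P(1) by (simp add: ln_prod flip: prod_norm)
        then have "\<bar>ln (norm (\<Prod>p\<in>P. 1 - ?f p)) + (\<Sum>p\<in>P. Re (?f p))\<bar>
            = \<bar>\<Sum>p\<in>P. ln (norm (1 - ?f p)) + Re (?f p)\<bar>"
          by (simp add: sum.distrib)
        also have "\<dots> \<le> (\<Sum>p\<in>P. 2 * real (gnorm p) powr (-2))"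
        proof (rule order_trans[OF sum_abs], rule sum_mono)
          fix p assume p: "p \<in> P"
          then have pp: "p \<in> gint_primes"
            using P(2) by auto
          have p2: "gnorm p \<ge> 2"
            using pp by (intro gnorm_prime_elem_ge_2 gint_primes_imp_prime_elem)
          have "(norm (?f p))\<^sup>2 \<le> (real (gnorm p) powr (-1))\<^sup>2"
            unfolding norm_hecke_term using s p2 by (intro power_mono powr_mono) auto
          also have "\<dots> = real (gnorm p) powr (-1 + -1)"
            unfolding powr_add power2_eq_square ..
          also have "\<dots> = real (gnorm p) powr (-2)"
            by simp
          finally show "\<bar>ln (norm (1 - ?f p)) + Re (?f p)\<bar> \<le> 2 * real (gnorm p) powr (-2)"
            using ln_norm_one_minus_approx[OF half[OF pp]] by linarith
        qed
        also have "\<dots> \<le> 2 * Z"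
          unfolding Z_def sum_distrib_left[symmetric] using P(1)
          by (intro mult_left_mono finite_sum_le_infsum summable_on_gnorm_powr) auto
        finally show ?thesis .
      qed
      then show "\<forall>\<^sub>F P in ?F. \<bar>ln (norm (\<Prod>p\<in>P. 1 - ?f p)) + (\<Sum>p\<in>P. Re (?f p))\<bar> \<le> 2 * Z"
        by (intro eventually_finite_subsets_at_top_weakI)
    qed simp
    moreover have "ln (norm (of_nat gint_unit_count / hecke_L k s)) = ln U - ln (norm (hecke_L k s))"
      using U hecke_L_nonzero[OF s] by (simp add: norm_divide ln_div U_def)
    ultimately show ?thesis
      by linarith
  qed
  then show ?thesis
    using that by blast
qed

lemma hecke_P_bounded:
  assumes k: "k \<ge> 1"
  obtains C s0 where "1 < s0" "\<And>s. 1 < s \<Longrightarrow> s \<le> s0 \<Longrightarrow> \<bar>hecke_P k s\<bar> \<le> C"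
proof -
  obtain C where C: "\<And>k s. s > 1 \<Longrightarrow> \<bar>hecke_P k s - ln (norm (hecke_L k s))\<bar> \<le> C"
    using hecke_P_approx by metis
  obtain c s0 where c: "c > 0" and s0: "1 < s0" "s0 \<le> 2"
    and low: "\<And>t. 1 < t \<Longrightarrow> t \<le> s0 \<Longrightarrow> norm (hecke_L k t) \<ge> c"
    using norm_hecke_L_lower_bound[OF k] by metis
  define D where "D = 2 * defect_const k / hecke_gap k"
  have "\<bar>hecke_P k s\<bar> \<le> C + \<bar>ln c\<bar> + \<bar>ln D\<bar>" if s: "1 < s" "s \<le> s0" for s
  proof -
    have "ln c \<le> ln (norm (hecke_L k s))"
      using low[OF s] c by (intro ln_mono) auto
    moreover have "ln (norm (hecke_L k s)) \<le> ln D"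
      using low[OF s] c norm_hecke_L_le[OF k, of s] s s0 unfolding D_def by (intro ln_mono) auto
    ultimately show ?thesis
      using C[of s k] s by linarith
  qed
  then show ?thesis
    using that[OF s0(1)] by blast
qed

lemma hecke_P_0_unbounded:
  assumes s0: "s0 > 1"
  obtains s where "1 < s" "s \<le> s0" "hecke_P 0 s > B"
proof -
  obtain C where C: "\<And>k s. s > 1 \<Longrightarrow> \<bar>hecke_P k s - ln (norm (hecke_L k s))\<bar> \<le> C"
    using hecke_P_approx by metis
  obtain s where s: "1 < s" "s \<le> s0" "norm (hecke_L 0 s) > exp (B + C)"
    using hecke_L_0_unbounded[OF s0] .
  then have "ln (norm (hecke_L 0 s)) > B + C"
    by (metis exp_gt_zero less_trans ln_exp ln_less_cancel_iff)
  then have "hecke_P 0 s > B"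
    using C[of s 0] s by linarith
  then show ?thesis
    using that s by blast
qed

subsection \<open>Equidistribution of the directions of Gaussian primes\<close>

text \<open>A trigonometric polynomial of degree \<open>m\<close> needs one range of
  \<open>s\<close> and one bound for all its nonzero frequencies.\<close>

lemma hecke_P_bounded_uniform:
  obtains C s0 where "1 < s0" "\<And>k s. 1 \<le> k \<Longrightarrow> k \<le> m \<Longrightarrow> 1 < s \<Longrightarrow> s \<le> s0 \<Longrightarrow> \<bar>hecke_P k s\<bar> \<le> C"
proof -
  have "\<exists>C s0. 1 < s0 \<and> (\<forall>k s. 1 \<le> k \<longrightarrow> k \<le> m \<longrightarrow> 1 < s \<longrightarrow> s \<le> s0 \<longrightarrow> \<bar>hecke_P k s\<bar> \<le> C)"
  proof (induction m)
    case 0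
    show ?case
      by (intro exI[of _ 0] exI[of _ 2]) auto
  next
    case (Suc m)
    then obtain C s0 where 1: "1 < s0"
      "\<And>k s. 1 \<le> k \<Longrightarrow> k \<le> m \<Longrightarrow> 1 < s \<Longrightarrow> s \<le> s0 \<Longrightarrow> \<bar>hecke_P k s\<bar> \<le> C"
      by blast
    obtain C' s0' where 2: "1 < s0'" "\<And>s. 1 < s \<Longrightarrow> s \<le> s0' \<Longrightarrow> \<bar>hecke_P (Suc m) s\<bar> \<le> C'"
      by (rule hecke_P_bounded[of "Suc m"]) auto
    have "\<bar>hecke_P k s\<bar> \<le> max C C'" if "1 \<le> k" "k \<le> Suc m" "1 < s" "s \<le> min s0 s0'" for k s
      using 1(2)[of k s] 2(2)[of s] that by (cases "k = Suc m") auto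
    then show ?case
      using 1(1) 2(1) by (intro exI[of _ "max C C'"] exI[of _ "min s0 s0'"]) auto
  qed
  then show ?thesis
    using that by blast
qed

text \<open>Binomial expansion of (e^(ix/2) + e^(-ix/2))^(2m). This is a nonnegative trigonometric
  polynomial in \<open>x\<close>, peaked at 0 and with mean C(2m, m) / 4^m; it serves as the kernel
  that isolates a direction.\<close>

lemma cos_half_power_expansion:
  "cos (x / 2) ^ (2 * m) = (\<Sum>j\<le>2*m. real ((2 * m) choose j) / 4 ^ m * cos ((real j - real m) * x))"
proof -
  have eq: "of_real (2 * cos (x / 2)) = cis (x / 2) + cis (- (x / 2))"
    by (simp add: complex_eq_iff)
  have "of_real ((2 * cos (x / 2)) ^ (2 * m)) = (cis (x / 2) + cis (- (x / 2))) ^ (2 * m)"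
    unfolding of_real_power eq ..
  also have "\<dots> = (\<Sum>j\<le>2*m. of_nat ((2 * m) choose j) * cis (x / 2) ^ j * cis (- (x / 2)) ^ (2 * m - j))"
    by (rule binomial_ring)
  also have "\<dots> = (\<Sum>j\<le>2*m. of_nat ((2 * m) choose j) * cis ((real j - real m) * x))"
  proof (intro sum.cong refl)
    fix j assume "j \<in> {..2 * m}"
    then have "real j * (x / 2) + real (2 * m - j) * - (x / 2) = (real j - real m) * x"
      by (simp add: of_nat_diff field_simps)
    then show "of_nat ((2 * m) choose j) * cis (x / 2) ^ j * cis (- (x / 2)) ^ (2 * m - j)
        = of_nat ((2 * m) choose j) * cis ((real j - real m) * x)"
      by (simp only: Complex.DeMoivre cis_mult mult.assoc)
  qed
  finally have "Re (of_real ((2 * cos (x / 2)) ^ (2 * m)))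
      = (\<Sum>j\<le>2*m. real ((2 * m) choose j) * cos ((real j - real m) * x))"
    by simp
  then have "4 ^ m * cos (x / 2) ^ (2 * m)
      = (\<Sum>j\<le>2*m. real ((2 * m) choose j) * cos ((real j - real m) * x))"
    by (simp add: power_mult_distrib power_mult)
  then have "cos (x / 2) ^ (2 * m)
      = (\<Sum>j\<le>2*m. real ((2 * m) choose j) * cos ((real j - real m) * x)) / 4 ^ m"
    by (simp add: field_simps)
  then show ?thesis
    by (simp add: sum_divide_distrib)
qed

lemma has_sum_sum:
  assumes "finite I" "\<And>i. i \<in> I \<Longrightarrow> (f i has_sum S i) A"
  shows "((\<lambda>x. \<Sum>i\<in>I. f i x) has_sum (\<Sum>i\<in>I. S i :: 'b :: topological_comm_monoid_add)) A"
  using assms by (induction I rule: finite_induct) (auto intro!: has_sum_add)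

text \<open>The mean of the kernel is at least 1 / (2m), so it outlives the exponential decay away
  from the peak.\<close>

lemma exists_central_binomial_gt:
  assumes q: "0 \<le> q" "q < (1::real)"
  obtains m where "m > 0" "q ^ m < real ((2 * m) choose m) / 4 ^ m"
proof -
  have "(\<lambda>n. real n * q ^ n) \<longlonglongrightarrow> 0"
    using powser_times_n_limit_0[of q] q by simp
  then have "\<forall>\<^sub>F n in sequentially. real n * q ^ n < 1 / 2"
    by (rule order_tendstoD) simp
  then have "\<forall>\<^sub>F n in sequentially. real n * q ^ n < 1 / 2 \<and> n > 0"
    using eventually_gt_at_top[of "0::nat"] by eventually_elim auto
  then obtain m where m: "real m * q ^ m < 1 / 2" "m > 0"
    using eventually_happens'[OF sequentially_bot] by blast
  have "4 ^ m / (2 * real m) \<le> real ((2 * m) choose m)"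
    using central_binomial_lower_bound[OF m(2)] by simp
  then have "4 ^ m / (2 * real m) / 4 ^ m \<le> real ((2 * m) choose m) / 4 ^ m"
    by (intro divide_right_mono) auto
  then have "1 / (2 * real m) \<le> real ((2 * m) choose m) / 4 ^ m"
    by simp
  moreover have "q ^ m < 1 / (2 * real m)"
    using m by (simp add: field_simps)
  ultimately show ?thesis
    using that m(2) by force
qed

text \<open>Sum over all primes, with weights N(p)^(-s), a trigonometric polynomial of positive mean
  that is nonpositive outside the window. Finitely many primes in the window would bound the sum
  from above, but its constant term is a positive multiple of the unbounded
  \<open>hecke_P 0 s\<close>, and the other frequencies stay bounded.\<close>

lemma infinite_gint_primes_direction:
  assumes c: "\<bar>c\<bar> \<le> 1" and e: "e > 0"
  shows "infinite {p \<in> gint_primes. \<bar>Re (hecke 1 p) - c\<bar> < e}" (is "infinite ?B")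
proof
  assume fin: "finite ?B"
  \<comment> \<open>Capping the width at 1 keeps \<open>q\<close> below nonnegative.\<close>
  define d where "d = min e 1"
  have d: "0 < d" "d \<le> 1" "d \<le> e"
    using e by (auto simp: d_def)
  \<comment> \<open>If cos x and cos t differ by at least \<open>d\<close>, the sines of (x - t) / 2
    and (x + t) / 2 have product at least d / 2 in modulus. Each squared sine is then at least d^2 /
    4, and each squared cosine at most \<open>q\<close>.\<close>
  define q where "q = 1 - d\<^sup>2 / 4"
  have "d\<^sup>2 \<le> 1"
    using d by (simp add: power_le_one)
  then have q: "0 \<le> q" "q < 1"
    using d by (auto simp: q_def)
  obtain m where m: "m > 0" "q ^ m < real ((2 * m) choose m) / 4 ^ m"
    using exists_central_binomial_gt[OF q] .
  define t where "t = arccos c"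
  have t: "cos t = c"
    using c by (simp add: t_def cos_arccos)
  define \<phi> where "\<phi> p = Arg (hecke 1 p)" for p
  have hk: "Re (hecke k p) = cos (real k * \<phi> p)" if "p \<in> gint_primes" for k p
  proof -
    have "p \<noteq> 0"
      using gint_primes_imp_prime_elem[OF that] by auto
    then have "norm (hecke 1 p) = 1"
      by (rule norm_hecke)
    moreover from this have "hecke 1 p \<noteq> 0"
      by (metis norm_zero zero_neq_one)
    ultimately have "hecke 1 p = cis (\<phi> p)"
      using cis_Arg[of "hecke 1 p"] by (simp add: \<phi>_def sgn_div_norm)
    then have "hecke k p = cis (\<phi> p) ^ k"
      using hecke_eq_power[of k p] by simp
    then show ?thesis
      by (simp add: Complex.DeMoivre)
  qed
  define a where "a j = 2 * (real ((2 * m) choose j) / 4 ^ m) * cos ((real j - real m) * t)" for j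
  define k where "k j = nat \<bar>int j - int m\<bar>" for j
  \<comment> \<open>Peaks at \<open>t\<close> and at \<open>-t\<close>: the target concerns only cos
    x, and evenness leaves only cosines, that is, real parts of characters. Subtracting
    \<open>2 * q ^ m\<close> makes \<open>W\<close> nonpositive off the window.\<close>
  define W where "W x = cos ((x - t) / 2) ^ (2 * m) + cos ((x + t) / 2) ^ (2 * m) - 2 * q ^ m" for x
  have W: "W x = (\<Sum>j\<le>2*m. a j * cos (real (k j) * x)) - 2 * q ^ m" for x
  proof -
    have kj: "cos (real (k j) * x) = cos ((real j - real m) * x)" for j
    proof -
      have "real (k j) = \<bar>real j - real m\<bar>"
        by (simp add: k_def)
      then show ?thesis
        by (cases "real j \<ge> real m") (simp_all add: abs_if, metis cos_minus minus_diff_eq mult_minus_left)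
    qed
    have "cos ((real j - real m) * (x - t)) + cos ((real j - real m) * (x + t))
        = 2 * cos ((real j - real m) * t) * cos (real (k j) * x)" for j
      unfolding kj by (simp add: ring_distribs cos_add cos_diff)
    then have "a j * cos (real (k j) * x)
        = real ((2 * m) choose j) / 4 ^ m * cos ((real j - real m) * (x - t))
          + real ((2 * m) choose j) / 4 ^ m * cos ((real j - real m) * (x + t))" for j
      unfolding a_def distrib_left[symmetric] by simp
    then show ?thesis
      unfolding W_def cos_half_power_expansion by (simp only: sum.distrib)
  qed
  have W_le_2: "W x \<le> 2" for x
  proof -
    have *: "cos y ^ (2 * m) \<le> 1" for y :: real
      unfolding power_mult by (rule power_le_one) (auto simp: abs_square_le_1)
    show ?thesis
      using *[of "(x - t) / 2"] *[of "(x + t) / 2"] zero_le_power[OF q(1), of m]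
      unfolding W_def by linarith
  qed
  have W_le_0: "W x \<le> 0" if x: "\<bar>cos x - c\<bar> \<ge> d" for x
  proof -
    define A B where "A = (x - t) / 2" and "B = (x + t) / 2"
    have "x = B + A" "t = B - A"
      by (simp_all add: A_def B_def field_simps)
    then have "cos x - c = - 2 * sin A * sin B"
      unfolding t[symmetric] by (simp add: cos_add cos_diff)
    then have "d \<le> 2 * \<bar>sin A\<bar> * \<bar>sin B\<bar>"
      using x by (simp add: abs_mult)
    then have "d\<^sup>2 \<le> (2 * \<bar>sin A\<bar> * \<bar>sin B\<bar>)\<^sup>2"
      using d by (intro power_mono) auto
    then have dd: "d\<^sup>2 / 4 \<le> (sin A)\<^sup>2 * (sin B)\<^sup>2"
      by (simp add: power_mult_distrib)
    have *: "(sin y)\<^sup>2 \<le> 1" for y :: real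
      by (simp add: abs_square_le_1)
    have "(sin A)\<^sup>2 * (sin B)\<^sup>2 \<le> (sin A)\<^sup>2 * 1" "(sin A)\<^sup>2 * (sin B)\<^sup>2 \<le> 1 * (sin B)\<^sup>2"
      by (intro mult_mono * order_refl zero_le_power2; simp)+
    then have "(cos A)\<^sup>2 \<le> q" "(cos B)\<^sup>2 \<le> q"
      using dd unfolding q_def cos_squared_eq by linarith+
    then have "(cos A)\<^sup>2 ^ m \<le> q ^ m" "(cos B)\<^sup>2 ^ m \<le> q ^ m"
      by (intro power_mono; simp)+
    then show ?thesis
      unfolding W_def A_def B_def by (simp add: power_mult)
  qed
  obtain C s0 where s0: "1 < s0"
    and C: "\<And>k s. 1 \<le> k \<Longrightarrow> k \<le> m \<Longrightarrow> 1 < s \<Longrightarrow> s \<le> s0 \<Longrightarrow> \<bar>hecke_P k s\<bar> \<le> C"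
    using hecke_P_bounded_uniform[of m] by metis
  define D where "D = 2 * real (card ?B) + (\<Sum>j\<in>{..2*m}-{m}. \<bar>a j\<bar> * C)"
  \<comment> \<open>The mean of \<open>W\<close>: frequency 0 arises only from
    \<open>j = m\<close>.\<close>
  define b where "b = a m - 2 * q ^ m"
  have b: "b > 0"
    using m(2) by (simp add: b_def a_def)
  obtain s where s: "1 < s" "s \<le> s0" "hecke_P 0 s > D / b"
    using hecke_P_0_unbounded[OF s0] .
  let ?N = "\<lambda>p. real (gnorm p) powr (-s)"
  have P: "((\<lambda>p. cos (real k * \<phi> p) * ?N p) has_sum hecke_P k s) gint_primes" for k
  proof -
    have "((\<lambda>p. Re (hecke_term k s p)) has_sum hecke_P k s) gint_primes"
      unfolding hecke_P_def by (intro has_sum_infsum summable_on_Re_hecke_term s(1))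
    then show ?thesis
      by (rule has_sum_cong[THEN iffD1, rotated]) (simp add: hecke_term_def hk)
  qed
  have "((\<lambda>p. (\<Sum>j\<le>2*m. a j * (cos (real (k j) * \<phi> p) * ?N p)) + (- 2 * q ^ m) * (cos (real 0 * \<phi> p) * ?N p))
      has_sum (\<Sum>j\<le>2*m. a j * hecke_P (k j) s) + (- 2 * q ^ m) * hecke_P 0 s) gint_primes"
    by (intro has_sum_add has_sum_sum has_sum_cmult_right P) auto
  also have "(\<lambda>p. (\<Sum>j\<le>2*m. a j * (cos (real (k j) * \<phi> p) * ?N p)) + (- 2 * q ^ m) * (cos (real 0 * \<phi> p) * ?N p))
      = (\<lambda>p. W (\<phi> p) * ?N p)"
    unfolding W by (intro ext) (simp add: left_diff_distrib sum_distrib_right mult.assoc)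
  finally have "(\<Sum>j\<le>2*m. a j * hecke_P (k j) s) + (- 2 * q ^ m) * hecke_P 0 s \<le> 2 * real (card ?B)"
  proof (rule has_sum_mono_neutral)
    show "((\<lambda>p. 2) has_sum 2 * real (card ?B)) ?B"
      using fin by (intro has_sum_finiteI) simp_all
    show "W (\<phi> p) * ?N p \<le> 2" if "p \<in> gint_primes \<inter> ?B" for p
    proof -
      have "gnorm p \<ge> 2"
        using that by (intro gnorm_prime_elem_ge_2 gint_primes_imp_prime_elem) auto
      then have "?N p \<le> real (gnorm p) powr 0"
        using s by (intro powr_mono) auto
      then have "?N p \<le> 1"
        using \<open>gnorm p \<ge> 2\<close> by (simp split: if_splits)
      then have "W (\<phi> p) * ?N p \<le> 2 * 1"
        using W_le_2 by (intro mult_mono) auto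
      then show ?thesis
        by simp
    qed
    show "W (\<phi> p) * ?N p \<le> 0" if p: "p \<in> gint_primes - ?B" for p
    proof -
      have "\<bar>cos (\<phi> p) - c\<bar> \<ge> d"
        using p hk[of p 1] d by auto
      then show ?thesis
        by (intro mult_nonpos_nonneg W_le_0) auto
    qed
  qed auto
  moreover have "(\<Sum>j\<le>2*m. a j * hecke_P (k j) s)
      = a m * hecke_P 0 s + (\<Sum>j\<in>{..2*m}-{m}. a j * hecke_P (k j) s)"
    by (subst sum.remove[of _ m]) (auto simp: k_def)
  moreover have "\<bar>\<Sum>j\<in>{..2*m}-{m}. a j * hecke_P (k j) s\<bar> \<le> (\<Sum>j\<in>{..2*m}-{m}. \<bar>a j\<bar> * C)"
  proof (rule order_trans[OF sum_abs], rule sum_mono)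
    fix j assume "j \<in> {..2*m}-{m}"
    then have "1 \<le> k j" "k j \<le> m"
      by (auto simp: k_def)
    then show "\<bar>a j * hecke_P (k j) s\<bar> \<le> \<bar>a j\<bar> * C"
      unfolding abs_mult using C s by (intro mult_left_mono) auto
  qed
  ultimately have "b * hecke_P 0 s \<le> D"
    unfolding b_def D_def by (simp add: left_diff_distrib)
  moreover have "b * hecke_P 0 s > D"
    using s(3) b by (simp add: field_simps)
  ultimately show False
    by simp
qed

subsection \<open>Lattice points on circles\<close>

definition circ :: "nat \<Rightarrow> gint set" where
  "circ m = {a. gnorm a = m}"

text \<open>For a nonempty circle of positive norm this is the integral of z^(4k) against the
  lattice measure, hence the conjugate of its Fourier coefficient at 4k.\<close>

definition circ_mean :: "nat \<Rightarrow> nat \<Rightarrow> complex" where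
  "circ_mean k m = (\<Sum>a\<in>circ m. hecke k a) / of_nat (card (circ m))"

lemma finite_circ [simp]: "finite (circ m)"
  by (rule finite_subset[OF _ finite_gnorm_le[of m]]) (auto simp: circ_def)

lemma hecke_gcnj: "hecke k (gcnj a) = cnj (hecke k a)"
  by (simp add: hecke_def sgn_div_norm)

lemma hecke_assoc:
  assumes "a dvd b" "b dvd a" "a \<noteq> 0"
  shows "hecke k a = hecke k b"
proof -
  obtain c where c: "b = a * c"
    using assms by (auto simp: dvd_def)
  then have "c dvd 1"
    using assms dvd_self_mult_imp_unit[of a c] by simp
  then show ?thesis
    by (simp add: c hecke_mult hecke_unit)
qed

lemma prime_elem_gcnj: "prime_elem (gcnj p)" if "prime_elem p"
  unfolding prime_elem_def
proof (intro conjI allI impI)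
  show "gcnj p \<noteq> 0" "\<not> gcnj p dvd 1"
    using that by (auto simp: prime_elem_def gint_unit_iff)
  fix x y assume "gcnj p dvd x * y"
  then have "p dvd gcnj x * gcnj y"
    using dvd_gcnj_iff[of "gcnj p" "x * y"] by simp
  then have "p dvd gcnj x \<or> p dvd gcnj y"
    using that prime_elem_dvd_multD by blast
  then show "gcnj p dvd x \<or> gcnj p dvd y"
    using dvd_gcnj_iff[of p "gcnj x"] dvd_gcnj_iff[of p "gcnj y"] by auto
qed

text \<open>\<open>p\<close> divides the norm \<open>a * gcnj a\<close>, so \<open>p\<close> or its
  conjugate divides \<open>a\<close>. Split, ramified and inert primes need not be
  distinguished.\<close>

lemma circ_mult_prime:
  assumes p: "prime_elem p"
  shows "circ (gnorm p * m) = (*) p ` circ m \<union> (*) (gcnj p) ` circ m"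
proof (intro equalityI subsetI)
  fix a assume a: "a \<in> circ (gnorm p * m)"
  have p0: "gnorm p \<noteq> 0"
    using p by auto
  have "p dvd of_nat (gnorm a)"
    using a dvd_of_nat_gnorm[of p] by (simp add: circ_def)
  then have "p dvd a * gcnj a"
    by (simp add: mult_gcnj)
  then have "p dvd a \<or> p dvd gcnj a"
    using p prime_elem_dvd_multD by blast
  then have "p dvd a \<or> gcnj p dvd a"
    using dvd_gcnj_iff[of p "gcnj a"] by auto
  then show "a \<in> (*) p ` circ m \<union> (*) (gcnj p) ` circ m"
  proof
    assume "p dvd a"
    then obtain b where "a = p * b"
      by (auto simp: dvd_def)
    then show ?thesis
      using a p0 by (auto simp: circ_def)
  next
    assume "gcnj p dvd a"
    then obtain b where "a = gcnj p * b"
      by (auto simp: dvd_def)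
    then show ?thesis
      using a p0 by (auto simp: circ_def)
  qed
qed (auto simp: circ_def)

text \<open>If \<open>p\<close> and its conjugate are not associates, their multiples form two
  disjoint halves, which averages the character value with its conjugate. If they are associates,
  the two sets coincide and the value at \<open>p\<close> is already real.\<close>

lemma circ_mean_mult_prime:
  assumes p: "prime_elem p" and q: "\<not> gnorm p dvd m"
  shows "circ_mean k (gnorm p * m) = of_real (Re (hecke k p)) * circ_mean k m"
proof -
  have p0: "p \<noteq> 0" "gcnj p \<noteq> 0"
    using p by auto
  have inj: "inj_on ((*) p) (circ m)" "inj_on ((*) (gcnj p)) (circ m)"
    using p0 by (simp_all add: inj_on_def)
  have sum: "(\<Sum>a\<in>(*) p ` circ m. hecke k a) = hecke k p * (\<Sum>a\<in>circ m. hecke k a)"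
    "(\<Sum>a\<in>(*) (gcnj p) ` circ m. hecke k a) = cnj (hecke k p) * (\<Sum>a\<in>circ m. hecke k a)"
    using inj by (simp_all add: sum.reindex hecke_mult sum_distrib_left hecke_gcnj)
  show ?thesis
  proof (cases "p dvd gcnj p")
    case True
    then have "gcnj p dvd p"
      using p prime_elem_gcnj[OF p] gint_prime_dvd_prime_imp_dvd by blast
    then obtain u where u: "p = gcnj p * u" "u dvd 1"
      using True p0(2) dvd_self_mult_imp_unit[of "gcnj p"] by (metis dvdE)
    have "(*) p ` circ m \<subseteq> (*) (gcnj p) ` circ m"
    proof
      fix a assume "a \<in> (*) p ` circ m"
      then obtain b where b: "a = p * b" "b \<in> circ m"
        by auto
      have "a = gcnj p * (u * b)"
        using b u(1) by (metis mult.assoc)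
      moreover have "u * b \<in> circ m"
        using b(2) u(2) by (simp add: circ_def gint_unit_iff)
      ultimately show "a \<in> (*) (gcnj p) ` circ m"
        by blast
    qed
    then have "circ (gnorm p * m) = (*) (gcnj p) ` circ m"
      using circ_mult_prime[OF p, of m] by auto
    moreover have "hecke k (gcnj p) = hecke k p"
      using True \<open>gcnj p dvd p\<close> p0 by (intro hecke_assoc)
    then have "cnj (hecke k p) = hecke k p"
      by (simp add: hecke_gcnj)
    then have "cnj (hecke k p) = of_real (Re (hecke k p))"
      by (simp add: complex_eq_iff)
    ultimately show ?thesis
      using sum(2) inj(2) by (simp add: circ_mean_def card_image)
  next
    case False
    \<comment> \<open>A common element would make \<open>b\<close> a multiple of
      \<open>gcnj p\<close>, so that \<open>gnorm p\<close> would divide \<open>m\<close>.\<close>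
    have disj: "(*) p ` circ m \<inter> (*) (gcnj p) ` circ m = {}"
    proof (rule ccontr)
      assume "(*) p ` circ m \<inter> (*) (gcnj p) ` circ m \<noteq> {}"
      then obtain b c where bc: "p * b = gcnj p * c" "b \<in> circ m"
        by auto
      then have "p dvd gcnj p * c"
        by (metis dvd_triv_left)
      then have "p dvd c"
        using p False prime_elem_dvd_multD by blast
      then obtain d where "c = p * d"
        by (auto simp: dvd_def)
      then have "p * b = p * (gcnj p * d)"
        using bc(1) by (simp add: mult_ac)
      then have "b = gcnj p * d"
        using p0 by simp
      then show False
        using bc(2) q by (auto simp: circ_def)
    qed
    have "(\<Sum>a\<in>circ (gnorm p * m). hecke k a)
        = of_real (2 * Re (hecke k p)) * (\<Sum>a\<in>circ m. hecke k a)"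
      unfolding circ_mult_prime[OF p] using disj
      by (subst sum.union_disjoint) (simp_all add: sum distrib_right[symmetric] complex_add_cnj)
    moreover have "card (circ (gnorm p * m)) = 2 * card (circ m)"
      unfolding circ_mult_prime[OF p] using disj inj
      by (subst card_Un_disjoint) (simp_all add: card_image)
    ultimately show ?thesis
      by (simp add: circ_mean_def)
  qed
qed

lemma circ_mean_1: "circ_mean k 1 = 1"
proof -
  have units: "circ 1 = {a. a dvd 1}"
    by (auto simp: circ_def gint_unit_iff)
  then have "circ_mean k 1 = of_nat (card (circ 1)) / of_nat (card (circ 1))"
    unfolding circ_mean_def by (simp add: hecke_unit)
  also have "\<dots> = 1"
    using gint_unit_count_pos unfolding units gint_unit_count_def by simp
  finally show ?thesis .
qed

lemma circ_mult_nonempty: "circ m \<noteq> {} \<Longrightarrow> circ (gnorm a * m) \<noteq> {}"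
proof -
  assume "circ m \<noteq> {}"
  then obtain b where "gnorm b = m"
    by (auto simp: circ_def)
  then have "a * b \<in> circ (gnorm a * m)"
    by (simp add: circ_def)
  then show ?thesis
    by blast
qed

lemma Re_hecke_2: "p \<noteq> 0 \<Longrightarrow> Re (hecke 2 p) = 2 * (Re (hecke 1 p))\<^sup>2 - 1"
  using norm_hecke[of p 1] cmod_power2[of "hecke 1 p"] by (simp add: hecke_eq_power[of 2] Re_power2)

lemma abs_Re_hecke_le: "\<bar>Re (hecke k p)\<bar> \<le> 1"
  using abs_Re_le_cmod[of "hecke k p"] norm_hecke_le[of k p] by linarith

section \<open>Rational primes below Gaussian primes\<close>

lemma gint_prime_dvd_of_nat_prime:
  assumes p: "prime_elem (p :: gint)" and "n > 0" "p dvd of_nat n"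
  obtains q where "prime q" "q dvd n" "p dvd of_nat q"
proof -
  have "\<exists>q. prime q \<and> q dvd n \<and> p dvd of_nat q"
    using assms(2,3)
  proof (induction n rule: less_induct)
    case (less n)
    have "n \<noteq> 1"
      using less.prems p by (auto simp: prime_elem_def)
    then obtain q r where q: "prime q" "n = q * r"
      by (metis prime_factor_nat dvdE)
    then have "p dvd of_nat q * of_nat r"
      using less.prems by simp
    then have "p dvd of_nat q \<or> p dvd of_nat r"
      using p prime_elem_dvd_multD by blast
    then show ?case
    proof
      assume "p dvd of_nat r"
      moreover have "r > 0" "r < n"
        using q less.prems(1) prime_gt_1_nat[OF q(1)] by auto
      ultimately show ?thesis
        using less.IH q(2) by (meson dvd_mult)
    qed (use q in auto)
  qed
  then show ?thesis
    using that by blast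
qed

lemma gnorm_gint_prime:
  assumes p: "prime_elem p"
  obtains q where "prime q" "p dvd of_nat q" "gnorm p = q \<or> gnorm p = q\<^sup>2"
proof -
  obtain q where q: "prime q" "p dvd of_nat q"
    using gint_prime_dvd_of_nat_prime[OF p _ dvd_of_nat_gnorm[of p]] p by auto
  have "gnorm p dvd q\<^sup>2"
    using gnorm_dvd[OF q(2)] by simp
  then obtain i where i: "i \<le> 2" "gnorm p = q ^ i"
    using divides_primepow_nat[OF q(1)] by blast
  then have "i \<noteq> 0"
    using gnorm_prime_elem_ge_2[OF p] by (intro notI) simp
  then have "i = 1 \<or> i = 2"
    using i by auto
  then show ?thesis
    using that q i by auto
qed

text \<open>A prime of norm \<open>q^2\<close> is an associate of the rational prime
  \<open>q\<close>, where the character is 1. Excluding this value excludes the inert primes, whose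
  norms are not squarefree.\<close>

lemma prime_gnorm_of_direction:
  assumes p: "prime_elem p" and h: "hecke 1 p \<noteq> 1"
  shows "prime (gnorm p)"
proof -
  obtain q where q: "prime q" "p dvd of_nat q" "gnorm p = q \<or> gnorm p = q\<^sup>2"
    using gnorm_gint_prime[OF p] .
  have "gnorm p \<noteq> q\<^sup>2"
  proof
    assume *: "gnorm p = q\<^sup>2"
    obtain u where u: "of_nat q = p * u"
      using q(2) by (auto simp: dvd_def)
    have "gnorm p * 1 = gnorm p * gnorm u"
      using * gnorm_of_nat[of q] unfolding u by (simp only: gnorm_mult mult_1_right)
    then have "u dvd 1"
      using p by (simp add: gint_unit_iff)
    then have "hecke 1 (of_nat q) = hecke 1 p"
      by (simp add: u hecke_mult hecke_unit)
    moreover have "hecke 1 (of_nat q) = 1"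
      using prime_gt_0_nat[OF q(1)]
      by (simp add: hecke_def sgn_div_norm scaleR_conv_of_real power_mult_distrib[symmetric])
    ultimately show False
      using h by simp
  qed
  then show ?thesis
    using q by auto
qed

text \<open>Splits a Gaussian prime off an element of norm \<open>n\<close>. Squarefreeness keeps
  its norm from dividing the cofactor, which is the side condition of
  \<open>circ_mean_mult_prime\<close>.\<close>

lemma squarefree_circ_induct [consumes 2, case_names 1 mult]:
  assumes "circ n \<noteq> {}" "squarefree n"
    and "P 1"
    and mult: "\<And>p m. prime_elem p \<Longrightarrow> \<not> gnorm p dvd m \<Longrightarrow> circ m \<noteq> {} \<Longrightarrow> P m \<Longrightarrow> P (gnorm p * m)"
  shows "P n"
  using assms(1,2)
proof (induction n rule: less_induct)
  case (less n)
  have n0: "n > 0"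
    using less.prems(2) by (auto intro: Nat.gr0I)
  show ?case
  proof (cases "n = 1")
    case False
    obtain a where a: "gnorm a = n"
      using less.prems by (auto simp: circ_def)
    then have "a \<noteq> 0" "\<not> a dvd 1"
      using n0 False by (auto simp: gint_unit_iff)
    then obtain p where p: "prime_elem p" "p dvd a"
      using gint_prime_divisor_exists by blast
    obtain b where b: "a = p * b"
      using p by (auto simp: dvd_def)
    define m where "m = gnorm b"
    have n: "n = gnorm p * m"
      using a b by (simp add: m_def)
    have p2: "gnorm p \<ge> 2"
      by (rule gnorm_prime_elem_ge_2[OF p(1)])
    have nd: "\<not> gnorm p dvd m"
    proof
      assume "gnorm p dvd m"
      then have "(gnorm p)\<^sup>2 dvd n"
        unfolding n power2_eq_square by (rule mult_dvd_mono[OF dvd_refl])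
      then show False
        using less.prems(2) p2 by (auto dest: squarefreeD)
    qed
    have ne: "circ m \<noteq> {}"
      by (auto simp: circ_def m_def)
    have lt: "m < n"
    proof -
      have "m > 0"
        using n n0 by (auto intro: Nat.gr0I)
      then show ?thesis
        using mult_le_mono1[OF p2, of m] n by linarith
    qed
    have sf: "squarefree m"
      using less.prems(2) n squarefree_multD by blast
    show ?thesis
      unfolding n by (rule mult[OF p(1) nd ne less.IH[OF lt ne sf]])
  qed (use assms in simp)
qed

subsection \<open>The region of Fourier coefficients\<close>

definition coeff_region :: "real \<Rightarrow> real \<Rightarrow> bool" where
  "coeff_region x y \<longleftrightarrow> \<bar>x\<bar> \<le> 1 \<and> 2 * x\<^sup>2 - 1 \<le> y \<and> y \<le> upper_curve x"

lemma upper_curve_abs: "upper_curve \<bar>x\<bar> = upper_curve x"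
  by (simp add: upper_curve_def)

lemma upper_curve_nonneg: "upper_curve x \<ge> 0"
  unfolding upper_curve_def by (simp add: le_max_iff_disj)

lemma upper_curve_le_1:
  assumes "\<bar>x\<bar> \<le> 1"
  shows "upper_curve x \<le> 1"
proof -
  have "\<bar>x\<bar> ^ 4 \<le> 1"
    using assms by (intro power_le_one) auto
  moreover have "(2 * \<bar>x\<bar> - 1)\<^sup>2 \<le> 1"
    using assms by (simp add: abs_square_le_1 abs_le_iff)
  ultimately show ?thesis
    by (simp add: upper_curve_def)
qed

lemma coeff_region_1: "coeff_region 1 1"
  by (simp add: coeff_region_def upper_curve_def)

text \<open>The sign of d = 2 c^2 - 1 decides which bound on \<open>Y\<close> is used. For d >= 0
  lower bounds yield lower bounds and upper ones upper ones; for d < 0 they change roles, with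
  \<open>Y \<le> 1\<close> serving the lower bound.\<close>

lemma coeff_region_mult:
  assumes R: "coeff_region X Y" and c: "\<bar>c\<bar> \<le> 1"
  shows "coeff_region (X * c) (Y * (2 * c\<^sup>2 - 1))"
proof -
  define d where "d = 2 * c\<^sup>2 - 1"
  have X: "\<bar>X\<bar> \<le> 1" "2 * X\<^sup>2 - 1 \<le> Y" "Y \<le> upper_curve X"
    using R by (auto simp: coeff_region_def)
  have X2: "X\<^sup>2 \<le> 1" and c2: "c\<^sup>2 \<le> 1"
    using X(1) c by (simp_all add: abs_square_le_1)
  have Y1: "Y \<le> 1"
    using X(3) upper_curve_le_1[OF X(1)] by linarith
  have "\<bar>X * c\<bar> \<le> 1"
    unfolding abs_mult using X(1) c by (intro mult_le_one) auto
  moreover have "2 * (X * c)\<^sup>2 - 1 \<le> Y * d"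
  proof (cases "d \<ge> 0")
    case True
    \<comment> \<open>Exactly the difference of the two sides of the next inequality.\<close>
    have "0 \<le> 2 * (1 - X\<^sup>2) * (1 - c\<^sup>2)"
      using X2 c2 by simp
    then have "2 * (X * c)\<^sup>2 - 1 \<le> (2 * X\<^sup>2 - 1) * d"
      by (simp add: d_def power_mult_distrib algebra_simps)
    also have "\<dots> \<le> Y * d"
      using X True by (intro mult_right_mono)
    finally show ?thesis .
  next
    case False
    have "X\<^sup>2 * c\<^sup>2 \<le> 1 * c\<^sup>2"
      using X2 by (intro mult_right_mono) auto
    then have "2 * (X * c)\<^sup>2 - 1 \<le> 1 * d"
      by (simp add: d_def power_mult_distrib)
    also have "\<dots> \<le> Y * d"
      using Y1 False by (intro mult_right_mono_neg) auto
    finally show ?thesis .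
  qed
  moreover have "Y * d \<le> upper_curve (X * c)"
  proof (cases "d \<ge> 0")
    case True
    \<comment> \<open>Equivalent to (1 - c^2)^2 >= 0; this makes the branch x^4 stable.\<close>
    have dc: "d \<le> c ^ 4"
      using zero_le_power2[of "1 - c\<^sup>2"] by (simp add: d_def power2_eq_square power4_eq_xxxx algebra_simps)
    have d1: "d \<le> 1"
      using c2 by (simp add: d_def)
    have "Y * d \<le> upper_curve X * d"
      using X True by (intro mult_right_mono)
    also have "\<dots> \<le> upper_curve (X * c)"
    proof (cases "upper_curve X = X ^ 4")
      case True
      have "X ^ 4 * d \<le> X ^ 4 * c ^ 4"
        using dc by (intro mult_left_mono) auto
      then show ?thesis
        unfolding True by (simp add: upper_curve_def power_mult_distrib)
    next
      case False
      then have ux: "upper_curve X = (1 - 2 * \<bar>X\<bar>)\<^sup>2" and less: "X ^ 4 < (1 - 2 * \<bar>X\<bar>)\<^sup>2"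
        by (auto simp: upper_curve_def max_def power2_commute split: if_splits)
      \<comment> \<open>For |X| >= 1/2 the number 2 |X| - 1 lies between 0 and X^2, so the first
        branch would win. Below 1/2 the second branch decreases in |X|, so replacing X by X c can
        only raise it.\<close>
      have "\<bar>X\<bar> < 1 / 2"
      proof (rule ccontr)
        assume "\<not> \<bar>X\<bar> < 1 / 2"
        moreover have "2 * \<bar>X\<bar> - 1 \<le> \<bar>X\<bar>\<^sup>2"
          using zero_le_power2[of "1 - \<bar>X\<bar>"] by (simp add: power2_eq_square algebra_simps)
        ultimately have "(2 * \<bar>X\<bar> - 1)\<^sup>2 \<le> (\<bar>X\<bar>\<^sup>2)\<^sup>2"
          by (intro power_mono) auto
        then show False
          using less by (simp add: power2_commute power_mult[symmetric])
      qed
      moreover have "\<bar>X * c\<bar> \<le> \<bar>X\<bar>"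
        unfolding abs_mult using c by (simp add: mult_left_le)
      ultimately have "(1 - 2 * \<bar>X\<bar>)\<^sup>2 \<le> (1 - 2 * \<bar>X * c\<bar>)\<^sup>2"
        by (intro power_mono) auto
      moreover have "(1 - 2 * \<bar>X\<bar>)\<^sup>2 * d \<le> (1 - 2 * \<bar>X\<bar>)\<^sup>2 * 1"
        using d1 by (intro mult_left_mono) auto
      ultimately have "(1 - 2 * \<bar>X\<bar>)\<^sup>2 * d \<le> (2 * \<bar>X * c\<bar> - 1)\<^sup>2"
        by (simp add: power2_commute)
      also have "\<dots> \<le> upper_curve (X * c)"
        by (simp add: upper_curve_def)
      finally show ?thesis
        unfolding ux .
    qed
    finally show ?thesis .
  next
    case d: False
    show ?thesis
    proof (cases "Y \<ge> 0")
      case True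
      then have "Y * d \<le> 0"
        using d by (intro mult_nonneg_nonpos) auto
      then show ?thesis
        using upper_curve_nonneg[of "X * c"] by linarith
    next
      case False
      have "Y * d \<le> (2 * X\<^sup>2 - 1) * d"
        using X d by (intro mult_right_mono_neg) auto
      also have "\<dots> = (1 - 2 * \<bar>X\<bar>\<^sup>2) * (1 - 2 * \<bar>c\<bar>\<^sup>2)"
        by (simp add: d_def algebra_simps)
      \<comment> \<open>The sides differ by 2 (|X| - |c|)^2. Two negative second coordinates thus
        lead to the second branch of \<open>upper_curve\<close>.\<close>
      also have "\<dots> \<le> (2 * (\<bar>X\<bar> * \<bar>c\<bar>) - 1)\<^sup>2"
        using zero_le_power2[of "\<bar>X\<bar> - \<bar>c\<bar>"] by (simp add: power2_eq_square algebra_simps)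
      also have "\<dots> \<le> upper_curve (X * c)"
        by (simp add: upper_curve_def abs_mult)
      finally show ?thesis .
    qed
  qed
  ultimately show ?thesis
    by (simp add: coeff_region_def d_def)
qed

lemma circ_mean_in_region:
  assumes "circ n \<noteq> {}" "squarefree n"
  shows "circ_mean k n \<in> \<real> \<and> coeff_region (Re (circ_mean 1 n)) (Re (circ_mean 2 n))"
  using assms
proof (induction n rule: squarefree_circ_induct)
  case 1
  then show ?case
    by (simp add: circ_mean_1[unfolded One_nat_def] coeff_region_1)
next
  case (mult p m)
  have "p \<noteq> 0"
    using mult.hyps by auto
  then show ?case
    using mult coeff_region_mult[OF _ abs_Re_hecke_le[of 1 p], of "Re (circ_mean 1 m)" "Re (circ_mean 2 m)"]
    unfolding circ_mean_mult_prime[OF mult.hyps(1,2)]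
    by (simp add: Re_hecke_2) (simp add: mult.commute)
qed

text \<open>Each factor is realised by a new prime of norm larger than the current \<open>n\<close>,
  so the product stays squarefree; infinitely many primes per direction make this possible.\<close>

lemma circ_mean_approx:
  assumes "\<And>c. c \<in> set cs \<Longrightarrow> \<bar>c\<bar> \<le> 1" "e > 0"
  shows "\<exists>n>0. circ n \<noteq> {} \<and> squarefree n \<and> \<bar>Re (circ_mean 1 n) - prod_list cs\<bar> < e
    \<and> \<bar>Re (circ_mean 2 n) - prod_list (map (\<lambda>c. 2 * c\<^sup>2 - 1) cs)\<bar> < e"
  using assms
proof (induction cs arbitrary: e)
  case Nil
  have "circ 1 \<noteq> {}"
    by (auto simp: circ_def intro: exI[of _ 1])
  then show ?case
    using Nil by (intro exI[of _ 1]) (simp add: circ_mean_1[unfolded One_nat_def])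
next
  case (Cons c cs)
  have c: "\<bar>c\<bar> \<le> 1"
    using Cons.prems by simp
  obtain n where n: "n > 0" "circ n \<noteq> {}" "squarefree n"
    "\<bar>Re (circ_mean 1 n) - prod_list cs\<bar> < e / 2"
    "\<bar>Re (circ_mean 2 n) - prod_list (map (\<lambda>c. 2 * c\<^sup>2 - 1) cs)\<bar> < e / 2"
    using Cons.IH[of "e / 2"] Cons.prems by auto
  \<comment> \<open>Aiming at \<open>c * (1 - h)\<close> with error below \<open>h\<close> keeps the
    value at \<open>p\<close> below 1, so \<open>gnorm p\<close> is a rational prime. The deviation
    from \<open>c\<close> is at most 2h and that from 2 c^2 - 1 at most 8h, which the 16 turns into
    half of \<open>e\<close>.\<close>
  define h where "h = min 1 (e / 16)"
  have h: "0 < h" "h \<le> 1" "16 * h \<le> e"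
    using Cons.prems by (auto simp: h_def)
  have c': "\<bar>c * (1 - h)\<bar> \<le> 1 - h" "\<bar>c * (1 - h) - c\<bar> \<le> h"
  proof -
    show "\<bar>c * (1 - h)\<bar> \<le> 1 - h"
      unfolding abs_mult using mult_right_mono[OF c, of "1 - h"] h by simp
    have "\<bar>c * (1 - h) - c\<bar> = \<bar>c\<bar> * h"
      using h by (simp add: algebra_simps abs_mult)
    then show "\<bar>c * (1 - h) - c\<bar> \<le> h"
      using mult_right_mono[OF c, of h] h by simp
  qed
  have "infinite {p \<in> gint_primes. \<bar>Re (hecke 1 p) - c * (1 - h)\<bar> < h}"
    using c'(1) h by (intro infinite_gint_primes_direction) auto
  then have "\<not> {p \<in> gint_primes. \<bar>Re (hecke 1 p) - c * (1 - h)\<bar> < h} \<subseteq> {a. gnorm a \<le> n}"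
    using finite_subset[OF _ finite_gnorm_le[of n]] by blast
  then obtain p where "p \<in> {p \<in> gint_primes. \<bar>Re (hecke 1 p) - c * (1 - h)\<bar> < h}"
    "p \<notin> {a. gnorm a \<le> n}"
    by blast
  then have p: "p \<in> gint_primes" "\<bar>Re (hecke 1 p) - c * (1 - h)\<bar> < h" "gnorm p > n"
    by auto
  define x where "x = Re (hecke 1 p)"
  have pe: "prime_elem p" "p \<noteq> 0"
    using gint_primes_imp_prime_elem[OF p(1)] by auto
  have "x < 1"
    using p(2) c'(1) unfolding x_def by linarith
  then have pr: "prime (gnorm p)"
    using pe(1) by (intro prime_gnorm_of_direction) (auto simp: x_def)
  have nd: "\<not> gnorm p dvd n"
    using p(3) n(1) by (auto dest: dvd_imp_le)
  have x: "\<bar>x - c\<bar> \<le> 2 * h" "\<bar>x\<bar> \<le> 1"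
    using p(2) c'(2) abs_Re_hecke_le[of 1 p] unfolding x_def by linarith+
  have prod_le: "\<bar>prod_list xs\<bar> \<le> 1" if "\<And>x. x \<in> set xs \<Longrightarrow> \<bar>x\<bar> \<le> 1" for xs :: "real list"
    using that by (induction xs) (auto simp: abs_mult intro!: mult_le_one)
  have prod_diff: "\<bar>u * v - u' * v'\<bar> \<le> \<bar>u - u'\<bar> + \<bar>v - v'\<bar>" if "\<bar>u\<bar> \<le> 1" "\<bar>v'\<bar> \<le> 1" for u v u' v' :: real
  proof -
    have "u * v - u' * v' = u * (v - v') + (u - u') * v'"
      by (simp add: algebra_simps)
    then have "\<bar>u * v - u' * v'\<bar> \<le> \<bar>u\<bar> * \<bar>v - v'\<bar> + \<bar>u - u'\<bar> * \<bar>v'\<bar>"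
      by (metis abs_mult abs_triangle_ineq)
    also have "\<dots> \<le> 1 * \<bar>v - v'\<bar> + \<bar>u - u'\<bar> * 1"
      using that by (intro add_mono mult_mono) auto
    finally show ?thesis
      by simp
  qed
  have sq: "\<bar>2 * u\<^sup>2 - 1\<bar> \<le> 1" if "\<bar>u\<bar> \<le> 1" for u :: real
    using that abs_square_le_1[of u] by (simp add: abs_le_iff)
  have dx: "\<bar>(2 * x\<^sup>2 - 1) - (2 * c\<^sup>2 - 1)\<bar> \<le> 8 * h"
  proof -
    have "\<bar>(2 * x\<^sup>2 - 1) - (2 * c\<^sup>2 - 1)\<bar> = 2 * (\<bar>x - c\<bar> * \<bar>x + c\<bar>)"
    proof -
      have "(2 * x\<^sup>2 - 1) - (2 * c\<^sup>2 - 1) = 2 * ((x - c) * (x + c))"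
        by (simp add: power2_eq_square algebra_simps)
      then show ?thesis
        by (simp only: abs_mult abs_numeral)
    qed
    also have "\<dots> \<le> 2 * ((2 * h) * 2)"
      using x c h by (intro mult_left_mono mult_mono) auto
    finally show ?thesis
      by simp
  qed
  have means: "Re (circ_mean 1 (gnorm p * n)) = x * Re (circ_mean 1 n)"
    "Re (circ_mean 2 (gnorm p * n)) = (2 * x\<^sup>2 - 1) * Re (circ_mean 2 n)"
    using pe nd by (simp_all add: circ_mean_mult_prime Re_hecke_2 x_def)
  show ?case
  proof (intro exI[of _ "gnorm p * n"] conjI)
    show "circ (gnorm p * n) \<noteq> {}" "0 < gnorm p * n"
      using n pe circ_mult_nonempty by auto
    have "coprime (gnorm p) n"
      using pr nd by (rule prime_imp_coprime)
    then show "squarefree (gnorm p * n)"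
      by (rule squarefree_mult_coprime[OF _ squarefree_prime[OF pr] n(3)])
    have "\<bar>x * Re (circ_mean 1 n) - c * prod_list cs\<bar> \<le> \<bar>x - c\<bar> + \<bar>Re (circ_mean 1 n) - prod_list cs\<bar>"
      using Cons.prems x by (intro prod_diff prod_le) auto
    then show "\<bar>Re (circ_mean 1 (gnorm p * n)) - prod_list (c # cs)\<bar> < e"
      using n(4) x h unfolding means by simp
    have "\<bar>(2 * x\<^sup>2 - 1) * Re (circ_mean 2 n)
        - (2 * c\<^sup>2 - 1) * prod_list (map (\<lambda>c. 2 * c\<^sup>2 - 1) cs)\<bar>
      \<le> \<bar>(2 * x\<^sup>2 - 1) - (2 * c\<^sup>2 - 1)\<bar>
        + \<bar>Re (circ_mean 2 n) - prod_list (map (\<lambda>c. 2 * c\<^sup>2 - 1) cs)\<bar>"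
      using Cons.prems x by (intro prod_diff prod_le) (auto intro: sq)
    then show "\<bar>Re (circ_mean 2 (gnorm p * n)) - prod_list (map (\<lambda>c. 2 * c\<^sup>2 - 1) (c # cs))\<bar> < e"
      using n(5) dx h unfolding means by simp
  qed
qed

text \<open>From exp u >= 1 + u one gets 2 x^(2/m) - 1 >= 1 + (4 ln x) / m, and the m-th power of
  the right side tends to exp (4 ln x).\<close>

lemma upper_curve_approx_by_powers:
  assumes x: "0 < x" and e: "e > 0"
  obtains m where "m > 0" "x ^ 4 - e < (2 * (x powr (1 / real m))\<^sup>2 - 1) ^ m"
proof -
  define L where "L = 4 * ln x"
  have "(\<lambda>m. (1 + L / real m) ^ m) \<longlonglongrightarrow> exp L"
    by (rule tendsto_exp_limit_sequentially)
  also have "exp L = x ^ 4"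
    using x by (simp add: L_def exp_of_nat_mult[of 4, simplified])
  finally have "\<forall>\<^sub>F m in sequentially. x ^ 4 - e < (1 + L / real m) ^ m"
    by (rule order_tendstoD) (use e in simp)
  moreover have "\<forall>\<^sub>F m in sequentially. real m > \<bar>L\<bar>"
    using filterlim_real_sequentially by (simp add: filterlim_at_top_dense)
  ultimately have "\<forall>\<^sub>F m in sequentially. x ^ 4 - e < (1 + L / real m) ^ m \<and> real m > \<bar>L\<bar>"
    by eventually_elim auto
  then obtain m where m: "x ^ 4 - e < (1 + L / real m) ^ m" "real m > \<bar>L\<bar>"
    using eventually_happens'[OF sequentially_bot] by blast
  have m0: "m > 0"
    using m(2) by (auto intro: Nat.gr0I)
  have "1 + 2 * ln x / real m \<le> exp (2 * ln x / real m)"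
    by simp
  also have "\<dots> = (x powr (1 / real m))\<^sup>2"
    using x by (simp add: powr_def power2_eq_square flip: exp_add)
  finally have "1 + L / real m \<le> 2 * (x powr (1 / real m))\<^sup>2 - 1"
    by (simp add: L_def)
  \<comment> \<open>The base \<open>1 + L / real m\<close> must be nonnegative for comparing powers;
    this is why \<open>m\<close> was taken above |L|.\<close>
  moreover have "\<bar>L / real m\<bar> < 1"
    using m(2) m0 by (simp add: abs_divide)
  then have "0 \<le> 1 + L / real m"
    by linarith
  ultimately have "(1 + L / real m) ^ m \<le> (2 * (x powr (1 / real m))\<^sup>2 - 1) ^ m"
    by (intro power_mono)
  then show ?thesis
    using that[OF m0] m(1) by linarith
qed

text \<open>With \<open>m\<close> factors \<open>a\<close> and one factor \<open>x / a ^ m\<close> the first coordinate of the product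
  is always \<open>x\<close>, while the second one moves continuously from \<open>2 x\<^sup>2 - 1\<close> (at \<open>a = 1\<close>) to
  the value with \<open>m\<close> equal factors.\<close>

lemma region_point_below_power:
  assumes x: "0 < x" "x \<le> 1" and m: "m > 0"
    and y: "2 * x\<^sup>2 - 1 \<le> y" "y \<le> (2 * (x powr (1 / real m))\<^sup>2 - 1) ^ m"
  shows "\<exists>cs. (\<forall>c\<in>set cs. \<bar>c\<bar> \<le> 1) \<and> prod_list cs = x \<and> prod_list (map (\<lambda>c. 2 * c\<^sup>2 - 1) cs) = y"
proof -
  define b where "b = x powr (1 / real m)"
  define F where "F a = (2 * a\<^sup>2 - 1) ^ m * (2 * (x / a ^ m)\<^sup>2 - 1)" for a :: real
  have b: "0 < b" "b \<le> 1"
    using x m by (auto simp: b_def powr_le1)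
  have bm: "b ^ m = x"
    using x m by (simp add: b_def powr_realpow[symmetric] powr_powr)
  have "\<exists>a. b \<le> a \<and> a \<le> 1 \<and> F a = y"
  proof (rule IVT2')
    show "F 1 \<le> y" "y \<le> F b"
      using y x bm by (simp_all add: F_def b_def[symmetric])
    show "continuous_on {b..1} F"
      unfolding F_def using b by (intro continuous_intros) auto
  qed (use b in auto)
  then obtain a where a: "b \<le> a" "a \<le> 1" "F a = y"
    by blast
  have "x \<le> a ^ m"
    unfolding bm[symmetric] using a b by (intro power_mono) auto
  then have "x / a ^ m \<le> 1"
    using a b by (simp add: divide_le_eq)
  then have "\<forall>c\<in>set ((x / a ^ m) # replicate m a). \<bar>c\<bar> \<le> 1"
    using a b x by (auto simp: abs_le_iff intro: order_trans[of _ 0])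
  moreover have "prod_list ((x / a ^ m) # replicate m a) = x"
    using a b by simp
  moreover have "prod_list (map (\<lambda>c. 2 * c\<^sup>2 - 1) ((x / a ^ m) # replicate m a)) = y"
    using a(3) by (simp add: F_def mult.commute)
  ultimately show ?thesis
    by blast
qed

text \<open>Values up to (2x - 1)^2 are reached exactly with \<open>m = 2\<close>. Above it
  \<open>y\<close> is at most x^4 and a large \<open>m\<close> is used; if \<open>y\<close> still
  exceeds the value of \<open>m\<close> equal factors, it is within \<open>e\<close> of that
  value.\<close>

lemma region_point_approx_pos:
  assumes x: "0 < x" "x \<le> 1" and y: "2 * x\<^sup>2 - 1 \<le> y" "y \<le> upper_curve x" and e: "e > 0"
  shows "\<exists>cs. (\<forall>c\<in>set cs. \<bar>c\<bar> \<le> 1) \<and> prod_list cs = x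
    \<and> \<bar>prod_list (map (\<lambda>c. 2 * c\<^sup>2 - 1) cs) - y\<bar> < e"
proof (cases "y \<le> (2 * x - 1)\<^sup>2")
  case True
  have "(x powr (1 / 2))\<^sup>2 = x"
    using x by (simp add: powr_half_sqrt)
  then have "\<exists>cs. (\<forall>c\<in>set cs. \<bar>c\<bar> \<le> 1) \<and> prod_list cs = x \<and> prod_list (map (\<lambda>c. 2 * c\<^sup>2 - 1) cs) = y"
    using region_point_below_power[OF x, of 2 y] y True by simp
  then show ?thesis
    using e by force
next
  case False
  then have y4: "y \<le> x ^ 4"
    using y(2) x by (simp add: upper_curve_def le_max_iff_disj)
  obtain m where m: "m > 0" "x ^ 4 - e < (2 * (x powr (1 / real m))\<^sup>2 - 1) ^ m"
    using upper_curve_approx_by_powers[OF x(1) e] .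
  define b where "b = x powr (1 / real m)"
  show ?thesis
  proof (cases "y \<le> (2 * b\<^sup>2 - 1) ^ m")
    case True
    then show ?thesis
      using region_point_below_power[OF x m(1) y(1)] e unfolding b_def by force
  next
    case False
    have b: "0 < b" "b \<le> 1"
      using x m by (auto simp: b_def powr_le1)
    have bm: "b ^ m = x"
      using x m(1) by (simp add: b_def powr_realpow[symmetric] powr_powr)
    show ?thesis
      using False b bm m y4 e
      by (intro exI[of _ "replicate m b"]) (auto simp: b_def[symmetric])
  qed
qed

lemma region_point_approx:
  assumes R: "coeff_region x y" and e: "e > 0"
  shows "\<exists>cs. (\<forall>c\<in>set cs. \<bar>c\<bar> \<le> 1) \<and> prod_list cs = x
    \<and> \<bar>prod_list (map (\<lambda>c. 2 * c\<^sup>2 - 1) cs) - y\<bar> < e"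
proof -
  have R: "\<bar>x\<bar> \<le> 1" "2 * x\<^sup>2 - 1 \<le> y" "y \<le> upper_curve x"
    using R by (auto simp: coeff_region_def)
  consider "x = 0" | "x > 0" | "x < 0"
    by linarith
  then show ?thesis
  proof cases
    case 1
    \<comment> \<open>The factors 0 and \<open>b\<close> have second coordinates -1 and -y.\<close>
    define b where "b = sqrt ((1 - y) / 2)"
    have y: "-1 \<le> y" "y \<le> 1"
      using R 1 by (auto simp: upper_curve_def)
    then have "\<bar>b\<bar> \<le> 1" "2 * b\<^sup>2 - 1 = - y"
      by (simp_all add: b_def field_simps)
    then show ?thesis
      using e 1 by (intro exI[of _ "[0, b]"]) simp
  next
    case 2
    then show ?thesis
      using region_point_approx_pos[of x y e] R e by simp
  next
    case 3
    then obtain cs where "\<forall>c\<in>set cs. \<bar>c\<bar> \<le> 1" "prod_list cs = - x"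
      "\<bar>prod_list (map (\<lambda>c. 2 * c\<^sup>2 - 1) cs) - y\<bar> < e"
      using region_point_approx_pos[of "- x" y e] R e upper_curve_abs[of x] by auto
    \<comment> \<open>The extra factor -1 has second coordinate 1 and only flips the sign of the
      first.\<close>
    then show ?thesis
      by (intro exI[of _ "(-1) # cs"]) simp
  qed
qed

lemma region_point_circ_approx:
  assumes R: "coeff_region x y" and e: "e > 0"
  shows "\<exists>n>0. circ n \<noteq> {} \<and> squarefree n \<and> \<bar>Re (circ_mean 1 n) - x\<bar> < e \<and> \<bar>Re (circ_mean 2 n) - y\<bar> < e"
proof -
  obtain cs where cs: "\<And>c. c \<in> set cs \<Longrightarrow> \<bar>c\<bar> \<le> 1" "prod_list cs = x"
    "\<bar>prod_list (map (\<lambda>c. 2 * c\<^sup>2 - 1) cs) - y\<bar> < e / 2"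
    using region_point_approx[OF R, of "e / 2"] e by auto
  obtain n where "n > 0" "circ n \<noteq> {}" "squarefree n" "\<bar>Re (circ_mean 1 n) - prod_list cs\<bar> < e / 2"
    "\<bar>Re (circ_mean 2 n) - prod_list (map (\<lambda>c. 2 * c\<^sup>2 - 1) cs)\<bar> < e / 2"
    using circ_mean_approx[of cs "e / 2"] cs(1) e by auto
  moreover from this have "\<bar>Re (circ_mean 1 n) - x\<bar> < e" "\<bar>Re (circ_mean 2 n) - y\<bar> < e"
    using cs(2,3) e by linarith+
  ultimately show ?thesis
    by blast
qed

subsection \<open>Measures on the circle\<close>

lemma gauss_points_eq: "gauss_points (int m) = of_gint ` circ m"
proof (intro equalityI subsetI)
  fix z assume "z \<in> gauss_points (int m)"
  then obtain a b where ab: "z = Complex (of_int a) (of_int b)" "a\<^sup>2 + b\<^sup>2 = int m"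
    by (auto simp: gauss_points_def)
  then have "z = of_gint (Gint a b)" "Gint a b \<in> circ m"
    by (auto simp: of_gint_def circ_def gnorm_def)
  then show "z \<in> of_gint ` circ m"
    by blast
next
  fix z assume "z \<in> of_gint ` circ m"
  then obtain a where a: "z = of_gint a" "gnorm a = m"
    by (auto simp: circ_def)
  then show "z \<in> gauss_points (int m)"
    using of_int_gnorm[of a] by (auto simp: gauss_points_def of_gint_def)
qed

lemma r2_eq_card_circ: "r2 (int m) = card (circ m)"
  unfolding r2_def gauss_points_eq by (rule card_image) (simp add: inj_on_def)

lemma circ_nonempty_iff: "m > 0 \<Longrightarrow> circ m \<noteq> {} \<longleftrightarrow> int m \<in> sums_of_two_squares"
proof -
  assume m: "m > 0"
  have "circ m \<noteq> {} \<longleftrightarrow> gauss_points (int m) \<noteq> {}"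
    by (simp add: gauss_points_eq)
  also have "\<dots> \<longleftrightarrow> int m \<in> sums_of_two_squares"
    using m by (simp add: gauss_points_def sums_of_two_squares_def eq_commute[of "int m"])
  finally show ?thesis .
qed

lemma sgn_in_sphere: "m > 0 \<Longrightarrow> a \<in> circ m \<Longrightarrow> sgn (of_gint a) \<in> sphere 0 1"
  by (auto simp: circ_def norm_sgn)

text \<open>Both measures give a set the proportion of lattice points whose directions lie in it.
  The default 1 makes the map circle-valued on the whole type, since \<open>sgn 0 = 0\<close> is off
  the circle.\<close>

lemma lattice_measure_eq_distr:
  assumes m: "m > 0" and ne: "circ m \<noteq> {}"
  shows "lattice_measure (int m)
    = distr (measure_pmf (pmf_of_set (circ m))) circle_borel (\<lambda>a. if a \<in> circ m then sgn (of_gint a) else 1)"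
proof (rule measure_eqI)
  let ?g = "\<lambda>a. if a \<in> circ m then sgn (of_gint a) else 1"
  show "sets (lattice_measure (int m)) = sets (distr (measure_pmf (pmf_of_set (circ m))) circle_borel ?g)"
    by simp
  fix A assume "A \<in> sets (lattice_measure (int m))"
  then have A: "A \<in> sets circle_borel"
    by simp
  have g: "?g \<in> measurable (measure_pmf (pmf_of_set (circ m))) circle_borel"
    using sgn_in_sphere[OF m] by auto
  have "emeasure (lattice_measure (int m)) A = ennreal (1 / real (card (circ m))) *
      (\<Sum>a\<in>circ m. emeasure (return circle_borel (of_gint a / of_real (sqrt (real m)))) A)"
    unfolding emeasure_lattice_measure[OF A] r2_eq_card_circ gauss_points_eq
    by (subst sum.reindex) (auto simp: inj_on_def)
  also have "(\<Sum>a\<in>circ m. emeasure (return circle_borel (of_gint a / of_real (sqrt (real m)))) A)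
      = (\<Sum>a\<in>circ m. indicator (?g -` A) a)"
    using A by (intro sum.cong refl)
      (auto simp: circ_def sgn_div_norm norm_of_gint scaleR_conv_of_real divide_inverse mult.commute
        indicator_def)
  also have "\<dots> = of_nat (card (circ m \<inter> ?g -` A))"
    by (simp add: indicator_def sum.If_cases) (rule arg_cong[where f = card], auto)
  also have "ennreal (1 / real (card (circ m))) * of_nat (card (circ m \<inter> ?g -` A))
      = ennreal (real (card (circ m \<inter> ?g -` A)) / real (card (circ m)))"
    by (simp add: ennreal_of_nat_eq_real_of_nat ennreal_mult[symmetric])
  also have "\<dots> = emeasure (measure_pmf (pmf_of_set (circ m))) (?g -` A)"
    using ne by (simp add: emeasure_pmf_of_set)
  also have "\<dots> = emeasure (distr (measure_pmf (pmf_of_set (circ m))) circle_borel ?g) A"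
    using A g by (simp add: emeasure_distr)
  finally show "emeasure (lattice_measure (int m)) A
      = emeasure (distr (measure_pmf (pmf_of_set (circ m))) circle_borel ?g) A" .
qed

lemma borel_measurable_circle:
  fixes f :: "complex \<Rightarrow> 'a :: topological_space"
  shows "continuous_on (sphere 0 1) f \<Longrightarrow> f \<in> borel_measurable circle_borel"
  unfolding circle_borel_def by (rule borel_measurable_continuous_on_restrict)

lemma integral_lattice_measure:
  fixes f :: "complex \<Rightarrow> real"
  assumes m: "m > 0" and ne: "circ m \<noteq> {}" and f: "continuous_on (sphere 0 1) f"
  shows "(\<integral>z. f z \<partial>lattice_measure (int m)) = (\<Sum>a\<in>circ m. f (sgn (of_gint a))) / card (circ m)"
proof -
  let ?g = "\<lambda>a. if a \<in> circ m then sgn (of_gint a) else 1"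
  have g: "?g \<in> measurable (measure_pmf (pmf_of_set (circ m))) circle_borel"
    using sgn_in_sphere[OF m] by auto
  have "(\<integral>z. f z \<partial>lattice_measure (int m)) = (\<integral>a. f (?g a) \<partial>measure_pmf (pmf_of_set (circ m)))"
    unfolding lattice_measure_eq_distr[OF m ne] using g
    by (intro integral_distr borel_measurable_circle f)
  also have "\<dots> = (\<Sum>a\<in>circ m. f (?g a)) / card (circ m)"
    using ne by (subst integral_pmf_of_set) auto
  finally show ?thesis
    by (simp cong: sum.cong)
qed

text \<open>On the circle 1/z is the conjugate of z, whence \<open>cnj\<close>. Test functions are
  real valued, so the real and imaginary parts of z^(4k) are treated separately.\<close>

lemma circle_weak_conv_fourier:
  assumes "circle_prob_measure \<mu>" and conv: "circle_weak_conv (\<lambda>j. lattice_measure (int (n j))) \<mu>"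
    and n: "\<And>j. n j > 0" "\<And>j. circ (n j) \<noteq> {}"
  shows "(\<lambda>j. circ_mean k (n j)) \<longlonglongrightarrow> cnj (fourier_coeff \<mu> (4 * int k))"
proof -
  interpret \<mu>: prob_space \<mu>
    using assms by (simp add: circle_prob_measure_def)
  have sets: "sets \<mu> = sets circle_borel"
    using assms by (simp add: circle_prob_measure_def)
  have space: "space \<mu> = sphere 0 1"
    using sets_eq_imp_space_eq[OF sets] by simp
  define f where "f z = z ^ (4 * k)" for z :: complex
  have f: "continuous_on A f" for A
    unfolding f_def by (intro continuous_intros)
  have cRe: "continuous_on A (\<lambda>z. Re (f z))" and cIm: "continuous_on A (\<lambda>z. Im (f z))" for A
    by (intro continuous_intros f)+
  have meas: "f \<in> borel_measurable \<mu>"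
    using borel_measurable_circle[OF f] by (simp add: measurable_cong_sets[OF sets refl])
  have "AE z in \<mu>. norm (f z) \<le> 1"
    using space by (intro AE_I2) (simp add: f_def norm_power)
  then have int: "integrable \<mu> f"
    by (intro \<mu>.integrable_const_bound[where B = 1] meas)
  have "fourier_coeff \<mu> (4 * int k) = (\<integral>z. cnj (f z) \<partial>\<mu>)"
    unfolding fourier_coeff_def
  proof (rule Bochner_Integration.integral_cong[OF refl])
    fix z assume "z \<in> space \<mu>"
    then have z: "norm z = 1"
      using space by simp
    then have "z * cnj z = 1"
      by (simp flip: complex_norm_square)
    then have "inverse z = cnj z"
      by (rule inverse_unique)
    then show "z powi (- (4 * int k)) = cnj (f z)"
      by (simp add: f_def power_int_minus power_int_def nat_mult_distrib power_inverse[symmetric])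
  qed
  then have four: "cnj (fourier_coeff \<mu> (4 * int k)) = (\<integral>z. f z \<partial>\<mu>)"
    by simp
  have mean: "(\<integral>z. Re (f z) \<partial>lattice_measure (int (n j))) = Re (circ_mean k (n j))"
    "(\<integral>z. Im (f z) \<partial>lattice_measure (int (n j))) = Im (circ_mean k (n j))" for j
    using integral_lattice_measure[OF n cRe, of j] integral_lattice_measure[OF n cIm, of j]
    by (simp_all add: circ_mean_def hecke_def f_def Re_divide_of_nat Im_divide_of_nat)
  have "(\<lambda>j. Re (circ_mean k (n j))) \<longlonglongrightarrow> (\<integral>z. Re (f z) \<partial>\<mu>)"
    "(\<lambda>j. Im (circ_mean k (n j))) \<longlonglongrightarrow> (\<integral>z. Im (f z) \<partial>\<mu>)"
    using conv cRe cIm unfolding circle_weak_conv_def mean[symmetric] by blast+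
  then have "(\<lambda>j. Re (circ_mean k (n j))) \<longlonglongrightarrow> Re (\<integral>z. f z \<partial>\<mu>)"
    "(\<lambda>j. Im (circ_mean k (n j))) \<longlonglongrightarrow> Im (\<integral>z. f z \<partial>\<mu>)"
    using int by simp_all
  then show ?thesis
    unfolding four tendsto_complex_iff by simp
qed

text \<open>Helly's theorem concerns the real line: the directions are moved there by
  \<open>Arg\<close>, and the limit returns by \<open>cis\<close>. The jump of \<open>Arg\<close>
  does no harm, because test functions become \<open>f (cis t)\<close>, continuous and bounded on
  the line.\<close>

lemma circle_weak_conv_subseq:
  assumes n: "\<And>j. n j > 0" "\<And>j. circ (n j) \<noteq> {}"
  obtains r \<mu> where "strict_mono (r :: nat \<Rightarrow> nat)" "circle_prob_measure \<mu>"
    "circle_weak_conv (\<lambda>j. lattice_measure (int (n (r j)))) \<mu>"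
proof -
  define g where "g a = Arg (sgn (of_gint a))" for a
  define \<nu> where "\<nu> j = distr (measure_pmf (pmf_of_set (circ (n j)))) borel g" for j
  have real_distr: "real_distribution (\<nu> j)" for j
    unfolding \<nu>_def real_distribution_def real_distribution_axioms_def
    by (auto intro!: measure_pmf.prob_space_distr)
  have "tight \<nu>"
    unfolding tight_def
  proof (intro conjI allI impI real_distr)
    fix e :: real assume e: "e > 0"
    \<comment> \<open>Arguments are bounded by pi < 4, so no mass escapes.\<close>
    have "measure (\<nu> j) {-4<..4} = 1" for j
    proof -
      have "g a \<in> {-4<..4}" for a
        using Arg_bounded[of "sgn (of_gint a)"] pi_less_4 by (auto simp: g_def)
      then have "g -` {-4<..4} = UNIV"
        by auto
      then show ?thesis
        by (simp add: \<nu>_def measure_distr)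
    qed
    then show "\<exists>a b. a < b \<and> (\<forall>j. 1 - e < measure (\<nu> j) {a<..b})"
      using e by (intro exI[of _ "-4"] exI[of _ 4]) simp
  qed
  from tight_imp_convergent_subsubsequence[OF this strict_mono_id]
  obtain r M where r: "strict_mono r" and M: "real_distribution M" and wc: "weak_conv_m (\<nu> \<circ> id \<circ> r) M"
    by blast
  interpret M: real_distribution M
    by (rule M)
  have cis: "cis \<in> measurable M circle_borel"
  proof -
    have "cis \<in> borel_measurable borel"
      by (intro borel_measurable_continuous_onI continuous_intros)
    then have "cis \<in> borel_measurable M"
      by (simp add: measurable_cong_sets[OF M.events_eq_borel refl])
    then show ?thesis
      unfolding circle_borel_def by (intro measurable_restrict_space2) auto
  qed
  define \<mu> where "\<mu> = distr M circle_borel cis"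
  have "circle_prob_measure \<mu>"
    unfolding circle_prob_measure_def \<mu>_def using cis by (auto intro: M.prob_space_distr)
  moreover have "circle_weak_conv (\<lambda>j. lattice_measure (int (n (r j)))) \<mu>"
    unfolding circle_weak_conv_def
  proof (intro allI impI)
    fix f :: "complex \<Rightarrow> real" assume f: "continuous_on (sphere 0 1) f"
    have cont: "continuous_on UNIV (\<lambda>t. f (cis t))"
      by (rule continuous_on_compose2[OF f]) (auto intro: continuous_intros)
    have "compact (f ` sphere 0 1)"
      using f by (intro compact_continuous_image) auto
    then obtain B where B: "\<And>z. z \<in> sphere 0 1 \<Longrightarrow> \<bar>f z\<bar> \<le> B"
      using compact_imp_bounded bounded_iff by (metis image_eqI real_norm_def)
    have "(\<lambda>j. integral\<^sup>L ((\<nu> \<circ> id \<circ> r) j) (\<lambda>t. f (cis t))) \<longlonglongrightarrow> integral\<^sup>L M (\<lambda>t. f (cis t))"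
    proof (rule weak_conv_imp_integral_bdd_continuous_conv)
      show "real_distribution ((\<nu> \<circ> id \<circ> r) j)" for j
        using real_distr by simp
      show "isCont (\<lambda>t. f (cis t)) t" for t
        using cont by (simp add: continuous_on_eq_continuous_at)
      show "norm (f (cis t)) \<le> B" for t
        using B[of "cis t"] by simp
    qed (rule M wc)+
    moreover have "integral\<^sup>L M (\<lambda>t. f (cis t)) = integral\<^sup>L \<mu> f"
      unfolding \<mu>_def using cis by (intro integral_distr[symmetric] borel_measurable_circle f)
    moreover have "integral\<^sup>L (\<nu> j) (\<lambda>t. f (cis t)) = integral\<^sup>L (lattice_measure (int (n j))) f" for j
    proof -
      have "integral\<^sup>L (\<nu> j) (\<lambda>t. f (cis t)) = (\<integral>a. f (cis (g a)) \<partial>measure_pmf (pmf_of_set (circ (n j))))"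
        unfolding \<nu>_def using cont by (intro integral_distr borel_measurable_continuous_onI) auto
      also have "\<dots> = (\<Sum>a\<in>circ (n j). f (cis (g a))) / card (circ (n j))"
        using n by (subst integral_pmf_of_set) auto
      also have "(\<Sum>a\<in>circ (n j). f (cis (g a))) = (\<Sum>a\<in>circ (n j). f (sgn (of_gint a)))"
      proof (intro sum.cong refl)
        fix a assume "a \<in> circ (n j)"
        then have "a \<noteq> 0"
          using n(1)[of j] by (auto simp: circ_def)
        then show "f (cis (g a)) = f (sgn (of_gint a))"
          unfolding g_def by (subst cis_Arg) (simp_all add: sgn_zero_iff)
      qed
      finally show ?thesis
        using integral_lattice_measure[OF n f] by simp
    qed
    ultimately show "(\<lambda>j. integral\<^sup>L (lattice_measure (int (n (r j)))) f) \<longlonglongrightarrow> integral\<^sup>L \<mu> f"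
      by simp
  qed
  ultimately show ?thesis
    using that r by blast
qed

section \<open>Transfer between integers and naturals, and passage to the limit\<close>

lemma sums_of_two_squares_pos: "n \<in> sums_of_two_squares \<Longrightarrow> n > 0"
  by (auto simp: sums_of_two_squares_def sum_power2_gt_zero_iff)

lemma squarefree_int_iff: "squarefree (int n) \<longleftrightarrow> squarefree n"
proof
  assume *: "squarefree (int n)"
  show "squarefree n"
  proof (rule squarefreeI)
    fix x assume "x\<^sup>2 dvd n"
    then have "(int x)\<^sup>2 dvd int n"
      by (metis of_nat_dvd_iff of_nat_power)
    then show "x dvd 1"
      using squarefreeD[OF *] by fastforce
  qed
next
  assume *: "squarefree n"
  show "squarefree (int n)"
  proof (rule squarefreeI)
    fix x :: int assume "x\<^sup>2 dvd int n"
    moreover have "int ((nat \<bar>x\<bar>)\<^sup>2) = x\<^sup>2"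
      by simp
    ultimately have "(nat \<bar>x\<bar>)\<^sup>2 dvd n"
      by (metis of_nat_dvd_iff)
    then have "nat \<bar>x\<bar> dvd 1"
      by (rule squarefreeD[OF *])
    then show "x dvd 1"
      by (simp add: nat_abs_dvd_iff)
  qed
qed

theorem theorem1p4:
  shows "(\<forall>\<mu>. squarefree_attainable \<mu> \<longrightarrow>
            fourier_coeff \<mu> 4 \<in> \<real> \<and> fourier_coeff \<mu> 8 \<in> \<real> \<and>
            2 * (Re (fourier_coeff \<mu> 4))\<^sup>2 - 1 \<le> Re (fourier_coeff \<mu> 8) \<and>
            Re (fourier_coeff \<mu> 8) \<le> upper_curve (Re (fourier_coeff \<mu> 4)))
       \<and> (\<forall>x y :: real. \<bar>x\<bar> \<le> 1 \<and> 2 * x\<^sup>2 - 1 \<le> y \<and> y \<le> upper_curve x \<longrightarrow>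
            (\<exists>\<mu>. squarefree_attainable \<mu> \<and>
               fourier_coeff \<mu> 4 = complex_of_real x \<and> fourier_coeff \<mu> 8 = complex_of_real y))"
proof (intro conjI[of "\<forall>\<mu>. _ \<mu>"] allI impI)
  fix \<mu> assume "squarefree_attainable \<mu>"
  then obtain n where \<mu>: "circle_prob_measure \<mu>"
    and n: "\<And>j. n j \<in> sums_of_two_squares" "\<And>j. squarefree (n j)"
    and conv: "circle_weak_conv (\<lambda>j. lattice_measure (n j)) \<mu>"
    by (auto simp: squarefree_attainable_def)
  define N where "N j = nat (n j)" for j
  have nN: "n = (\<lambda>j. int (N j))"
    using sums_of_two_squares_pos[OF n(1)] by (auto simp: N_def fun_eq_iff less_imp_le)
  have N: "N j > 0" "circ (N j) \<noteq> {}" "squarefree (N j)" for j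
    using sums_of_two_squares_pos[OF n(1), of j] n[of j] circ_nonempty_iff[of "N j"]
    by (auto simp: nN squarefree_int_iff)
  have lim: "(\<lambda>j. circ_mean k (N j)) \<longlonglongrightarrow> cnj (fourier_coeff \<mu> (4 * int k))" for k
    by (rule circle_weak_conv_fourier[OF \<mu>]) (use conv N in \<open>simp_all add: nN\<close>)
  have R: "circ_mean k (N j) \<in> \<real>" "coeff_region (Re (circ_mean 1 (N j))) (Re (circ_mean 2 (N j)))" for j k
    using circ_mean_in_region[OF N(2,3)] by auto
  \<comment> \<open>The reals are closed in the plane, so realness passes from the means to the
    limits.\<close>
  have "cnj (fourier_coeff \<mu> (4 * int k)) \<in> \<real>" for k
    by (rule closed_sequentially[OF closed_complex_Reals _ lim]) (rule R)
  from this[of 1] this[of 2] have real: "fourier_coeff \<mu> 4 \<in> \<real>" "fourier_coeff \<mu> 8 \<in> \<real>"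
    by (simp_all add: complex_is_Real_iff)
  define X Y where "X j = Re (circ_mean 1 (N j))" and "Y j = Re (circ_mean 2 (N j))" for j
  have "X \<longlonglongrightarrow> Re (fourier_coeff \<mu> 4)" "Y \<longlonglongrightarrow> Re (fourier_coeff \<mu> 8)"
    using tendsto_Re[OF lim[of 1]] tendsto_Re[OF lim[of 2]] by (simp_all add: X_def[abs_def] Y_def[abs_def])
  note XY = this
  have region: "2 * (X j)\<^sup>2 - 1 \<le> Y j" "Y j \<le> max (X j ^ 4) ((2 * \<bar>X j\<bar> - 1)\<^sup>2)" for j
    using R(2)[of j] by (simp_all add: X_def Y_def coeff_region_def upper_curve_def)
  have "2 * (Re (fourier_coeff \<mu> 4))\<^sup>2 - 1 \<le> Re (fourier_coeff \<mu> 8)"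
    by (rule LIMSEQ_le[of "\<lambda>j. 2 * (X j)\<^sup>2 - 1" _ Y])
      (use region(1) in \<open>auto intro!: tendsto_intros XY\<close>)
  moreover have "Re (fourier_coeff \<mu> 8) \<le> upper_curve (Re (fourier_coeff \<mu> 4))"
    unfolding upper_curve_def
    by (rule LIMSEQ_le[of Y _ "\<lambda>j. max (X j ^ 4) ((2 * \<bar>X j\<bar> - 1)\<^sup>2)"])
      (use region(2) in \<open>auto intro!: tendsto_intros XY\<close>)
  ultimately show "fourier_coeff \<mu> 4 \<in> \<real> \<and> fourier_coeff \<mu> 8 \<in> \<real> \<and>
      2 * (Re (fourier_coeff \<mu> 4))\<^sup>2 - 1 \<le> Re (fourier_coeff \<mu> 8) \<and>
      Re (fourier_coeff \<mu> 8) \<le> upper_curve (Re (fourier_coeff \<mu> 4))"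
    using real by blast
next
  fix x y :: real
  assume "\<bar>x\<bar> \<le> 1 \<and> 2 * x\<^sup>2 - 1 \<le> y \<and> y \<le> upper_curve x"
  then have R: "coeff_region x y"
    by (simp add: coeff_region_def)
  \<comment> \<open>Both means converge along the whole sequence chosen here, so whichever
    subsequence compactness selects, its limit measure has the prescribed coefficients.\<close>
  have "\<forall>j. \<exists>n>0. circ n \<noteq> {} \<and> squarefree n \<and> \<bar>Re (circ_mean 1 n) - x\<bar> < inverse (real (Suc j))
      \<and> \<bar>Re (circ_mean 2 n) - y\<bar> < inverse (real (Suc j))"
    by (intro allI region_point_circ_approx R) simp
  then obtain n where n: "\<And>j. n j > 0" "\<And>j. circ (n j) \<noteq> {}" "\<And>j. squarefree (n j)"
    "\<And>j. \<bar>Re (circ_mean 1 (n j)) - x\<bar> < inverse (real (Suc j))"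
    "\<And>j. \<bar>Re (circ_mean 2 (n j)) - y\<bar> < inverse (real (Suc j))"
    by metis
  obtain r \<mu> where r: "strict_mono r" and \<mu>: "circle_prob_measure \<mu>"
    and conv: "circle_weak_conv (\<lambda>j. lattice_measure (int (n (r j)))) \<mu>"
    by (rule circle_weak_conv_subseq[OF n(1,2)])
  have lim: "(\<lambda>j. circ_mean k (n (r j))) \<longlonglongrightarrow> cnj (fourier_coeff \<mu> (4 * int k))" for k
    by (rule circle_weak_conv_fourier[OF \<mu> conv n(1,2)])
  have coeff: "fourier_coeff \<mu> (4 * int k) = of_real u"
    if u: "\<And>j. \<bar>Re (circ_mean k (n j)) - u\<bar> < inverse (real (Suc j))" for k u
  proof -
    have "(\<lambda>j. Re (circ_mean k (n j)) - u) \<longlonglongrightarrow> 0"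
      by (rule Lim_null_comparison[OF _ LIMSEQ_inverse_real_of_nat])
        (use u in \<open>auto intro!: always_eventually less_imp_le\<close>)
    then have "(\<lambda>j. Re (circ_mean k (n j))) \<longlonglongrightarrow> u"
      by (simp add: LIM_zero_iff)
    from LIMSEQ_subseq_LIMSEQ[OF this r]
    have "(\<lambda>j. of_real (Re (circ_mean k (n (r j)))) :: complex) \<longlonglongrightarrow> of_real u"
      unfolding o_def by (rule tendsto_of_real)
    also have "(\<lambda>j. of_real (Re (circ_mean k (n (r j)))) :: complex) = (\<lambda>j. circ_mean k (n (r j)))"
      using circ_mean_in_region[OF n(2,3), of k] by (auto simp: fun_eq_iff)
    finally have "cnj (fourier_coeff \<mu> (4 * int k)) = of_real u"
      by (rule LIMSEQ_unique[OF lim])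
    then show ?thesis
      by (metis complex_cnj_cnj complex_cnj_complex_of_real)
  qed
  have "squarefree_attainable \<mu>"
    unfolding squarefree_attainable_def using \<mu> conv n circ_nonempty_iff
    by (auto intro!: exI[of _ "\<lambda>j. int (n (r j))"] simp: squarefree_int_iff)
  then show "\<exists>\<mu>. squarefree_attainable \<mu> \<and>
      fourier_coeff \<mu> 4 = complex_of_real x \<and> fourier_coeff \<mu> 8 = complex_of_real y"
    using coeff[OF n(4)] coeff[OF n(5)] by (intro exI[of _ \<mu>]) simp
qed

end
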